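(* Let $X=\{X_Q\}_Q$ be a family of normalized quasi-Banach function spaces, indexed by the cubes $Q\subset\mathbb{R}^n$, and let $\eta,\gamma\in(0,1)$. The following statements are equivalent: (i) $\mathrm{BMO}\hookrightarrow\mathrm{BMO}_X$, i.e. there is a constant $C_1>0$ such that $\|f\|_{\mathrm{BMO}_X}\le C_1\|f\|_{\mathrm{BMO}}$ for all $f\in\mathrm{BMO}$. (ii) There is a constant $C_2>0$ such that for every cube $Q$ and any $\eta$-sparse family $\mathcal{F}\subset\mathcal{D}(Q)$ we have $$\Big\|\sum_{P\in\mathcal{F}}\chi_P\Big\|_{X_Q}\le C_2.$$ (iii) There is a constant $C_3>0$ such that for every cube $Q$ and any sequence of nested measurable sets $\Omega_k\subset Q$, $k=0,1,2,\dots$ (that is, $\Omega_{k+1}\subset\Omega_k$) satisfying $|\Omega_k|\le\gamma^k|Q|$ for all $k$, we have $$\Big\|\sum_{k=0}^\infty\chi_{\Omega_k}\Big\|_{X_Q}\le C_3.$$ (iv) There is a constant $C_4>0$ such that for any cube $Q$ and $f\in\exp L(Q)$ we have $\|f\|_{X_Q}\le C_4\|f\|_{\exp L(Q)}$. Moreover, $C_1\simeq C_2\simeq C_3\simeq C_4$ for the best constants in (i)–(iv), with implicit constants depending only on $n$, $\eta$, $\gamma$ and the constants in the normalization $\|\chi_Q\|_{X_Q}\simeq1$.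
   Context: Cubes $Q\subset\mathbb{R}^n$ have sides parallel to the axes, and $\langle f\rangle_Q:=\frac1{|Q|}\int_Q f$. A quasi-Banach function space over a cube $Q$ is an order ideal $X_Q$ of the space of measurable functions $Q\to\mathbb{R}$, equipped with a quasi-norm $\|\cdot\|_{X_Q}$, such that: (Compatibility) if $f,g\in X_Q$ and $|f|\le|g|$ then $\|f\|_{X_Q}\le\|g\|_{X_Q}$; (Weak order unit) there is $f\in X_Q$ with $f>0$ a.e.; (Fatou property) if $0\le f_m\uparrow f$ with $f_m \in X_Q$ and $\sup_m\|f_m\|_{X_Q}<\infty$, then $f\in X_Q$ and $\|f\|_{X_Q}=\sup_m\|f_m\|_{X_Q}$. We put $\|f\|_{X_Q}=\infty$ if $f\notin X_Q$; for $f$ defined on $\mathbb{R}^n$, $\|f\|_{X_Q}$ means the quasi-norm of the restriction of $f$ to $Q$. $X=\{X_Q\}$ is a family of normalized quasi-Banach function spaces if for every cube $Q$, $X_Q$ is a quasi-Banach function space over $Q$ and $\|\chi_Q\|_{X_Q}\simeq1$, with constants independent of $Q$. $\mathrm{BMO}$ is the space of locally integrable $f:\mathbb{R}^n\to\mathbb{R}$ with $\|f\|_{\mathrm{BMO}}:=\sup_Q\frac1{|Q|}\int_Q|f-\langle f\rangle_Q|<\infty$. $\mathrm{BMO}_X$ is the space of locally integrable $f:\mathbb{R}^n\to\mathbb{R}$ with $\|f\|_{\mathrm{BMO}_X}:=\sup_Q\|f-\langle f\rangle_Q\|_{X_Q}<\infty$. $\mathcal{D}(Q)$ denotes the set of all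 dyadic cubes with respect to $Q$: the cubes obtained by repeated subdivision of $Q$ and each of its descendants into $2^n$ congruent subcubes (including $Q$ itself). A family $\mathcal{F}\subset\mathcal{D}(Q)$ is $\eta$-sparse if $|E_P|\ge\eta|P|$ for all $P\in\mathcal{F}$, where $E_P:=P\setminus\bigcup_{P'\in\mathcal{F}:\,P'\subsetneq P}P'$. $\exp L(Q)$ is the space of measurable $f$ on $Q$ with $\|f\|_{\exp L(Q)}:=\inf\{\alpha>0:\frac1{|Q|}\int_Q(e^{|f|/\alpha}-1)\,dx\le1\}<\infty$. *)

theory Defs
  imports "HOL-Analysis.Analysis"
begin

section \<open>Cubes and dyadic subdivision\<close>

text \<open>Cubes are taken half-open, so that subdividing a cube gives a genuine partition.  Closed
  or open cubes would differ by null sets only.\<close>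

definition cube :: "real^'n \<Rightarrow> real \<Rightarrow> (real^'n) set" where
  "cube a l = {x. \<forall>i. a $ i \<le> x $ i \<and> x $ i < a $ i + l}"

definition cubes :: "(real^'n) set set" where
  "cubes = {cube a l | a l. l > 0}"

definition subcubes :: "(real^'n) set \<Rightarrow> (real^'n) set set" where
  "subcubes P = {cube (\<chi> i. if i \<in> S then a $ i + l / 2 else a $ i) (l / 2) | a l S.
                   l > 0 \<and> P = cube a l}"

inductive_set dyadic_cubes :: "(real^'n) set \<Rightarrow> (real^'n) set set" for Q where
  self: "Q \<in> dyadic_cubes Q"
| child: "P \<in> dyadic_cubes Q \<Longrightarrow> P' \<in> subcubes P \<Longrightarrow> P' \<in> dyadic_cubes Q"

definition sparse :: "real \<Rightarrow> (real^'n) set set \<Rightarrow> bool" where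
  "sparse \<eta> \<F> \<longleftrightarrow>
     (\<forall>P\<in>\<F>. measure lebesgue (P - \<Union>{P' \<in> \<F>. P' \<subset> P}) \<ge> \<eta> * measure lebesgue P)"


section \<open>Quasi-Banach function spaces over a set\<close>

text \<open>Functions on \<open>Q\<close> are represented by total functions, of which only the
  almost-everywhere class on \<open>Q\<close> matters: all order relations below are almost everywhere
  on \<open>Q\<close>, so membership and quasi-norm are invariant under changing a function on a null
  subset of \<open>Q\<close> or outside \<open>Q\<close>.\<close>

record 'a fun_space =
  members :: "('a \<Rightarrow> real) set"
  qnorm :: "('a \<Rightarrow> real) \<Rightarrow> real"

definition order_ideal :: "(real^'n) set \<Rightarrow> (real^'n \<Rightarrow> real) set \<Rightarrow> bool" where
  "order_ideal Q S \<longleftrightarrow>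
     S \<subseteq> borel_measurable (lebesgue_on Q) \<and>
     (\<lambda>x. 0) \<in> S \<and>
     (\<forall>f\<in>S. \<forall>g\<in>S. (\<lambda>x. f x + g x) \<in> S) \<and>
     (\<forall>f\<in>S. \<forall>c. (\<lambda>x. c * f x) \<in> S) \<and>
     (\<forall>g\<in>S. \<forall>f\<in>borel_measurable (lebesgue_on Q).
        (AE x in lebesgue_on Q. \<bar>f x\<bar> \<le> \<bar>g x\<bar>) \<longrightarrow> f \<in> S)"

definition quasi_norm ::
    "(real^'n) set \<Rightarrow> (real^'n \<Rightarrow> real) set \<Rightarrow> ((real^'n \<Rightarrow> real) \<Rightarrow> real) \<Rightarrow> bool" where
  "quasi_norm Q S N \<longleftrightarrow>
     (\<forall>f\<in>S. 0 \<le> N f) \<and>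
     (\<forall>f\<in>S. N f = 0 \<longleftrightarrow> (AE x in lebesgue_on Q. f x = 0)) \<and>
     (\<forall>f\<in>S. \<forall>c. N (\<lambda>x. c * f x) = \<bar>c\<bar> * N f) \<and>
     (\<exists>K\<ge>1. \<forall>f\<in>S. \<forall>g\<in>S. N (\<lambda>x. f x + g x) \<le> K * (N f + N g))"

text \<open>Completeness is not listed separately: it follows from the Fatou property.\<close>

definition quasi_banach_function_space :: "(real^'n) set \<Rightarrow> (real^'n) fun_space \<Rightarrow> bool" where
  "quasi_banach_function_space Q X \<longleftrightarrow>
     order_ideal Q (members X) \<and>
     quasi_norm Q (members X) (qnorm X) \<and>
     \<comment> \<open>compatibility\<close>
     (\<forall>f\<in>members X. \<forall>g\<in>members X.
        (AE x in lebesgue_on Q. \<bar>f x\<bar> \<le> \<bar>g x\<bar>) \<longrightarrow> qnorm X f \<le> qnorm X g) \<and>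
     \<comment> \<open>weak order unit\<close>
     (\<exists>f\<in>members X. AE x in lebesgue_on Q. f x > 0) \<and>
     \<comment> \<open>Fatou property\<close>
     (\<forall>F f. (\<forall>m. F m \<in> members X) \<and> f \<in> borel_measurable (lebesgue_on Q) \<and>
        (AE x in lebesgue_on Q. (\<forall>m. 0 \<le> F m x) \<and> incseq (\<lambda>m. F m x) \<and>
                                (\<lambda>m. F m x) \<longlonglongrightarrow> f x) \<and>
        bdd_above (range (\<lambda>m. qnorm X (F m))) \<longrightarrow>
        f \<in> members X \<and> qnorm X f = (SUP m. qnorm X (F m)))"

definition ext_norm :: "'a fun_space \<Rightarrow> ('a \<Rightarrow> real) \<Rightarrow> ennreal" where
  "ext_norm X f = (if f \<in> members X then ennreal (qnorm X f) else \<infinity>)"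

text \<open>The quasi-triangle constant may depend on \<open>Q\<close>; only the normalization constants
  are uniform.\<close>

definition normalized_with ::
    "real \<Rightarrow> real \<Rightarrow> ((real^'n) set \<Rightarrow> (real^'n) fun_space) \<Rightarrow> bool" where
  "normalized_with c0 c1 X \<longleftrightarrow>
     (\<forall>Q\<in>cubes. quasi_banach_function_space Q (X Q) \<and>
        ennreal c0 \<le> ext_norm (X Q) (indicator Q) \<and>
        ext_norm (X Q) (indicator Q) \<le> ennreal c1)"

definition normalized_family :: "((real^'n) set \<Rightarrow> (real^'n) fun_space) \<Rightarrow> bool" where
  "normalized_family X \<longleftrightarrow> (\<exists>c0>0. \<exists>c1>0. normalized_with c0 c1 X)"


section \<open>BMO and exponential integrability\<close>

definition avg :: "(real^'n) set \<Rightarrow> (real^'n \<Rightarrow> real) \<Rightarrow> real" where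
  "avg Q f = (LINT x|lebesgue_on Q. f x) / measure lebesgue Q"

definition locally_integrable :: "(real^'n \<Rightarrow> real) \<Rightarrow> bool" where
  "locally_integrable f \<longleftrightarrow> (\<forall>K. compact K \<longrightarrow> f absolutely_integrable_on K)"

definition bmo_norm :: "(real^'n \<Rightarrow> real) \<Rightarrow> ennreal" where
  "bmo_norm f = (SUP Q\<in>cubes. ennreal (avg Q (\<lambda>x. \<bar>f x - avg Q f\<bar>)))"

definition BMO :: "(real^'n \<Rightarrow> real) set" where
  "BMO = {f. locally_integrable f \<and> bmo_norm f < \<infinity>}"

definition bmo_X_norm ::
    "((real^'n) set \<Rightarrow> (real^'n) fun_space) \<Rightarrow> (real^'n \<Rightarrow> real) \<Rightarrow> ennreal" where
  "bmo_X_norm X f = (SUP Q\<in>cubes. ext_norm (X Q) (\<lambda>x. f x - avg Q f))"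

definition expL_norm :: "(real^'n) set \<Rightarrow> (real^'n \<Rightarrow> real) \<Rightarrow> ennreal" where
  "expL_norm Q f = Inf {ennreal \<alpha> | \<alpha>. \<alpha> > 0 \<and>
     (\<integral>\<^sup>+x. ennreal (exp (\<bar>f x\<bar> / \<alpha>) - 1) \<partial>lebesgue_on Q) / emeasure lebesgue Q \<le> 1}"

definition expL :: "(real^'n) set \<Rightarrow> (real^'n \<Rightarrow> real) set" where
  "expL Q = {f \<in> borel_measurable (lebesgue_on Q). expL_norm Q f < \<infinity>}"


section \<open>The four conditions, each with its constant\<close>

text \<open>A finite bound on \<open>bmo_X_norm X f\<close> says in particular that \<open>f\<close> belongs to
  the space \<open>BMO_X\<close>.\<close>

definition bmo_embedding ::
    "((real^'n) set \<Rightarrow> (real^'n) fun_space) \<Rightarrow> real \<Rightarrow> bool" where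
  "bmo_embedding X C \<longleftrightarrow> (\<forall>f\<in>BMO. bmo_X_norm X f \<le> ennreal C * bmo_norm f)"

text \<open>The sums in the next two conditions may have infinitely many terms; they are finite
  almost everywhere on \<open>Q\<close>, and \<open>infsum\<close> is \<open>0\<close> on the exceptional null set.\<close>

definition sparse_bound ::
    "real \<Rightarrow> ((real^'n) set \<Rightarrow> (real^'n) fun_space) \<Rightarrow> real \<Rightarrow> bool" where
  "sparse_bound \<eta> X C \<longleftrightarrow>
     (\<forall>Q\<in>cubes. \<forall>\<F>. \<F> \<subseteq> dyadic_cubes Q \<and> sparse \<eta> \<F> \<longrightarrow>
        ext_norm (X Q) (\<lambda>x. \<Sum>\<^sub>\<infinity>P\<in>\<F>. indicator P x) \<le> ennreal C)"

definition nested_bound ::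
    "real \<Rightarrow> ((real^'n) set \<Rightarrow> (real^'n) fun_space) \<Rightarrow> real \<Rightarrow> bool" where
  "nested_bound \<gamma> X C \<longleftrightarrow>
     (\<forall>Q\<in>cubes. \<forall>\<Omega> :: nat \<Rightarrow> (real^'n) set.
        (\<forall>k. \<Omega> k \<in> sets lebesgue \<and> \<Omega> k \<subseteq> Q \<and> \<Omega> (Suc k) \<subseteq> \<Omega> k \<and>
             measure lebesgue (\<Omega> k) \<le> \<gamma> ^ k * measure lebesgue Q) \<longrightarrow>
        ext_norm (X Q) (\<lambda>x. \<Sum>\<^sub>\<infinity>k. indicator (\<Omega> k) x) \<le> ennreal C)"

definition expL_bound ::
    "((real^'n) set \<Rightarrow> (real^'n) fun_space) \<Rightarrow> real \<Rightarrow> bool" where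
  "expL_bound X C \<longleftrightarrow>
     (\<forall>Q\<in>cubes. \<forall>f\<in>expL Q. ext_norm (X Q) f \<le> ennreal C * expL_norm Q f)"

text \<open>The best constant is \<open>\<infinity>\<close> if no constant is admissible.\<close>

definition best_const :: "(real \<Rightarrow> bool) \<Rightarrow> ennreal" where
  "best_const P = Inf {ennreal C | C. C > 0 \<and> P C}"

end

theory Submission
  imports Defs
begin

text \<open>The implications (i) \<open>\<Longrightarrow>\<close> (ii) \<open>\<Longrightarrow>\<close> (iv) \<open>\<Longrightarrow>\<close> (i) and (iii) \<open>\<longleftrightarrow>\<close> (iv) all reduce to pointwise
  domination by a constant multiple of a single function, so that the quasi-triangle inequality,
  whose constant is not uniform in \<open>Q\<close>, is never used.

  (i) \<open>\<Longrightarrow>\<close> (ii): replacing each indicator in the sparse sum by a Lipschitz bump gives a function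
  in BMO.  (ii) \<open>\<Longrightarrow>\<close> (iv): if the average of \<open>exp (\<bar>f\<bar> / \<alpha>)\<close> on \<open>Q\<close> is at most \<open>2\<close>, then its
  Calderon--Zygmund cubes at geometrically growing heights form a sparse family whose counting
  function dominates \<open>\<bar>f\<bar> / \<alpha>\<close>, up to a constant.  (iv) \<open>\<Longrightarrow>\<close> (i) is the John--Nirenberg inequality.
  (iii) \<open>\<longleftrightarrow>\<close> (iv): a function is in \<open>exp L\<close> iff its level sets at equally spaced heights decay
  geometrically.\<close>

section \<open>Dyadic cubes\<close>

text \<open>Bumps are used in (i) \<Longrightarrow> (ii) because \<open>BMO\<close> tests all cubes,
  not only dyadic ones. The indicators of cubes shrinking to a common corner add up to a function
  that is large on one side of the corner and 0 on the other, so its oscillation there is unbounded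
  although such a family can be sparse. Bumps as wide as their cubes remove the jump. In (ii)
  \<Longrightarrow> (iv) the sparseness constant is prescribed, so the heights have to grow by
  \<open>2 ^ CARD('n) / (1 - \<eta>)\<close>: the factor 2^n pays for the overshoot of an average
  from parent to child, and 1 / (1 - \<eta>) keeps the smaller selected cubes below the fraction 1 -
  \<eta> of their ancestor. Each implication fixes its factor before the family \<open>X\<close> and
  the admissible constant are given; this uniformity makes the best constants comparable.\<close>

lemma cube_inject:
  fixes a b :: "real^'n"
  assumes "cube a l = cube b m" "l > 0" "m > 0"
  shows "a = b" "l = m"
proof -
  have "a \<in> cube a l" "b \<in> cube b m"
    using assms by (auto simp: cube_def)
  then have "a \<in> cube b m" "b \<in> cube a l"
    using assms by auto
  then show ab: "a = b"
    by (auto simp: cube_def vec_eq_iff intro: order.antisym)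
  \<comment> \<open>If m' were larger than l', the far corner omitted by the half-open cube of side
    l' would lie in the cube of side m'.\<close>
  have le: "m' \<le> l'" if "cube b l' = cube b m'" "l' > 0" "m' > 0" for l' m'
  proof (rule ccontr)
    assume "\<not> m' \<le> l'"
    then have "(\<chi> i. b $ i + l') \<in> cube b m'"
      using that by (auto simp: cube_def)
    then have "(\<chi> i. b $ i + l') \<in> cube b l'"
      using that by auto
    then show False
      by (auto simp: cube_def)
  qed
  show "l = m"
    using le[of l m] le[of m l] assms ab by auto
qed

lemma cube_ne: "l > 0 \<Longrightarrow> a \<in> cube a l"
  by (auto simp: cube_def)

section \<open>Measurability, volume and diameter of cubes\<close>

lemma cube_between_boxes:
  fixes a :: "real^'n"
  shows "box a (\<chi> i. a $ i + l) \<subseteq> cube a l" "cube a l \<subseteq> cbox a (\<chi> i. a $ i + l)"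
  by (auto simp: cube_def mem_box_cart less_imp_le)

lemma cube_sets_borel [measurable]: "cube (a::real^'n) l \<in> sets borel"
proof -
  have "cube a l = (\<Inter>i. {x. a $ i \<le> x $ i} \<inter> {x. x $ i < a $ i + l})"
    by (auto simp: cube_def)
  moreover have "\<dots> \<in> sets borel"
    by (intro sets.finite_INT borel_closed sets.Int borel_open open_halfspace_component_lt_cart
        closed_halfspace_component_ge_cart) auto
  ultimately show ?thesis by simp
qed

lemma cube_sets [measurable]: "cube (a::real^'n) l \<in> sets lebesgue"
  by (simp add: sets_completionI_sets)

lemma emeasure_cube:
  fixes a :: "real^'n"
  assumes "l > 0"
  shows "emeasure lebesgue (cube a l) = ennreal (l ^ CARD('n))"
proof -
  let ?b = "(\<chi> i. a $ i + l) :: real^'n"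
  have le: "\<forall>i\<in>Basis. a \<bullet> i \<le> ?b \<bullet> i"
    using assms by (auto simp: Basis_vec_def inner_axis)
  have pr: "(\<Prod>i\<in>Basis. (?b - a) \<bullet> i) = l ^ CARD('n)"
    using content_cbox_cart[of a ?b] assms le by (simp add: content_cbox' box_ne_empty inner_diff_left)
  have "emeasure lborel (box a ?b) = l ^ CARD('n)" "emeasure lborel (cbox a ?b) = l ^ CARD('n)"
    using le pr by (simp_all add: emeasure_lborel_box_eq emeasure_lborel_cbox_eq)
  moreover have "emeasure lborel (box a ?b) \<le> emeasure lborel (cube a l)"
     "emeasure lborel (cube a l) \<le> emeasure lborel (cbox a ?b)"
    by (intro emeasure_mono cube_between_boxes; simp)+
  ultimately show ?thesis
    by (simp add: order.antisym)
qed

lemma measure_cube: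
  fixes a :: "real^'n"
  assumes "l > 0"
  shows "measure lebesgue (cube a l) = l ^ CARD('n)"
  using emeasure_cube[OF assms] assms by (simp add: measure_def)

lemma cube_dist_le:
  fixes a :: "real^'n" and l :: real
  assumes "x \<in> cube a l" "y \<in> cube a l"
  shows "dist x y \<le> CARD('n) * l"
proof -
  have "dist x y \<le> (\<Sum>i\<in>UNIV. \<bar>(x - y) $ i\<bar>)"
    using norm_le_l1_cart[of "x - y"] by (simp add: dist_norm)
  also have "\<dots> \<le> (\<Sum>i\<in>(UNIV::'n set). l)"
  proof (rule sum_mono)
    fix i
    show "\<bar>(x - y) $ i\<bar> \<le> l"
      using assms by (auto simp: cube_def abs_le_iff dest!: spec[of _ i])
  qed
  finally show ?thesis by simp
qed

text \<open>The dyadic cube of generation \<open>k\<close> of \<open>cube a l\<close> that contains \<open>x\<close>.\<close>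

definition dcube :: "real^'n \<Rightarrow> real \<Rightarrow> nat \<Rightarrow> real^'n \<Rightarrow> (real^'n) set" where
  "dcube a l k x = {y. \<forall>i. \<lfloor>(y $ i - a $ i) * 2 ^ k / l\<rfloor> = \<lfloor>(x $ i - a $ i) * 2 ^ k / l\<rfloor>}"

lemma dcube_self: "x \<in> dcube a l k x"
  by (simp add: dcube_def)

lemma dcube_eq: "y \<in> dcube a l k x \<Longrightarrow> dcube a l k y = dcube a l k x"
  by (auto simp: dcube_def)

text \<open>The grid index of a parent is half the child's index, rounded down, so points with the
  same child also share the parent.\<close>

lemma dcube_Suc: "dcube a l (Suc k) x \<subseteq> dcube a l k x"
proof
  fix y assume y: "y \<in> dcube a l (Suc k) x"
  have *: "\<lfloor>u\<rfloor> = \<lfloor>2 * u\<rfloor> div 2" for u :: real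
    using floor_divide_real_eq_div[of 2 "2 * u"] by simp
  show "y \<in> dcube a l k x"
    unfolding dcube_def mem_Collect_eq
  proof
    fix i
    have "\<lfloor>2 * ((y $ i - a $ i) * 2 ^ k / l)\<rfloor> = \<lfloor>2 * ((x $ i - a $ i) * 2 ^ k / l)\<rfloor>"
      using y by (auto simp: dcube_def mult_ac)
    then show "\<lfloor>(y $ i - a $ i) * 2 ^ k / l\<rfloor> = \<lfloor>(x $ i - a $ i) * 2 ^ k / l\<rfloor>"
      by (subst (1 2) *) simp
  qed
qed

lemma dcube_mono: "j \<le> k \<Longrightarrow> dcube a l k x \<subseteq> dcube a l j x"
  by (rule lift_Suc_antimono_le[of "\<lambda>k. dcube a l k x", OF dcube_Suc])

lemma dcube_eq_cube:
  fixes a x :: "real^'n"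
  assumes "l > 0"
  shows "dcube a l k x = cube (\<chi> i. a $ i + l / 2 ^ k * \<lfloor>(x $ i - a $ i) * 2 ^ k / l\<rfloor>) (l / 2 ^ k)"
proof -
  have *: "\<lfloor>u * 2 ^ k / l\<rfloor> = z \<longleftrightarrow> l / 2 ^ k * z \<le> u \<and> u < l / 2 ^ k * z + l / 2 ^ k" for u and z :: int
    using assms by (simp add: floor_eq_iff field_simps)
  have **: "\<lfloor>(y $ i - a $ i) * 2 ^ k / l\<rfloor> = z \<longleftrightarrow>
    a $ i + l / 2 ^ k * z \<le> y $ i \<and> y $ i < a $ i + l / 2 ^ k * z + l / 2 ^ k" for y i and z :: int
    unfolding * by auto
  show ?thesis
    unfolding dcube_def cube_def by (auto simp: **)
qed

lemma dcube_0:
  assumes "l > 0" "x \<in> cube a l"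
  shows "dcube a l 0 x = cube a l"
proof -
  have "\<lfloor>(x $ i - a $ i) / l\<rfloor> = 0" for i
    using assms by (auto simp: cube_def floor_eq_iff field_simps dest!: spec[of _ i])
  then show ?thesis
    using assms by (simp add: dcube_eq_cube)
qed

lemma dcube_subset:
  assumes "l > 0" "x \<in> cube a l"
  shows "dcube a l k x \<subseteq> cube a l"
  using dcube_mono[of 0 k a l x] dcube_0[OF assms] by auto

lemma dcube_in_subcubes:
  fixes a x :: "real^'n"
  assumes "l > 0"
  shows "dcube a l (Suc k) x \<in> subcubes (dcube a l k x)"
proof -
  define z where "z i = \<lfloor>(x $ i - a $ i) * 2 ^ k / l\<rfloor>" for i
  define w where "w i = \<lfloor>(x $ i - a $ i) * 2 ^ Suc k / l\<rfloor>" for i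
  have *: "\<lfloor>u\<rfloor> = \<lfloor>2 * u\<rfloor> div 2" for u :: real
    using floor_divide_real_eq_div[of 2 "2 * u"] by simp
  have z: "z i = w i div 2" for i
    unfolding z_def w_def by (subst *) (simp add: mult_ac)
  \<comment> \<open>An odd index means that the child occupies the upper half of its parent in that
    coordinate.\<close>
  define S where "S = {i. odd (w i)}"
  define b where "b = (\<chi> i. a $ i + l / 2 ^ k * z i)"
  have w: "real_of_int (w i) = 2 * z i + (if i \<in> S then 1 else 0)" for i
  proof -
    have "w i = 2 * z i + (if i \<in> S then 1 else 0)"
      unfolding z S_def by auto
    then have "real_of_int (w i) = real_of_int (2 * z i + (if i \<in> S then 1 else 0))"
      by presburger
    then show ?thesis by simp
  qed
  have P: "dcube a l k x = cube b (l / 2 ^ k)"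
    unfolding b_def z_def by (rule dcube_eq_cube[OF assms])
  have "dcube a l (Suc k) x = cube (\<chi> i. a $ i + l / 2 ^ Suc k * w i) (l / 2 ^ Suc k)"
    unfolding w_def by (rule dcube_eq_cube[OF assms])
  also have "(\<chi> i. a $ i + l / 2 ^ Suc k * w i) =
      (\<chi> i. if i \<in> S then b $ i + (l / 2 ^ k) / 2 else b $ i)"
    unfolding w by (simp add: vec_eq_iff b_def field_simps)
  also have "l / 2 ^ Suc k = (l / 2 ^ k) / 2"
    by simp
  finally show ?thesis
    unfolding P subcubes_def mem_Collect_eq using assms
    by (intro exI[of _ b] exI[of _ "l/2^k"] exI[of _ S] conjI) simp_all
qed

lemma subcubes_dcube:
  fixes a x :: "real^'n"
  assumes "l > 0" "P' \<in> subcubes (dcube a l k x)"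
  obtains y where "P' = dcube a l (Suc k) y" "y \<in> dcube a l k x"
proof -
  define z where "z i = \<lfloor>(x $ i - a $ i) * 2 ^ k / l\<rfloor>" for i
  define b where "b = (\<chi> i. a $ i + l / 2 ^ k * z i)"
  have P: "dcube a l k x = cube b (l / 2 ^ k)"
    unfolding b_def z_def by (rule dcube_eq_cube[OF assms(1)])
  obtain b' m S where S: "P' = cube (\<chi> i. if i \<in> S then b' $ i + m / 2 else b' $ i) (m / 2)"
    "m > 0" "dcube a l k x = cube b' m"
    using assms by (auto simp: subcubes_def)
  have bm: "b' = b" "m = l / 2 ^ k"
    using cube_inject[of b "l/2^k" b' m] S P assms by auto
  \<comment> \<open>The lower corner of the child serves as its representative: its grid coordinates
    at generation \<open>Suc k\<close> are integers, so the floors are exact.\<close>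
  define y where "y = (\<chi> i. if i \<in> S then b $ i + m / 2 else b $ i)"
  have "(y $ i - a $ i) * 2 ^ Suc k / l = of_int (2 * z i + (if i \<in> S then 1 else 0))" for i
    using assms by (auto simp: y_def b_def bm field_simps)
  then have fl: "real_of_int \<lfloor>(y $ i - a $ i) * 2 ^ Suc k / l\<rfloor> = (y $ i - a $ i) * 2 ^ Suc k / l" for i
    by (metis floor_of_int)
  have "dcube a l (Suc k) y = cube y (l / 2 ^ Suc k)"
    unfolding dcube_eq_cube[OF assms(1)] fl using assms by (simp add: vec_eq_iff)
  also have "\<dots> = P'"
    unfolding S y_def bm by (simp add: mult.commute)
  finally have "P' = dcube a l (Suc k) y" by simp
  moreover have "y \<in> dcube a l k x"
    unfolding P using assms by (simp add: cube_def y_def bm field_simps)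
  ultimately show thesis by (rule that)
qed

text \<open>The indexed form turns the dyadic cubes through a fixed point into a chain ordered by
  generation, on which nesting and maximality arguments rest.\<close>

lemma dyadic_cubes_eq:
  fixes a :: "real^'n"
  assumes "l > 0"
  shows "dyadic_cubes (cube a l) = {dcube a l k x | k x. x \<in> cube a l}"
proof (intro equalityI subsetI)
  fix P assume "P \<in> dyadic_cubes (cube a l)"
  then show "P \<in> {dcube a l k x | k x. x \<in> cube a l}"
  proof induction
    case self
    have "a \<in> cube a l" using assms by (rule cube_ne)
    then show ?case using dcube_0[OF assms, of a] by blast
  next
    case (child P P')
    then obtain k x where x: "P = dcube a l k x" "x \<in> cube a l" by blast
    with child obtain y where y: "P' = dcube a l (Suc k) y" "y \<in> dcube a l k x"
      using subcubes_dcube[OF assms] by metis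
    then show ?case using dcube_subset[OF assms x(2)] by blast
  qed
next
  fix P assume "P \<in> {dcube a l k x | k x. x \<in> cube a l}"
  then obtain k x where x: "P = dcube a l k x" "x \<in> cube a l" by blast
  have "dcube a l k x \<in> dyadic_cubes (cube a l)" for k
  proof (induction k)
    case 0
    then show ?case using dcube_0[OF assms x(2)] dyadic_cubes.self by auto
  next
    case (Suc k)
    then show ?case using dcube_in_subcubes[OF assms] dyadic_cubes.child by metis
  qed
  then show "P \<in> dyadic_cubes (cube a l)" using x by simp
qed

section \<open>Countability, nesting and maximal cubes\<close>

lemma countable_dyadic_cubes:
  fixes Q :: "(real^'n) set"
  assumes "Q \<in> cubes"
  shows "countable (dyadic_cubes Q)"
proof -
  obtain a l where Q: "Q = cube a l" "l > 0" using assms by (auto simp: cubes_def)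
  let ?h = "\<lambda>(k, z). cube (\<chi> i. a $ i + l / 2 ^ k * real_of_int (z i)) (l / 2 ^ k)"
  have "dyadic_cubes Q \<subseteq> ?h ` (UNIV :: (nat \<times> ('n \<Rightarrow> int)) set)"
    unfolding Q dyadic_cubes_eq[OF Q(2)] by (auto simp: dcube_eq_cube[OF Q(2)])
  then show ?thesis
    by (rule countable_subset) auto
qed

lemma dyadic_cubes_cubes:
  assumes "Q \<in> cubes" "P \<in> dyadic_cubes Q"
  shows "P \<in> cubes"
proof -
  obtain a l where Q: "Q = cube a l" "l > 0" using assms by (auto simp: cubes_def)
  then obtain k x where "P = dcube a l k x"
    using assms dyadic_cubes_eq[OF Q(2)] by blast
  moreover have "l / 2 ^ k > 0"
    using Q by simp
  ultimately show ?thesis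
    unfolding cubes_def mem_Collect_eq dcube_eq_cube[OF Q(2)] by (intro exI conjI)
qed

lemma dyadic_cubes_subset:
  assumes "Q \<in> cubes" "P \<in> dyadic_cubes Q"
  shows "P \<subseteq> Q"
proof -
  obtain a l where Q: "Q = cube a l" "l > 0" using assms by (auto simp: cubes_def)
  then show ?thesis
    using assms(2) dcube_subset[OF Q(2)] unfolding Q dyadic_cubes_eq[OF Q(2)] by blast
qed

lemma cubes_sets [measurable_dest]: "P \<in> cubes \<Longrightarrow> P \<in> sets lebesgue"
  by (auto simp: cubes_def)

lemma cubes_lmeasurable: "P \<in> cubes \<Longrightarrow> P \<in> lmeasurable"
  unfolding cubes_def by clarify (rule fmeasurableI; simp only: cube_sets emeasure_cube ennreal_less_top infinity_ennreal_def)

lemma cubes_emeasure: "P \<in> cubes \<Longrightarrow> emeasure lebesgue P = ennreal (measure lebesgue P)"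
  by (rule emeasure_eq_measure2[OF cubes_lmeasurable])

lemma cubes_pos:
  assumes "P \<in> cubes"
  shows "measure lebesgue P > 0"
proof -
  obtain a l where "P = cube a l" "l > 0"
    using assms by (auto simp: cubes_def)
  then show ?thesis
    by (simp only: measure_cube zero_less_power)
qed

text \<open>Represented by a common point, both cubes belong to one chain, so comparing generations
  decides the inclusion.\<close>

lemma dyadic_nested:
  assumes "Q \<in> cubes" "P \<in> dyadic_cubes Q" "R \<in> dyadic_cubes Q" "P \<inter> R \<noteq> {}"
  shows "P \<subseteq> R \<or> R \<subseteq> P"
proof -
  obtain a l where Q: "Q = cube a l" "l > 0" using assms by (auto simp: cubes_def)
  obtain j x k y where xy: "P = dcube a l j x" "R = dcube a l k y"
    using assms unfolding Q dyadic_cubes_eq[OF Q(2)] by auto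
  obtain z where "z \<in> P" "z \<in> R" using assms by auto
  then have "P = dcube a l j z" "R = dcube a l k z"
    using xy dcube_eq[of z a l] by auto
  then show ?thesis
    using dcube_mono[of j k a l z] dcube_mono[of k j a l z] by (cases "j \<le> k") auto
qed

text \<open>Generations are natural numbers, so among the cubes of \<open>G\<close> through a point
  one has least generation, and it is maximal. Overlapping families can thus be replaced by disjoint
  ones.\<close>

lemma maximal_cubes:
  assumes Q: "Q \<in> cubes" and G: "G \<subseteq> dyadic_cubes Q"
  defines "G' \<equiv> {P \<in> G. \<forall>R\<in>G. \<not> P \<subset> R}"
  shows "disjoint G'" "\<Union>G' = \<Union>G"
proof -
  show "disjoint G'"
  proof (rule disjointI)
    fix P R assume PR: "P \<in> G'" "R \<in> G'" "P \<noteq> R"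
    then show "P \<inter> R = {}"
      using dyadic_nested[OF Q, of P R] G by (auto simp: G'_def)
  qed
  obtain a l where Qa: "Q = cube a l" "l > 0" using Q by (auto simp: cubes_def)
  have "x \<in> \<Union>G'" if x: "x \<in> P" "P \<in> G" for x P
  proof -
    obtain k y where ky: "P = dcube a l k y"
      using x G unfolding Qa dyadic_cubes_eq[OF Qa(2)] by blast
    then have "dcube a l k x \<in> G" using x dcube_eq[of x a l k y] by simp
    define j where "j = (LEAST j. dcube a l j x \<in> G)"
    have j: "dcube a l j x \<in> G"
      unfolding j_def by (rule LeastI) fact
    moreover have "\<not> dcube a l j x \<subset> R" if "R \<in> G" for R
    proof
      assume sub: "dcube a l j x \<subset> R"
      have "R \<in> dyadic_cubes (cube a l)"
        using \<open>R \<in> G\<close> G Qa by auto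
      then obtain i z where iz: "R = dcube a l i z"
        unfolding dyadic_cubes_eq[OF Qa(2)] by auto
      then have R: "R = dcube a l i x"
        using dcube_eq[of x a l i z] dcube_self[of x a l j] sub by auto
      then have "j \<le> i"
        using that unfolding j_def by (auto intro: Least_le)
      then show False
        using dcube_mono[of j i a l x] sub R by auto
    qed
    ultimately have "dcube a l j x \<in> G'" by (auto simp: G'_def)
    then show ?thesis using dcube_self by blast
  qed
  then show "\<Union>G' = \<Union>G" by (auto simp: G'_def)
qed

section \<open>Averages over dyadic cubes and sparse families\<close>

text \<open>\<open>density\<close> turns each set integral into a measure, so both sides split over
  the countable disjoint family and can be compared term by term.\<close>

lemma set_nn_integral_Union_mono:
  fixes u v :: "'a \<Rightarrow> ennreal"
  assumes [measurable]: "u \<in> borel_measurable M" "v \<in> borel_measurable M"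
    and G: "countable G" "disjoint G" "G \<subseteq> sets M"
    and le: "\<And>P. P \<in> G \<Longrightarrow> (\<integral>\<^sup>+x\<in>P. u x \<partial>M) \<le> (\<integral>\<^sup>+x\<in>P. v x \<partial>M)"
  shows "(\<integral>\<^sup>+x\<in>\<Union>G. u x \<partial>M) \<le> (\<integral>\<^sup>+x\<in>\<Union>G. v x \<partial>M)"
proof -
  have *: "(\<integral>\<^sup>+x\<in>\<Union>G. w x \<partial>M) = (\<integral>\<^sup>+P. (\<integral>\<^sup>+x\<in>P. w x \<partial>M) \<partial>count_space G)"
    if [measurable]: "w \<in> borel_measurable M" for w
  proof -
    have "\<Union>G \<in> sets M"
      using G by (intro sets.countable_Union)
    then have "(\<integral>\<^sup>+x\<in>\<Union>G. w x \<partial>M) = emeasure (density M w) (\<Union>(id ` G))"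
      by (simp add: emeasure_density)
    also have "\<dots> = (\<integral>\<^sup>+P. emeasure (density M w) (id P) \<partial>count_space G)"
      using G by (intro emeasure_UN_countable) (auto simp: disjoint_family_on_def disjoint_def)
    also have "\<dots> = (\<integral>\<^sup>+P. (\<integral>\<^sup>+x\<in>P. w x \<partial>M) \<partial>count_space G)"
      using G by (intro nn_integral_cong) (auto simp: emeasure_density)
    finally show ?thesis .
  qed
  show ?thesis
    unfolding *[OF assms(1)] *[OF assms(2)] by (rule nn_integral_mono) (simp add: le)
qed

text \<open>Passing to maximal cubes removes overlaps without changing the union. With a constant
  for \<open>u\<close> this is the weak-type estimate behind the stopping-time arguments
  below.\<close>

lemma dyadic_set_nn_integral_Union_mono:
  fixes u v :: "real^'n \<Rightarrow> ennreal"
  assumes uv: "u \<in> borel_measurable lebesgue" "v \<in> borel_measurable lebesgue"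
    and Q: "Q \<in> cubes" and G: "G \<subseteq> dyadic_cubes Q"
    and le: "\<And>P. P \<in> G \<Longrightarrow> (\<integral>\<^sup>+x\<in>P. u x \<partial>lebesgue) \<le> (\<integral>\<^sup>+x\<in>P. v x \<partial>lebesgue)"
  shows "(\<integral>\<^sup>+x\<in>\<Union>G. u x \<partial>lebesgue) \<le> (\<integral>\<^sup>+x\<in>\<Union>G. v x \<partial>lebesgue)"
proof -
  let ?G = "{P \<in> G. \<forall>R\<in>G. \<not> P \<subset> R}"
  have "countable ?G"
    by (rule countable_subset[OF _ countable_dyadic_cubes[OF Q]]) (use G in auto)
  moreover have "?G \<subseteq> sets lebesgue"
    using G dyadic_cubes_cubes[OF Q] cubes_sets by blast
  ultimately show ?thesis
    unfolding maximal_cubes(2)[OF Q G, symmetric] using le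
    by (intro set_nn_integral_Union_mono uv maximal_cubes(1)[OF Q G]) auto
qed

lemma dyadic_small_cube:
  fixes x :: "real^'n"
  assumes Q: "Q \<in> cubes" "x \<in> Q" and T: "open T" "x \<in> T"
  obtains P where "P \<in> dyadic_cubes Q" "x \<in> P" "P \<subseteq> T"
proof -
  obtain a l where Qa: "Q = cube a l" "l > 0" using Q by (auto simp: cubes_def)
  obtain r where r: "r > 0" "ball x r \<subseteq> T"
    using T openE by blast
  obtain k where k: "CARD('n) * l / r < 2 ^ k"
    using real_arch_pow[of 2] by auto
  have "dcube a l k x \<subseteq> ball x r"
  proof
    fix y assume y: "y \<in> dcube a l k x"
    then have "dist x y \<le> CARD('n) * (l / 2 ^ k)"
      using dcube_self[of x a l k] unfolding dcube_eq_cube[OF Qa(2)] by (intro cube_dist_le)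
    also have "\<dots> < r"
      using k r by (simp add: field_simps)
    finally show "y \<in> ball x r" by simp
  qed
  moreover have "dcube a l k x \<in> dyadic_cubes Q"
    using Q unfolding Qa dyadic_cubes_eq[OF Qa(2)] by blast
  ultimately show thesis
    using r dcube_self that by blast
qed

text \<open>A one-sided form of Lebesgue differentiation. The set \<open>E\<close> of bad points is
  covered by dyadic cubes inside an open set of nearly the same measure; the average bound on these
  cubes shows that the integral of \<open>v\<close> over \<open>E\<close> is at most t |E|, while
  \<open>v\<close> exceeds \<open>t\<close> on \<open>E\<close>.\<close>

lemma AE_le_of_dyadic_averages_le:
  fixes v :: "real^'n \<Rightarrow> ennreal" and t :: real
  assumes v [measurable]: "v \<in> borel_measurable lebesgue" and Q: "Q \<in> cubes" and t: "t \<ge> 0"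
  shows "AE x in lebesgue. x \<in> Q \<longrightarrow>
    (\<forall>P\<in>dyadic_cubes Q. x \<in> P \<longrightarrow> (\<integral>\<^sup>+y\<in>P. v y \<partial>lebesgue) \<le> ennreal t * emeasure lebesgue P) \<longrightarrow>
    v x \<le> ennreal t"
proof -
  define H where "H = {P\<in>dyadic_cubes Q. \<not> (\<integral>\<^sup>+y\<in>P. v y \<partial>lebesgue) \<le> ennreal t * emeasure lebesgue P}"
  have sD: "P \<in> sets lebesgue" if "P \<in> dyadic_cubes Q" for P
    using cubes_sets dyadic_cubes_cubes[OF Q] that by blast
  have cD: "countable G" if "G \<subseteq> dyadic_cubes Q" for G
    using countable_subset[OF that countable_dyadic_cubes[OF Q]] .
  have [measurable]: "\<Union>H \<in> sets lebesgue"
    using sD by (intro sets.countable_Union cD) (auto simp: H_def)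
  have [measurable]: "Q \<in> sets lebesgue"
    using cubes_sets[OF Q] .
  define E where "E = {x \<in> space lebesgue. v x > ennreal t} \<inter> (Q - \<Union>H)"
  have E [measurable]: "E \<in> sets lebesgue"
    unfolding E_def by measurable
  have "emeasure lebesgue E \<le> emeasure lebesgue Q"
    by (intro emeasure_mono) (auto simp: E_def)
  then have Efin: "emeasure lebesgue E < \<infinity>"
    using cubes_emeasure[OF Q] by (auto simp: order.strict_trans1 top.not_eq_extremum)
  have "(\<integral>\<^sup>+x\<in>E. v x \<partial>lebesgue) \<le> ennreal t * emeasure lebesgue E"
  proof (rule ennreal_le_epsilon)
    fix e :: real assume e: "e > 0"
    \<comment> \<open>Dividing by \<open>t + 1\<close> instead of \<open>t\<close> also covers
      \<open>t = 0\<close>.\<close>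
    then have "e / (t + 1) > 0" using t by simp
    from sets_lebesgue_outer_open[OF E this] obtain T
      where T: "open T" "E \<subseteq> T" "T - E \<in> lmeasurable" "emeasure lebesgue (T - E) < ennreal (e / (t + 1))"
      by metis
    define G where "G = {P\<in>dyadic_cubes Q. P \<subseteq> T \<and> P \<inter> E \<noteq> {}}"
    have "\<exists>P\<in>G. x \<in> P" if "x \<in> E" for x
    proof -
      have "x \<in> Q" "x \<in> T"
        using that T(2) by (auto simp: E_def)
      from dyadic_small_cube[OF Q this(1) T(1) this(2)] obtain P
        where "P \<in> dyadic_cubes Q" "x \<in> P" "P \<subseteq> T" .
      then show ?thesis
        using that by (auto simp: G_def)
    qed
    then have EG: "E \<subseteq> \<Union>G" by blast
    have T_sets [measurable]: "T \<in> sets lebesgue"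
      using T(1) by (simp add: sets_completionI_sets)
    have [measurable]: "\<Union>G \<in> sets lebesgue"
      using sD by (intro sets.countable_Union cD) (auto simp: G_def)
    have "(\<integral>\<^sup>+x\<in>E. v x \<partial>lebesgue) \<le> (\<integral>\<^sup>+x\<in>\<Union>G. v x \<partial>lebesgue)"
      using EG by (intro nn_integral_mono) (auto simp: indicator_def)
    also have "\<dots> \<le> (\<integral>\<^sup>+x\<in>\<Union>G. ennreal t \<partial>lebesgue)"
    proof (rule dyadic_set_nn_integral_Union_mono[OF v _ Q])
      fix P assume P: "P \<in> G"
      \<comment> \<open>\<open>P\<close> meets \<open>E\<close>, and \<open>E\<close> avoids every
        cube of \<open>H\<close>.\<close>
      then have "P \<notin> H" by (auto simp: G_def E_def)
      then have "(\<integral>\<^sup>+y\<in>P. v y \<partial>lebesgue) \<le> ennreal t * emeasure lebesgue P"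
        using P by (auto simp: H_def G_def)
      also have "\<dots> = (\<integral>\<^sup>+y\<in>P. ennreal t \<partial>lebesgue)"
        using P sD by (subst nn_integral_cmult_indicator) (auto simp: G_def)
      finally show "(\<integral>\<^sup>+y\<in>P. v y \<partial>lebesgue) \<le> (\<integral>\<^sup>+y\<in>P. ennreal t \<partial>lebesgue)" .
    qed (auto simp: G_def)
    also have "\<dots> = ennreal t * emeasure lebesgue (\<Union>G)"
      by (subst nn_integral_cmult_indicator) auto
    also have "\<dots> \<le> ennreal t * emeasure lebesgue (E \<union> (T - E))"
      by (intro mult_left_mono emeasure_mono) (auto simp: G_def)
    also have "\<dots> \<le> ennreal t * (emeasure lebesgue E + ennreal (e / (t + 1)))"
      using T(4) by (intro mult_left_mono order.trans[OF emeasure_subadditive] add_left_mono) auto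
    also have "\<dots> = ennreal t * emeasure lebesgue E + ennreal (t * (e / (t + 1)))"
      using t e by (subst distrib_left) (simp add: ennreal_mult[symmetric])
    also have "\<dots> \<le> ennreal t * emeasure lebesgue E + ennreal e"
      using t e by (intro add_left_mono ennreal_leI) (simp add: field_simps)
    finally show "(\<integral>\<^sup>+x\<in>E. v x \<partial>lebesgue) \<le> ennreal t * emeasure lebesgue E + ennreal e" .
  qed
  also have "\<dots> = (\<integral>\<^sup>+x\<in>E. ennreal t \<partial>lebesgue)"
    by (subst nn_integral_cmult_indicator) auto
  finally have le: "(\<integral>\<^sup>+x\<in>E. v x \<partial>lebesgue) \<le> (\<integral>\<^sup>+x\<in>E. ennreal t \<partial>lebesgue)" .
  have "AE x in lebesgue. v x * indicator E x \<le> ennreal t * indicator E x"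
  proof (rule ccontr)
    assume not: "\<not> (AE x in lebesgue. v x * indicator E x \<le> ennreal t * indicator E x)"
    have fin: "(\<integral>\<^sup>+x\<in>E. ennreal t \<partial>lebesgue) \<noteq> \<infinity>"
      using Efin by (subst nn_integral_cmult_indicator) (auto simp: ennreal_mult_eq_top_iff)
    have ord: "AE x in lebesgue. ennreal t * indicator E x \<le> v x * indicator E x"
      by (auto simp: E_def indicator_def)
    have "(\<integral>\<^sup>+x\<in>E. ennreal t \<partial>lebesgue) < (\<integral>\<^sup>+x\<in>E. v x \<partial>lebesgue)"
      by (rule nn_integral_less[OF _ _ fin ord not]) measurable
    with le show False by simp
  qed
  then show ?thesis
  proof (rule AE_mp, intro AE_I2 impI)
    fix x
    assume x: "v x * indicator E x \<le> ennreal t * indicator E x" "x \<in> Q"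
      "\<forall>P\<in>dyadic_cubes Q. x \<in> P \<longrightarrow> (\<integral>\<^sup>+y\<in>P. v y \<partial>lebesgue) \<le> ennreal t * emeasure lebesgue P"
    show "v x \<le> ennreal t"
    proof (rule ccontr)
      assume "\<not> v x \<le> ennreal t"
      then have "x \<in> E" using x by (auto simp: E_def H_def)
      then show False using x \<open>\<not> v x \<le> ennreal t\<close> by simp
    qed
  qed
qed

text \<open>Where infinitely many sets contain \<open>x\<close>, both sides take their default value
  0: the sum diverges, and \<open>card\<close> of an infinite set is 0.\<close>

lemma infsum_indicator_eq_card:
  "(\<Sum>\<^sub>\<infinity>i\<in>I. indicator (W i) x :: real) = real (card {i \<in> I. x \<in> W i})"
proof (cases "finite {i \<in> I. x \<in> W i}")
  case True
  have "(\<Sum>\<^sub>\<infinity>i\<in>I. indicator (W i) x :: real) = (\<Sum>\<^sub>\<infinity>i\<in>{i \<in> I. x \<in> W i}. 1)"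
    by (intro infsum_cong_neutral) auto
  then show ?thesis using True by simp
next
  case False
  have "\<not> (\<lambda>i. indicator (W i) x :: real) summable_on I"
  proof
    assume "(\<lambda>i. indicator (W i) x :: real) summable_on I"
    then have "(\<lambda>i. indicator (W i) x :: real) summable_on {i \<in> I. x \<in> W i}"
      by (rule summable_on_subset_banach) auto
    then have "(\<lambda>i. 1 :: real) summable_on {i \<in> I. x \<in> W i}"
      by (subst (asm) summable_on_cong[of _ _ "\<lambda>_. 1"]) auto
    then show False
      using infsum_diverge_constant[OF False, of "1::real"] by auto
  qed
  then show ?thesis
    using False by (simp add: infsum_not_exists)
qed

lemma nn_integral_count_space_indicator_eq_emeasure:
  "(\<integral>\<^sup>+i. indicator (W i) x \<partial>count_space I) = emeasure (count_space I) {i \<in> I. x \<in> W i}"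
proof -
  have "(\<integral>\<^sup>+i. indicator (W i) x \<partial>count_space I) = (\<integral>\<^sup>+i. indicator {i \<in> I. x \<in> W i} i \<partial>count_space I)"
    by (intro nn_integral_cong) (auto simp: indicator_def)
  then show ?thesis by simp
qed

lemma borel_measurable_nn_integral_count_space_indicator:
  assumes "countable I" and W: "\<And>i. i \<in> I \<Longrightarrow> W i \<in> sets M"
  shows "(\<lambda>x. \<integral>\<^sup>+i. indicator (W i) x \<partial>count_space I) \<in> borel_measurable M"
proof -
  interpret sigma_finite_measure "count_space I"
    using assms(1) by (rule sigma_finite_measure_count_space_countable)
  show ?thesis
  proof (rule borel_measurable_nn_integral)
    have "(\<lambda>(i, x). indicator (W i) x) \<in> borel_measurable (count_space I \<Otimes>\<^sub>M M)"
      using assms by (intro measurable_pair_measure_countable1) auto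
    from measurable_comp[OF measurable_pair_swap' this]
    show "(\<lambda>(x, i). indicator (W i) x) \<in> borel_measurable (M \<Otimes>\<^sub>M count_space I)"
      by (simp add: comp_def case_prod_unfold)
  qed
qed

lemma borel_measurable_card_sets:
  assumes "countable I" and W: "\<And>i. i \<in> I \<Longrightarrow> W i \<in> sets M"
  shows "(\<lambda>x. real (card {i \<in> I. x \<in> W i})) \<in> borel_measurable M"
proof -
  have "(\<lambda>x. \<integral>\<^sup>+i. indicator (W i) x \<partial>count_space I) \<in> borel_measurable M"
    by (rule borel_measurable_nn_integral_count_space_indicator[OF assms])
  then have "(\<lambda>x. enn2real (emeasure (count_space I) {i \<in> I. x \<in> W i})) \<in> borel_measurable M"
    by (simp add: nn_integral_count_space_indicator_eq_emeasure)
  \<comment> \<open>\<open>enn2real\<close> sends infinity to 0, in agreement with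
    \<open>card\<close> of an infinite set.\<close>
  moreover have "enn2real (emeasure (count_space I) {i \<in> I. x \<in> W i}) = real (card {i \<in> I. x \<in> W i})" for x
    by (cases "finite {i \<in> I. x \<in> W i}") (auto simp: emeasure_count_space)
  ultimately show ?thesis by simp
qed

text \<open>Each cube costs at most \<open>1 / \<eta>\<close> times its own part that is not covered by smaller
  cubes of the family, and these parts are disjoint.\<close>

lemma sparse_packing:
  fixes Q :: "(real^'n) set"
  assumes Q: "Q \<in> cubes" and F: "F \<subseteq> dyadic_cubes Q" "sparse \<eta> F" and \<eta>: "\<eta> > 0"
    and S: "S \<in> sets lebesgue"
  shows "(\<integral>\<^sup>+P. emeasure lebesgue P \<partial>count_space {P\<in>F. P \<subseteq> S}) \<le> ennreal (1 / \<eta>) * emeasure lebesgue S"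
proof -
  define E where "E P = P - \<Union>{P'\<in>F. P' \<subset> P}" for P
  have sF: "P \<in> cubes" if "P \<in> F" for P
    using dyadic_cubes_cubes[OF Q] F that by blast
  have cF: "countable G" if "G \<subseteq> F" for G
    using countable_subset[OF _ countable_dyadic_cubes[OF Q]] that F by blast
  have sE: "E P \<in> sets lebesgue" if "P \<in> F" for P
    unfolding E_def using that sF cubes_sets by (intro sets.Diff sets.countable_Union cF) auto
  have le: "emeasure lebesgue P \<le> ennreal (1 / \<eta>) * emeasure lebesgue (E P)" if "P \<in> F" for P
  proof -
    have "emeasure lebesgue (E P) \<le> emeasure lebesgue P"
      using that sF cubes_sets by (intro emeasure_mono) (auto simp: E_def)
    then have fin: "emeasure lebesgue (E P) \<noteq> top"
      using cubes_emeasure[OF sF[OF that]] by (auto simp: top_unique)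
    have "measure lebesgue P \<le> 1 / \<eta> * measure lebesgue (E P)"
      using F(2) that \<eta> unfolding sparse_def E_def by (auto simp: field_simps)
    then have "ennreal (measure lebesgue P) \<le> ennreal (1 / \<eta>) * ennreal (measure lebesgue (E P))"
      using \<eta> by (subst ennreal_mult[symmetric]) (auto intro!: ennreal_leI)
    then show ?thesis
      using cubes_emeasure[OF sF[OF that]] emeasure_eq_ennreal_measure[OF fin] by simp
  qed
  let ?F = "{P\<in>F. P \<subseteq> S}"
  \<comment> \<open>If one cube lies strictly inside another, all of it is removed from the
    uncovered part of the larger one.\<close>
  have disj: "disjoint_family_on E ?F"
    unfolding disjoint_family_on_def
  proof (intro ballI impI)
    fix P R assume PR: "P \<in> ?F" "R \<in> ?F" "P \<noteq> R"
    then consider "P \<inter> R = {}" | "P \<subset> R" | "R \<subset> P"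
      using dyadic_nested[OF Q, of P R] F(1) by blast
    then show "E P \<inter> E R = {}"
      using PR unfolding E_def by cases blast+
  qed
  have "(\<integral>\<^sup>+P. emeasure lebesgue P \<partial>count_space ?F) \<le> (\<integral>\<^sup>+P. ennreal (1 / \<eta>) * emeasure lebesgue (E P) \<partial>count_space ?F)"
    using le by (intro nn_integral_mono) auto
  also have "\<dots> = ennreal (1 / \<eta>) * (\<integral>\<^sup>+P. emeasure lebesgue (E P) \<partial>count_space ?F)"
    by (rule nn_integral_cmult) simp
  also have "(\<integral>\<^sup>+P. emeasure lebesgue (E P) \<partial>count_space ?F) = emeasure lebesgue (\<Union>(E ` ?F))"
    using sE by (intro emeasure_UN_countable[symmetric] disj cF) auto
  also have "\<dots> \<le> emeasure lebesgue S"
    using S by (intro emeasure_mono) (auto simp: E_def)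
  finally show ?thesis
    by (simp add: mult_left_mono)
qed

text \<open>The integral of the counting function is the sum of the volumes, which packing bounds by
  |Q| / \<eta>.\<close>

lemma sparse_AE_finite:
  fixes Q :: "(real^'n) set"
  assumes Q: "Q \<in> cubes" and F: "F \<subseteq> dyadic_cubes Q" "sparse \<eta> F" and \<eta>: "\<eta> > 0"
  shows "AE x in lebesgue. finite {P \<in> F. x \<in> P}"
proof -
  have sF: "P \<in> cubes" if "P \<in> F" for P
    using dyadic_cubes_cubes[OF Q] F that by blast
  have [measurable]: "P \<in> sets lebesgue" if "P \<in> F" for P
    using sF[OF that] cubes_sets by blast
  have cF: "countable F"
    using countable_subset[OF _ countable_dyadic_cubes[OF Q]] F by blast
  have FQ: "{P\<in>F. P \<subseteq> Q} = F"
    using dyadic_cubes_subset[OF Q] F by blast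
  have meas: "(\<lambda>x. \<integral>\<^sup>+P. indicator P x \<partial>count_space F) \<in> borel_measurable lebesgue"
    using cF by (rule borel_measurable_nn_integral_count_space_indicator) measurable
  have "(\<integral>\<^sup>+x. \<integral>\<^sup>+P. indicator P x \<partial>count_space F \<partial>lebesgue) = (\<integral>\<^sup>+P. \<integral>\<^sup>+x. indicator P x \<partial>lebesgue \<partial>count_space F)"
    using cF by (intro nn_integral_count_space_nn_integral) auto
  also have "\<dots> = (\<integral>\<^sup>+P. emeasure lebesgue P \<partial>count_space F)"
    by (intro nn_integral_cong) auto
  also have "\<dots> \<le> ennreal (1 / \<eta>) * emeasure lebesgue Q"
    using sparse_packing[OF Q F \<eta> cubes_sets[OF Q]] unfolding FQ .
  also have "\<dots> < \<infinity>"
    using cubes_emeasure[OF Q] by (simp add: ennreal_mult_less_top)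
  finally have "AE x in lebesgue. (\<integral>\<^sup>+P. indicator P x \<partial>count_space F) \<noteq> \<infinity>"
    by (intro nn_integral_PInf_AE meas) auto
  then show ?thesis
    by eventually_elim
      (auto simp: nn_integral_count_space_indicator_eq_emeasure emeasure_count_space split: if_splits)
qed

text \<open>Every pointwise domination is transferred to norms here, by the ideal property,
  homogeneity and compatibility and without adding functions. If \<open>g\<close> is outside the
  space, c > 0 keeps the right side infinite.\<close>

lemma ext_norm_mono:
  assumes X: "quasi_banach_function_space Q X"
    and f: "f \<in> borel_measurable (lebesgue_on Q)"
    and le: "AE x in lebesgue_on Q. \<bar>f x\<bar> \<le> c * \<bar>g x\<bar>" and c: "c > 0"
  shows "ext_norm X f \<le> ennreal c * ext_norm X g"
proof (cases "g \<in> members X")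
  case True
  note X = X[unfolded quasi_banach_function_space_def]
  note oi = X[THEN conjunct1, unfolded order_ideal_def]
  note qn = X[THEN conjunct2, THEN conjunct1, unfolded quasi_norm_def]
  note comp = X[THEN conjunct2, THEN conjunct2, THEN conjunct1, rule_format]
  have cg: "(\<lambda>x. c * g x) \<in> members X"
    using oi True by simp
  have le': "AE x in lebesgue_on Q. \<bar>f x\<bar> \<le> \<bar>c * g x\<bar>"
    using le c by (simp add: abs_mult)
  have fm: "f \<in> members X"
    using oi[THEN conjunct2, THEN conjunct2, THEN conjunct2, THEN conjunct2, rule_format, OF cg f le'] .
  have "qnorm X f \<le> qnorm X (\<lambda>x. c * g x)"
    by (rule comp[OF fm cg le'])
  also have "\<dots> = c * qnorm X g"
    using qn True c by simp
  finally have "ennreal (qnorm X f) \<le> ennreal (c * qnorm X g)"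
    by (rule ennreal_leI)
  moreover have "qnorm X g \<ge> 0"
    using qn True by simp
  ultimately show ?thesis
    using True fm c by (simp add: ext_norm_def ennreal_mult)
next
  case False
  then show ?thesis
    using c by (simp add: ext_norm_def ennreal_mult_top)
qed

section \<open>Exponential integrability and nested sets\<close>

text \<open>A decreasing sequence of sets leaves a point once and for all, so the number of sets
  around \<open>x\<close> is also the first index whose set omits \<open>x\<close>.\<close>

lemma nested_indices_eq_lessThan:
  assumes "decseq W" "finite {k::nat. x \<in> W k}"
  shows "{k. x \<in> W k} = {..<card {k. x \<in> W k}}"
proof -
  define N where "N = (LEAST k. x \<notin> W k)"
  have "\<exists>k. x \<notin> W k"
    using assms(2) by (metis (mono_tags) infinite_UNIV_nat UNIV_eq_I mem_Collect_eq)
  then have N: "x \<notin> W N"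
    unfolding N_def by (rule LeastI_ex)
  have "x \<in> W k \<longleftrightarrow> k < N" for k
  proof
    show "x \<in> W k \<Longrightarrow> k < N"
      using N decseqD[OF assms(1), of N k] by (metis not_le subsetD)
    show "k < N \<Longrightarrow> x \<in> W k"
      unfolding N_def using not_less_Least by blast
  qed
  then have "{k. x \<in> W k} = {..<N}" by auto
  then show ?thesis by simp
qed

lemma emeasure_subset_cube:
  assumes "Q \<in> cubes" "W \<subseteq> Q" "W \<in> sets lebesgue"
  shows "emeasure lebesgue W = ennreal (measure lebesgue W)"
  by (rule emeasure_eq_measure2[OF fmeasurableI2[OF cubes_lmeasurable[OF assms(1)] assms(2,3)]])

text \<open>With N the number of sets containing x, exp (|f| / \<alpha>) is at most \<beta>^N, and
  \<beta>^N - 1 telescopes into a sum over exactly these sets. Integration leaves a geometric series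
  of ratio q \<beta>.\<close>

lemma expL_norm_nested:
  fixes Q :: "(real^'n) set"
  assumes Q: "Q \<in> cubes" and W: "\<And>k. W k \<in> sets lebesgue" "\<And>k. W k \<subseteq> Q" "\<And>k. W (Suc k) \<subseteq> W k"
    and W_le: "\<And>k. measure lebesgue (W k) \<le> q ^ k * measure lebesgue Q"
    and q: "0 < q" "q < 1" and c: "c > 0"
    and f: "f \<in> borel_measurable (lebesgue_on Q)"
      "AE x in lebesgue_on Q. \<bar>f x\<bar> \<le> c * real (card {k. x \<in> W k})"
  shows "f \<in> expL Q" "expL_norm Q f \<le> ennreal (c / ln (2 / (1 + q)))"
proof -
  \<comment> \<open>This choice makes the series of ratio \<open>q * \<beta>\<close>, weighted by
    \<open>\<beta> - 1\<close>, sum to exactly 1, the bound in the definition of the exponential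
    norm.\<close>
  define \<beta> where "\<beta> = 2 / (1 + q)"
  have \<beta>: "1 < \<beta>" "q * \<beta> < 1" "(\<beta> - 1) / (1 - q * \<beta>) = 1"
    using q by (auto simp: \<beta>_def field_simps)
  define \<alpha> where "\<alpha> = c / ln \<beta>"
  have \<alpha>: "\<alpha> > 0"
    using c \<beta> by (simp add: \<alpha>_def)
  have dec: "decseq W"
    using W(3) by (rule decseq_SucI)
  have point: "ennreal (exp (\<bar>f x\<bar> / \<alpha>) - 1) \<le> (\<Sum>k. ennreal ((\<beta> - 1) * \<beta> ^ k) * indicator (W k) x)"
    if le: "\<bar>f x\<bar> \<le> c * real (card {k. x \<in> W k})" for x
  proof (cases "finite {k. x \<in> W k}")
    case False
    \<comment> \<open>Here \<open>card\<close> is 0, so the hypothesis forces f x = 0 and the left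
      side vanishes.\<close>
    then show ?thesis using le by simp
  next
    case True
    define N where "N = card {k. x \<in> W k}"
    have N: "{k. x \<in> W k} = {..<N}"
      unfolding N_def using nested_indices_eq_lessThan[OF dec True] .
    have "\<bar>f x\<bar> / \<alpha> \<le> ln \<beta> * N"
      using le c \<beta> by (simp add: \<alpha>_def N_def[symmetric] field_simps)
    then have "exp (\<bar>f x\<bar> / \<alpha>) \<le> exp (ln \<beta> * N)" by simp
    also have "\<dots> = \<beta> ^ N"
      using \<beta> by (metis exp_ln exp_of_nat_mult less_trans mult.commute zero_less_one)
    finally have "exp (\<bar>f x\<bar> / \<alpha>) - 1 \<le> \<beta> ^ N - 1" by simp
    also have "\<dots> = (\<Sum>k<N. (\<beta> - 1) * \<beta> ^ k)"
      by (simp add: power_diff_1_eq sum_distrib_left)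
    finally have "ennreal (exp (\<bar>f x\<bar> / \<alpha>) - 1) \<le> ennreal (\<Sum>k<N. (\<beta> - 1) * \<beta> ^ k)"
      by (rule ennreal_leI)
    also have "\<dots> = (\<Sum>k<N. ennreal ((\<beta> - 1) * \<beta> ^ k))"
      using \<beta> by (subst sum_ennreal) auto
    also have "\<dots> = (\<Sum>k<N. ennreal ((\<beta> - 1) * \<beta> ^ k) * indicator (W k) x)"
    proof (rule sum.cong)
      fix k assume "k \<in> {..<N}"
      then have "x \<in> W k" unfolding N[symmetric] by simp
      then show "ennreal ((\<beta> - 1) * \<beta> ^ k) = ennreal ((\<beta> - 1) * \<beta> ^ k) * indicator (W k) x" by simp
    qed simp
    also have "\<dots> \<le> (\<Sum>k. ennreal ((\<beta> - 1) * \<beta> ^ k) * indicator (W k) x)"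
      by (intro sum_le_suminf) auto
    finally show ?thesis .
  qed
  have Qs: "Q \<in> sets lebesgue" by (rule cubes_sets[OF Q])
  have W_Q: "W k \<in> sets (lebesgue_on Q)" for k
    using W Qs by (simp add: sets_restrict_space_iff)
  have em: "emeasure (lebesgue_on Q) (W k) = ennreal (measure lebesgue (W k))" for k
    unfolding emeasure_subset_cube[OF Q W(2) W(1), symmetric]
    using W Qs by (intro emeasure_restrict_space) auto
  have "(\<integral>\<^sup>+x. ennreal (exp (\<bar>f x\<bar> / \<alpha>) - 1) \<partial>lebesgue_on Q)
      \<le> (\<integral>\<^sup>+x. (\<Sum>k. ennreal ((\<beta> - 1) * \<beta> ^ k) * indicator (W k) x) \<partial>lebesgue_on Q)"
    using f(2) point by (intro nn_integral_mono_AE) auto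
  also have "\<dots> = (\<Sum>k. \<integral>\<^sup>+x. ennreal ((\<beta> - 1) * \<beta> ^ k) * indicator (W k) x \<partial>lebesgue_on Q)"
    using W_Q by (intro nn_integral_suminf) auto
  also have "\<dots> = (\<Sum>k. ennreal ((\<beta> - 1) * \<beta> ^ k * measure lebesgue (W k)))"
    using W_Q \<beta> by (subst nn_integral_cmult_indicator) (auto simp: em ennreal_mult)
  also have "\<dots> \<le> (\<Sum>k. ennreal ((\<beta> - 1) * measure lebesgue Q * (q * \<beta>) ^ k))"
  proof (intro suminf_le ennreal_leI)
    fix k
    have "(\<beta> - 1) * \<beta> ^ k * measure lebesgue (W k) \<le> (\<beta> - 1) * \<beta> ^ k * (q ^ k * measure lebesgue Q)"
      using W_le \<beta> by (intro mult_left_mono) auto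
    then show "(\<beta> - 1) * \<beta> ^ k * measure lebesgue (W k) \<le> (\<beta> - 1) * measure lebesgue Q * (q * \<beta>) ^ k"
      by (simp add: power_mult_distrib mult_ac)
  qed auto
  also have "\<dots> = ennreal (\<Sum>k. (\<beta> - 1) * measure lebesgue Q * (q * \<beta>) ^ k)"
    using \<beta> q by (intro suminf_ennreal2 summable_mult summable_geometric) auto
  also have "(\<Sum>k. (\<beta> - 1) * measure lebesgue Q * (q * \<beta>) ^ k) = (\<beta> - 1) * measure lebesgue Q * (1 / (1 - q * \<beta>))"
    using \<beta> q by (subst suminf_mult) (auto simp: suminf_geometric)
  also have "\<dots> = (\<beta> - 1) / (1 - q * \<beta>) * measure lebesgue Q"
    by simp
  also have "ennreal \<dots> = emeasure lebesgue Q"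
    by (simp add: \<beta>(3) cubes_emeasure[OF Q])
  finally have "(\<integral>\<^sup>+x. ennreal (exp (\<bar>f x\<bar> / \<alpha>) - 1) \<partial>lebesgue_on Q) / emeasure lebesgue Q \<le> 1"
    using cubes_pos[OF Q] by (intro divide_le_posI_ennreal) (auto simp: cubes_emeasure[OF Q])
  then have le: "expL_norm Q f \<le> ennreal \<alpha>"
    unfolding expL_norm_def using \<alpha> by (intro Inf_lower) auto
  then show "expL_norm Q f \<le> ennreal (c / ln (2 / (1 + q)))"
    by (simp add: \<alpha>_def \<beta>_def)
  show "f \<in> expL Q"
    using f le by (auto simp: expL_def order.strict_trans1)
qed

lemma ennreal_divide_mult_cancel: "b \<noteq> 0 \<Longrightarrow> b \<noteq> top \<Longrightarrow> a / b * b = (a::ennreal)"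
  by (metis ennreal_mult_divide_eq ennreal_times_divide mult.commute)

text \<open>The norm is an infimum, so a lower bound for it is checked on each admissible \<alpha>
  separately. The proofs of (iv) thereby work with one fixed \<alpha>.\<close>

lemma expL_norm_greatest:
  assumes "c > 0"
    and le: "\<And>\<alpha>. \<alpha> > 0 \<Longrightarrow>
      (\<integral>\<^sup>+x. ennreal (exp (\<bar>f x\<bar> / \<alpha>) - 1) \<partial>lebesgue_on Q) / emeasure lebesgue Q \<le> 1 \<Longrightarrow>
      y \<le> ennreal (c * \<alpha>)"
  shows "y \<le> ennreal c * expL_norm Q f"
proof -
  have "y / ennreal c \<le> expL_norm Q f"
    unfolding expL_norm_def
  proof (rule Inf_greatest)
    fix z assume "z \<in> {ennreal \<alpha> | \<alpha>. \<alpha> > 0 \<and>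
     (\<integral>\<^sup>+x. ennreal (exp (\<bar>f x\<bar> / \<alpha>) - 1) \<partial>lebesgue_on Q) / emeasure lebesgue Q \<le> 1}"
    then obtain \<alpha> where \<alpha>: "z = ennreal \<alpha>" "\<alpha> > 0" "y \<le> ennreal (c * \<alpha>)"
      using le by auto
    then show "y / ennreal c \<le> z"
      using assms(1) by (intro divide_le_posI_ennreal) (auto simp: ennreal_mult)
  qed
  then have "ennreal c * (y / ennreal c) \<le> ennreal c * expL_norm Q f"
    by (rule mult_left_mono) simp
  then show ?thesis
    using assms(1) by (simp add: ennreal_times_divide ennreal_mult_divide_eq mult.commute[of "ennreal c"])
qed

text \<open>Restoring the subtracted 1 adds |Q| once more, whence the factor 2.\<close>

lemma exp_integral_le:
  fixes Q :: "(real^'n) set"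
  assumes Q: "Q \<in> cubes" and f: "f \<in> borel_measurable (lebesgue_on Q)"
    and le: "(\<integral>\<^sup>+x. ennreal (exp (\<bar>f x\<bar> / \<alpha>) - 1) \<partial>lebesgue_on Q) / emeasure lebesgue Q \<le> 1"
    and \<alpha>: "\<alpha> > 0"
  shows "(\<integral>\<^sup>+x. ennreal (exp (\<bar>f x\<bar> / \<alpha>)) \<partial>lebesgue_on Q) \<le> ennreal (2 * measure lebesgue Q)"
proof -
  note [measurable] = f
  have Qs: "Q \<in> sets lebesgue" by (rule cubes_sets[OF Q])
  have pos: "0 < emeasure lebesgue Q" "emeasure lebesgue Q < top"
    using cubes_pos[OF Q] by (auto simp: cubes_emeasure[OF Q])
  have "(\<integral>\<^sup>+x. ennreal (exp (\<bar>f x\<bar> / \<alpha>) - 1) \<partial>lebesgue_on Q) =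
      (\<integral>\<^sup>+x. ennreal (exp (\<bar>f x\<bar> / \<alpha>) - 1) \<partial>lebesgue_on Q) / emeasure lebesgue Q * emeasure lebesgue Q"
    using pos by (intro ennreal_divide_mult_cancel[symmetric]) auto
  also have "\<dots> \<le> 1 * emeasure lebesgue Q"
    using le by (rule mult_right_mono) simp
  finally have *: "(\<integral>\<^sup>+x. ennreal (exp (\<bar>f x\<bar> / \<alpha>) - 1) \<partial>lebesgue_on Q) \<le> emeasure lebesgue Q"
    by simp
  have "ennreal (exp (\<bar>f x\<bar> / \<alpha>)) = ennreal (exp (\<bar>f x\<bar> / \<alpha>) - 1) + 1" for x
    using \<alpha> by (subst ennreal_1[symmetric], subst ennreal_plus[symmetric]) auto
  then have "(\<integral>\<^sup>+x. ennreal (exp (\<bar>f x\<bar> / \<alpha>)) \<partial>lebesgue_on Q) =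
      (\<integral>\<^sup>+x. ennreal (exp (\<bar>f x\<bar> / \<alpha>) - 1) + 1 \<partial>lebesgue_on Q)"
    by simp
  also have "\<dots> = (\<integral>\<^sup>+x. ennreal (exp (\<bar>f x\<bar> / \<alpha>) - 1) \<partial>lebesgue_on Q) + emeasure lebesgue Q"
    using Qs by (subst nn_integral_add) (auto simp: emeasure_restrict_space space_restrict_space)
  also have "\<dots> \<le> emeasure lebesgue Q + emeasure lebesgue Q"
    using * by (rule add_right_mono)
  also have "\<dots> = ennreal (2 * measure lebesgue Q)"
    by (simp add: cubes_emeasure[OF Q] flip: ennreal_plus)
  finally show ?thesis .
qed

text \<open>Chebyshev's inequality for exp (|f| / \<alpha>), whose average over \<open>Q\<close> is
  at most 2.\<close>

lemma exp_tail_le: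
  fixes Q :: "(real^'n) set"
  assumes Q: "Q \<in> cubes" and f: "f \<in> borel_measurable (lebesgue_on Q)"
    and le: "(\<integral>\<^sup>+x. ennreal (exp (\<bar>f x\<bar> / \<alpha>) - 1) \<partial>lebesgue_on Q) / emeasure lebesgue Q \<le> 1"
    and \<alpha>: "\<alpha> > 0"
  shows "{x \<in> Q. t < \<bar>f x\<bar>} \<in> sets lebesgue"
    "measure lebesgue {x \<in> Q. t < \<bar>f x\<bar>} \<le> 2 * exp (- t / \<alpha>) * measure lebesgue Q"
proof -
  note [measurable] = f
  let ?S = "{x \<in> Q. t < \<bar>f x\<bar>}"
  have Qs: "Q \<in> sets lebesgue" by (rule cubes_sets[OF Q])
  have "{x \<in> space (lebesgue_on Q). t < \<bar>f x\<bar>} \<in> sets (lebesgue_on Q)"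
    by measurable
  then have S: "?S \<in> sets (lebesgue_on Q)"
    by (simp add: space_restrict_space)
  then show Sl: "?S \<in> sets lebesgue"
    using Qs by (simp add: sets_restrict_space_iff)
  have "ennreal (exp (t / \<alpha>) * measure lebesgue ?S) = ennreal (exp (t / \<alpha>)) * emeasure lebesgue ?S"
    using Q Sl by (subst emeasure_subset_cube[OF Q]) (auto simp: ennreal_mult)
  also have "\<dots> = ennreal (exp (t / \<alpha>)) * emeasure (lebesgue_on Q) ?S"
    using Qs by (subst emeasure_restrict_space) auto
  also have "\<dots> = (\<integral>\<^sup>+x. ennreal (exp (t / \<alpha>)) * indicator ?S x \<partial>lebesgue_on Q)"
    using S by (rule nn_integral_cmult_indicator[symmetric])
  also have "\<dots> \<le> (\<integral>\<^sup>+x. ennreal (exp (\<bar>f x\<bar> / \<alpha>)) \<partial>lebesgue_on Q)"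
    using \<alpha> by (intro nn_integral_mono) (auto simp: indicator_def divide_right_mono)
  also have "\<dots> \<le> ennreal (2 * measure lebesgue Q)"
    by (rule exp_integral_le[OF Q f le \<alpha>])
  finally have "exp (t / \<alpha>) * measure lebesgue ?S \<le> 2 * measure lebesgue Q"
    by (simp add: ennreal_le_iff)
  then show "measure lebesgue ?S \<le> 2 * exp (- t / \<alpha>) * measure lebesgue Q"
    by (simp add: exp_minus field_simps)
qed

text \<open>Borel--Cantelli, since the measures are dominated by a summable geometric
  sequence.\<close>

lemma nested_AE_finite:
  assumes Q: "Q \<in> cubes" and W: "\<And>k. W k \<in> sets lebesgue" "\<And>k. W k \<subseteq> Q"
    and W_le: "\<And>k. measure lebesgue (W k) \<le> q ^ k * measure lebesgue Q"
    and q: "0 < q" "q < 1"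
  shows "AE x in lebesgue. finite {k. x \<in> W k}"
proof -
  have "AE x in lebesgue. eventually (\<lambda>k. x \<in> space lebesgue - W k) sequentially"
  proof (rule borel_cantelli_AE1)
    show "summable (\<lambda>k. measure lebesgue (W k))"
      using q W_le by (intro summable_comparison_test'[OF summable_mult2[OF summable_geometric]]) auto
    show "emeasure lebesgue (W k) < \<infinity>" for k
      by (simp only: emeasure_subset_cube[OF Q W(2) W(1)] ennreal_less_top infinity_ennreal_def)
  qed (rule W)
  then show ?thesis
  proof eventually_elim
    case (elim x)
    then obtain N where "\<And>k. k \<ge> N \<Longrightarrow> x \<notin> W k"
      by (auto simp: eventually_sequentially)
    then have "{k. x \<in> W k} \<subseteq> {..<N}"
      by (auto simp: not_le[symmetric])
    then show ?case by (rule finite_subset) simp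
  qed
qed

lemma AE_lebesgue_on:
  assumes "Q \<in> cubes" "AE x in lebesgue. x \<in> Q \<longrightarrow> P x"
  shows "AE x in lebesgue_on Q. P x"
  using assms cubes_sets[OF assms(1)] by (subst AE_restrict_space_iff) auto

text \<open>The sum of the indicators is its own dominating function, so
  \<open>expL_norm_nested\<close> applies with c = 1.\<close>

lemma expL_bound_imp_nested_bound:
  fixes X :: "(real^'n) set \<Rightarrow> (real^'n) fun_space"
  assumes q: "0 < q" "q < 1" and X: "expL_bound X C" and C: "C > 0"
  shows "nested_bound q X (1 / ln (2 / (1 + q)) * C)"
  unfolding nested_bound_def
proof (intro ballI allI impI)
  fix Q :: "(real^'n) set" and W :: "nat \<Rightarrow> (real^'n) set"
  assume Q: "Q \<in> cubes"
    and "\<forall>k. W k \<in> sets lebesgue \<and> W k \<subseteq> Q \<and> W (Suc k) \<subseteq> W k \<and>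
             measure lebesgue (W k) \<le> q ^ k * measure lebesgue Q"
  then have W: "\<And>k. W k \<in> sets lebesgue" "\<And>k. W k \<subseteq> Q" "\<And>k. W (Suc k) \<subseteq> W k"
    "\<And>k. measure lebesgue (W k) \<le> q ^ k * measure lebesgue Q"
    by auto
  let ?h = "\<lambda>x. \<Sum>\<^sub>\<infinity>k. indicator (W k) x :: real"
  have h: "?h x = real (card {k. x \<in> W k})" for x
    using infsum_indicator_eq_card[of W x UNIV] by simp
  have "?h \<in> borel_measurable lebesgue"
    unfolding h using borel_measurable_card_sets[of "UNIV :: nat set" W lebesgue] W by simp
  then have "?h \<in> borel_measurable (lebesgue_on Q)"
    by (rule measurable_restrict_space1)
  then have e: "?h \<in> expL Q" "expL_norm Q ?h \<le> ennreal (1 / ln (2 / (1 + q)))"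
    using expL_norm_nested[OF Q W q, of 1 ?h] by (auto simp: h)
  have "ext_norm (X Q) ?h \<le> ennreal C * expL_norm Q ?h"
    using X Q e unfolding expL_bound_def by auto
  also have "\<dots> \<le> ennreal C * ennreal (1 / ln (2 / (1 + q)))"
    using e by (intro mult_left_mono) auto
  also have "\<dots> = ennreal (1 / ln (2 / (1 + q)) * C)"
    using C q by (subst ennreal_mult[symmetric]) (auto simp: mult.commute)
  finally show "ext_norm (X Q) ?h \<le> ennreal (1 / ln (2 / (1 + q)) * C)" .
qed

text \<open>The tail bound for |f| shrinks by the factor q when the height grows by \<alpha> ln (1 /
  q). Level sets at this spacing therefore serve as nested sets, and their counting function
  dominates |f| up to a constant.\<close>

lemma nested_bound_imp_expL_bound:
  fixes X :: "(real^'n) set \<Rightarrow> (real^'n) fun_space"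
  assumes q: "0 < q" "q < 1"
  shows "\<exists>K>0. \<forall>X :: (real^'n) set \<Rightarrow> (real^'n) fun_space. \<forall>C>0.
    (\<forall>Q\<in>cubes. quasi_banach_function_space Q (X Q)) \<longrightarrow> nested_bound q X C \<longrightarrow> expL_bound X (K * C)"
proof -
  \<comment> \<open>The tail bound carries a factor 2; starting \<open>k0\<close> levels higher
    absorbs it.\<close>
  obtain k0 where k0: "q ^ k0 < 1 / 2"
    using real_arch_pow_inv[of "1/2" q] q by auto
  define L where "L = ln (1 / q)"
  have L: "L > 0" "exp (- L) = q"
    using q by (auto simp: L_def ln_div)
  define K where "K = L * real (k0 + 1)"
  have "expL_bound X (K * C)"
    if X: "\<forall>Q\<in>cubes. quasi_banach_function_space Q (X Q)" and nb: "nested_bound q X C" and C: "C > 0"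
    for X :: "(real^'n) set \<Rightarrow> (real^'n) fun_space" and C
    unfolding expL_bound_def
  proof (intro ballI expL_norm_greatest)
    show "0 < K * C" using L C by (simp add: K_def)
    fix Q :: "(real^'n) set" and f \<alpha>
    assume Q: "Q \<in> cubes" and "f \<in> expL Q" and \<alpha>: "\<alpha> > 0"
      and le: "(\<integral>\<^sup>+x. ennreal (exp (\<bar>f x\<bar> / \<alpha>) - 1) \<partial>lebesgue_on Q) / emeasure lebesgue Q \<le> 1"
    then have f: "f \<in> borel_measurable (lebesgue_on Q)"
      by (auto simp: expL_def)
    define S where "S k = {x \<in> Q. real (k + k0) * (\<alpha> * L) < \<bar>f x\<bar>}" for k
    \<comment> \<open>Taking \<open>Q\<close> itself at index 0 makes every point count at least
      once, so the \<open>k0\<close> skipped levels can be absorbed into a multiple of the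
      count.\<close>
    define W where "W k = (if k = 0 then Q else S k)" for k
    have W1: "W k \<in> sets lebesgue" "W k \<subseteq> Q" for k
      using exp_tail_le(1)[OF Q f le \<alpha>] cubes_sets[OF Q] by (auto simp: W_def S_def)
    have W2: "W (Suc k) \<subseteq> W k" for k
    proof
      fix x assume x: "x \<in> W (Suc k)"
      have "real (k + k0) * (\<alpha> * L) \<le> real (Suc k + k0) * (\<alpha> * L)"
        using \<alpha> L by (intro mult_right_mono) auto
      then show "x \<in> W k"
        using x by (auto simp: W_def S_def)
    qed
    have W3: "measure lebesgue (W k) \<le> q ^ k * measure lebesgue Q" for k
    proof (cases "k = 0")
      case False
      have "measure lebesgue (W k) \<le> 2 * exp (- (real (k + k0) * (\<alpha> * L)) / \<alpha>) * measure lebesgue Q"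
        using exp_tail_le(2)[OF Q f le \<alpha>, of "real (k + k0) * (\<alpha> * L)"] False by (simp add: W_def S_def)
      also have "exp (- (real (k + k0) * (\<alpha> * L)) / \<alpha>) = exp (- L) ^ (k + k0)"
        using \<alpha> by (subst exp_of_nat_mult[symmetric]) simp
      also have "2 * exp (- L) ^ (k + k0) = q ^ k * (2 * q ^ k0)"
        using L by (simp add: power_add)
      also have "\<dots> * measure lebesgue Q \<le> q ^ k * 1 * measure lebesgue Q"
        using k0 q by (intro mult_right_mono mult_left_mono) auto
      finally show ?thesis by simp
    qed (simp add: W_def)
    let ?h = "\<lambda>x. \<Sum>\<^sub>\<infinity>k. indicator (W k) x :: real"
    have h: "?h x = real (card {k. x \<in> W k})" for x
      using infsum_indicator_eq_card[of W x UNIV] by simp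
    have dec: "decseq W" using W2 by (rule decseq_SucI)
    have "AE x in lebesgue. x \<in> Q \<longrightarrow> \<bar>f x\<bar> \<le> K * \<alpha> * \<bar>?h x\<bar>"
      using nested_AE_finite[OF Q W1 W3 q]
    proof (rule AE_mp, intro AE_I2 impI)
      fix x assume elim: "finite {k. x \<in> W k}" "x \<in> Q"
      define N where "N = card {k. x \<in> W k}"
      have N: "{k. x \<in> W k} = {..<N}"
        unfolding N_def by (rule nested_indices_eq_lessThan[OF dec elim(1)])
      have "x \<in> W 0" using elim by (simp add: W_def)
      then have "N > 0" using N by auto
      moreover have "x \<notin> W N" using N by auto
      ultimately have "\<bar>f x\<bar> \<le> real (N + k0) * (\<alpha> * L)"
        using elim by (auto simp: W_def S_def)
      also have "\<dots> \<le> real ((k0 + 1) * N) * (\<alpha> * L)"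
      proof (intro mult_right_mono)
        have "k0 * 1 \<le> k0 * N" using \<open>N > 0\<close> by (intro mult_le_mono) auto
        then show "real (N + k0) \<le> real ((k0 + 1) * N)"
          unfolding of_nat_le_iff by simp
      qed (use \<alpha> L in auto)
      also have "\<dots> = K * \<alpha> * \<bar>?h x\<bar>"
        unfolding h by (simp add: K_def N_def algebra_simps)
      finally show "\<bar>f x\<bar> \<le> K * \<alpha> * \<bar>?h x\<bar>" .
    qed
    then have "ext_norm (X Q) f \<le> ennreal (K * \<alpha>) * ext_norm (X Q) ?h"
      using X Q f \<alpha> L by (intro ext_norm_mono AE_lebesgue_on) (auto simp: K_def)
    also have "\<dots> \<le> ennreal (K * \<alpha>) * ennreal C"
      using nb Q W1 W2 W3 unfolding nested_bound_def by (intro mult_left_mono) auto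
    also have "\<dots> = ennreal (K * C * \<alpha>)"
      using \<alpha> C L by (subst ennreal_mult[symmetric]) (auto simp: K_def mult_ac)
    finally show "ext_norm (X Q) f \<le> ennreal (K * C * \<alpha>)" .
  qed
  moreover have "K > 0" using L by (simp add: K_def)
  ultimately show ?thesis by blast
qed

section \<open>Sparse domination of exponentially integrable functions\<close>

lemma dyadic_parent:
  fixes Q :: "(real^'n) set"
  assumes Q: "Q \<in> cubes" and P: "P \<in> dyadic_cubes Q" "P \<noteq> Q"
  obtains R where "R \<in> dyadic_cubes Q" "P \<subset> R" "measure lebesgue R = 2 ^ CARD('n) * measure lebesgue P"
proof -
  obtain a l where Qa: "Q = cube a l" "l > 0" using Q by (auto simp: cubes_def)
  obtain k x where x: "P = dcube a l k x" "x \<in> Q"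
    using P(1) unfolding Qa(1) dyadic_cubes_eq[OF Qa(2)] by blast
  have "k \<noteq> 0"
    using x P(2) dcube_0[OF Qa(2)] Qa(1) by metis
  then obtain j where j: "k = Suc j" by (cases k) auto
  let ?R = "dcube a l j x"
  have m: "measure lebesgue (dcube a l i x) = (l / 2 ^ i) ^ CARD('n)" for i
    unfolding dcube_eq_cube[OF Qa(2)] using Qa(2) by (intro measure_cube) simp
  have "l / 2 ^ j = 2 * (l / 2 ^ k)"
    by (simp add: j)
  then have me: "measure lebesgue ?R = 2 ^ CARD('n) * measure lebesgue P"
    unfolding x(1) m by (simp only: power_mult_distrib)
  have "measure lebesgue P > 0"
    unfolding x(1) m using Qa(2) by simp
  moreover have "(1::real) < 2 ^ CARD('n)"
    by simp
  ultimately have "measure lebesgue P < measure lebesgue ?R"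
    unfolding me by simp
  then have "P \<noteq> ?R" by blast
  moreover have "P \<subseteq> ?R"
    unfolding x(1) j by (rule dcube_Suc)
  moreover have "?R \<in> dyadic_cubes Q"
    using x(2) unfolding Qa(1) dyadic_cubes_eq[OF Qa(2)] by blast
  ultimately show thesis
    using that me by blast
qed

text \<open>The parent still satisfies the bound and has 2^n times the volume, so the average over a
  stopping cube overshoots the height by at most 2^n.\<close>

lemma stopping_cube_average_le:
  fixes v :: "real^'n \<Rightarrow> ennreal"
  assumes Q: "Q \<in> cubes" and P: "P \<in> dyadic_cubes Q" "P \<noteq> Q" and t: "t \<ge> 0"
    and le: "\<And>R. R \<in> dyadic_cubes Q \<Longrightarrow> P \<subset> R \<Longrightarrow>
      (\<integral>\<^sup>+x\<in>R. v x \<partial>lebesgue) \<le> ennreal t * emeasure lebesgue R"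
  shows "(\<integral>\<^sup>+x\<in>P. v x \<partial>lebesgue) \<le> ennreal (2 ^ CARD('n) * t) * emeasure lebesgue P"
proof -
  obtain R where R: "R \<in> dyadic_cubes Q" "P \<subset> R" "measure lebesgue R = 2 ^ CARD('n) * measure lebesgue P"
    using dyadic_parent[OF Q P] .
  have PR: "P \<in> cubes" "R \<in> cubes"
    using R P dyadic_cubes_cubes[OF Q] by auto
  have "(\<integral>\<^sup>+x\<in>P. v x \<partial>lebesgue) \<le> (\<integral>\<^sup>+x\<in>R. v x \<partial>lebesgue)"
    using R by (intro nn_integral_mono) (auto simp: indicator_def)
  also have "\<dots> \<le> ennreal t * emeasure lebesgue R"
    using R by (intro le) auto
  also have "\<dots> = ennreal (2 ^ CARD('n) * t) * emeasure lebesgue P"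
    using t by (simp add: cubes_emeasure[OF PR(1)] cubes_emeasure[OF PR(2)] R(3) mult_ac flip: ennreal_mult)
  finally show ?thesis .
qed

text \<open>The family consists of \<open>Q\<close> and of the maximal dyadic cubes on which the average of \<open>v\<close>
  exceeds \<open>2 A\<^bsup>k+1\<^esup>\<close>; a point where \<open>v\<close> is large lies in a cube of each low level.\<close>

lemma sparse_family_log_dominates:
  fixes Q :: "(real^'n) set" and v :: "real^'n \<Rightarrow> ennreal"
  assumes Q: "Q \<in> cubes" and \<eta>: "0 < \<eta>" "\<eta> < 1"
    and v [measurable]: "v \<in> borel_measurable lebesgue"
    and int: "(\<integral>\<^sup>+x\<in>Q. v x \<partial>lebesgue) \<le> ennreal 2 * emeasure lebesgue Q"
  defines "A \<equiv> 2 ^ CARD('n) / (1 - \<eta>)"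
  obtains F where "F \<subseteq> dyadic_cubes Q" "sparse \<eta> F"
    "AE x in lebesgue. x \<in> Q \<longrightarrow>
       0 < card {P \<in> F. x \<in> P} \<and> v x \<le> ennreal (2 * A ^ card {P \<in> F. x \<in> P})"
proof -
  define big where "big t P \<longleftrightarrow> \<not> (\<integral>\<^sup>+x\<in>P. v x \<partial>lebesgue) \<le> ennreal t * emeasure lebesgue P"
    for t :: real and P
  have big_mono: "big s P" if "big t P" "s \<le> t" for s t P
  proof -
    have "ennreal s * emeasure lebesgue P \<le> ennreal t * emeasure lebesgue P"
      using that by (intro mult_right_mono ennreal_leI) auto
    then show ?thesis using that unfolding big_def by (meson order_trans)
  qed
  have two_pow: "(2::real) \<le> 2 ^ CARD('n)"
    using power_increasing[of 1 "CARD('n)" "2::real"] by simp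
  \<comment> \<open>Heights growing by at least 2^n keep stopping cubes of different levels
    distinct.\<close>
  have A: "2 ^ CARD('n) \<le> A"
    unfolding A_def using \<eta> by (simp add: field_simps)
  then have A1: "1 \<le> A" "0 < A" using two_pow by linarith+
  \<comment> \<open>Already the lowest height 2 A exceeds the average 2 allowed on \<open>Q\<close>,
    so \<open>Q\<close> is never a stopping cube; in \<open>F\<close> it plays the part of an extra
    level of height 2.\<close>
  define lam where "lam k = 2 * A ^ Suc k" for k
  have lam_pos: "0 < lam k" for k using A1 by (simp add: lam_def)
  have lam_Suc: "lam (Suc k) = A * lam k" for k by (simp add: lam_def)
  have lam_mono: "lam j \<le> lam k" if "j \<le> k" for j k
    using that A1 by (simp add: lam_def power_increasing)
  have lam_0: "2 * A \<le> lam k" for k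
    using lam_mono[of 0 k] by (simp add: lam_def)
  define S where "S k = {P\<in>dyadic_cubes Q. big (lam k) P \<and> (\<forall>R\<in>dyadic_cubes Q. P \<subset> R \<longrightarrow> \<not> big (lam k) R)}" for k
  define F where "F = insert Q (\<Union>k. S k)"
  have notQ: "\<not> big 2 Q" using int by (simp add: big_def)
  then have SQ: "Q \<notin> S k" for k
    using big_mono[of "lam k" Q 2] lam_0[of k] A1 by (auto simp: S_def)
  have SD: "S k \<subseteq> dyadic_cubes Q" for k by (auto simp: S_def)
  have FD: "F \<subseteq> dyadic_cubes Q"
    using SD by (auto simp: F_def dyadic_cubes.self)
  have S_le: "\<not> big (2 ^ CARD('n) * lam k) P" if "P \<in> S k" for P k
    using stopping_cube_average_le[OF Q, of P "lam k" v] that SQ lam_pos[of k]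
    by (auto simp: S_def big_def)
  have sC: "P \<in> cubes" if "P \<in> F" for P
    using dyadic_cubes_cubes[OF Q] FD that by blast
  have ss: "\<Union>G \<in> sets lebesgue" if "G \<subseteq> F" for G
    using that sC cubes_sets FD countable_subset[OF _ countable_dyadic_cubes[OF Q], of G]
    by (intro sets.countable_Union) blast+
  have sp: "sparse \<eta> F"
    unfolding sparse_def
  proof
    fix P assume P: "P \<in> F"
    \<comment> \<open>Common form of both cases: the average over \<open>P\<close> is at most 2^n
      \<mu>, while smaller cubes of \<open>F\<close> have averages above A \<mu>. The quotient 2^n /
      A = 1 - \<eta> then bounds the covered fraction of \<open>P\<close>.\<close>
    have "\<exists>\<mu>>0. \<not> big (2 ^ CARD('n) * \<mu>) P \<and> (\<forall>P'\<in>F. P' \<subset> P \<longrightarrow> big (A * \<mu>) P')"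
    proof (cases "P = Q")
      case True
      have "\<not> big (2 ^ CARD('n) * 2) P"
        using notQ True big_mono[of "2 ^ CARD('n) * 2" P 2] two_pow by auto
      moreover have "big (A * 2) P'" if P': "P' \<in> F" "P' \<subset> P" for P'
      proof -
        have "P' \<noteq> Q" using P' True by blast
        then obtain k where "P' \<in> S k"
          using P'(1) unfolding F_def by blast
        then have "big (lam k) P'"
          by (simp add: S_def)
        then show ?thesis
          using lam_0[of k] by (intro big_mono[of "lam k" P' "A * 2"]) simp_all
      qed
      ultimately show ?thesis by (intro exI[of _ 2]) auto
    next
      case False
      then obtain k where k: "P \<in> S k" using P by (auto simp: F_def)
      have "big (A * lam k) P'" if P': "P' \<in> F" "P' \<subset> P" for P'
      proof -
        have "P \<subseteq> Q" using P FD dyadic_cubes_subset[OF Q] by blast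
        then have "P' \<noteq> Q" using P' by blast
        then obtain j where j: "P' \<in> S j" using P' by (auto simp: F_def)
        \<comment> \<open>\<open>P'\<close> is maximal at level j and \<open>P\<close> is larger,
          whereas \<open>P\<close> is big at level k; hence j exceeds k.\<close>
        then have "\<not> big (lam j) P"
          using k P' by (auto simp: S_def)
        then have "\<not> lam j \<le> lam k"
          using k big_mono by (auto simp: S_def)
        then have "Suc k \<le> j" using lam_mono[of j k] by linarith
        then have "A * lam k \<le> lam j"
          using lam_mono[of "Suc k" j] by (simp add: lam_Suc)
        then show ?thesis using j big_mono by (auto simp: S_def)
      qed
      then show ?thesis using S_le[OF k] lam_pos[of k] by blast
    qed
    then obtain \<mu> where \<mu>: "\<mu> > 0" "\<not> big (2 ^ CARD('n) * \<mu>) P"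
      "\<And>P'. P' \<in> F \<Longrightarrow> P' \<subset> P \<Longrightarrow> big (A * \<mu>) P'" by blast
    let ?G = "{P' \<in> F. P' \<subset> P}"
    have GP: "\<Union>?G \<subseteq> P" by blast
    have Gs: "\<Union>?G \<in> sets lebesgue" by (rule ss) blast
    have Gm: "\<Union>?G \<in> lmeasurable"
      by (rule fmeasurableI2[OF cubes_lmeasurable[OF sC[OF P]] GP Gs])
    have "ennreal (A * \<mu> * measure lebesgue (\<Union>?G)) = (\<integral>\<^sup>+x\<in>\<Union>?G. ennreal (A * \<mu>) \<partial>lebesgue)"
      using A1 \<mu> by (simp only: nn_integral_cmult_indicator[OF Gs] emeasure_eq_measure2[OF Gm])
         (simp add: ennreal_mult)
    also have "\<dots> \<le> (\<integral>\<^sup>+x\<in>\<Union>?G. v x \<partial>lebesgue)"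
    proof (rule dyadic_set_nn_integral_Union_mono[OF _ v Q])
      fix P' assume P': "P' \<in> ?G"
      have "(\<integral>\<^sup>+x\<in>P'. ennreal (A * \<mu>) \<partial>lebesgue) = ennreal (A * \<mu>) * emeasure lebesgue P'"
        using P' sC cubes_sets by (intro nn_integral_cmult_indicator) blast
      also have "\<dots> \<le> (\<integral>\<^sup>+x\<in>P'. v x \<partial>lebesgue)"
        using \<mu>(3)[of P'] P' unfolding big_def by auto
      finally show "(\<integral>\<^sup>+x\<in>P'. ennreal (A * \<mu>) \<partial>lebesgue) \<le> (\<integral>\<^sup>+x\<in>P'. v x \<partial>lebesgue)" .
    qed (use FD in auto)
    also have "\<dots> \<le> (\<integral>\<^sup>+x\<in>P. v x \<partial>lebesgue)"
      using GP by (intro nn_integral_mono) (auto simp: indicator_def)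
    also have "\<dots> \<le> ennreal (2 ^ CARD('n) * \<mu>) * emeasure lebesgue P"
      using \<mu>(2) by (simp add: big_def)
    also have "\<dots> = ennreal (2 ^ CARD('n) * \<mu> * measure lebesgue P)"
      using \<mu> by (simp add: cubes_emeasure[OF sC[OF P]] ennreal_mult)
    finally have "A * \<mu> * measure lebesgue (\<Union>?G) \<le> 2 ^ CARD('n) * \<mu> * measure lebesgue P"
      using \<mu> by (subst (asm) ennreal_le_iff) auto
    also have "2 ^ CARD('n) = A * (1 - \<eta>)"
      using \<eta> by (simp add: A_def)
    finally have "A * \<mu> * measure lebesgue (\<Union>?G) \<le> A * \<mu> * ((1 - \<eta>) * measure lebesgue P)"
      by (simp add: mult_ac)
    then have "measure lebesgue (\<Union>?G) \<le> (1 - \<eta>) * measure lebesgue P"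
      using A1 \<mu> by (subst (asm) mult_le_cancel_left_pos) auto
    moreover have "measure lebesgue (P - \<Union>?G) = measure lebesgue P - measure lebesgue (\<Union>?G)"
      by (rule measurable_measure_Diff[OF cubes_lmeasurable[OF sC[OF P]] Gs GP])
    ultimately show "\<eta> * measure lebesgue P \<le> measure lebesgue (P - \<Union>?G)"
      by (simp add: algebra_simps)
  qed
  have "AE x in lebesgue. \<forall>k. x \<in> Q \<longrightarrow>
      (\<forall>P\<in>dyadic_cubes Q. x \<in> P \<longrightarrow> \<not> big (lam k) P) \<longrightarrow> v x \<le> ennreal (lam k)"
    using AE_le_of_dyadic_averages_le[OF v Q less_imp_le[OF lam_pos]] unfolding AE_all_countable big_def by auto
  with sparse_AE_finite[OF Q FD sp \<eta>(1)]
  have "AE x in lebesgue. x \<in> Q \<longrightarrow>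
       0 < card {P \<in> F. x \<in> P} \<and> v x \<le> ennreal (2 * A ^ card {P \<in> F. x \<in> P})"
  proof eventually_elim
    case (elim x)
    show ?case
    proof (intro impI conjI)
      assume x: "x \<in> Q"
      define m where "m = card {P \<in> F. x \<in> P}"
      have "Q \<in> {P \<in> F. x \<in> P}" using x by (simp add: F_def)
      then show "0 < card {P \<in> F. x \<in> P}"
        using elim(1) by (auto simp: card_gt_0_iff)
      show "v x \<le> ennreal (2 * A ^ card {P \<in> F. x \<in> P})"
      proof (rule ccontr)
        assume "\<not> v x \<le> ennreal (2 * A ^ card {P \<in> F. x \<in> P})"
        then have less: "ennreal (2 * A ^ m) < v x" by (simp add: m_def)
        \<comment> \<open>A value above 2 A^m exceeds the heights of levels 0 to m - 1, so each of
          these has a stopping cube through \<open>x\<close>. Together with \<open>Q\<close> this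
          makes m + 1 members of \<open>F\<close>, although only m contain \<open>x\<close>.\<close>
        have "\<exists>P. P \<in> S k \<and> x \<in> P" if "k < m" for k
        proof -
          have "lam k \<le> 2 * A ^ m"
            unfolding lam_def using that A1 by (intro mult_left_mono power_increasing) auto
          then have "\<not> v x \<le> ennreal (lam k)"
            using less ennreal_leI by (metis not_le order_less_le_trans order_less_imp_le)
          then obtain P where P: "P \<in> dyadic_cubes Q" "x \<in> P" "big (lam k) P"
            using elim(2) x by blast
          let ?G = "{P\<in>dyadic_cubes Q. big (lam k) P}"
          have "x \<in> \<Union>?G" using P by blast
          then have "x \<in> \<Union>{P \<in> ?G. \<forall>R\<in>?G. \<not> P \<subset> R}"
            by (subst maximal_cubes(2)[OF Q]) auto
          then show ?thesis by (auto simp: S_def)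
        qed
        then obtain p where p: "\<And>k. k < m \<Longrightarrow> p k \<in> S k" "\<And>k. k < m \<Longrightarrow> x \<in> p k" by metis
        \<comment> \<open>The average over a cube of \<open>S j\<close> is at most 2^n times its
          height, hence at most the next height.\<close>
        have disj: "p j \<noteq> p k" if "j < k" "k < m" for j k
        proof
          assume eq: "p j = p k"
          have "big (lam k) (p j)" using p(1)[of k] that eq by (auto simp: S_def)
          moreover have "2 ^ CARD('n) * lam j \<le> lam k"
          proof -
            have "2 ^ CARD('n) * lam j \<le> lam (Suc j)"
              unfolding lam_Suc using A lam_pos[of j] by (intro mult_right_mono) auto
            also have "\<dots> \<le> lam k" using that by (intro lam_mono) auto
            finally show ?thesis .
          qed
          ultimately have "big (2 ^ CARD('n) * lam j) (p j)" by (rule big_mono)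
          then show False using S_le[OF p(1)[of j]] that by auto
        qed
        have "inj_on p {..<m}"
        proof (rule inj_onI)
          fix j k assume "j \<in> {..<m}" "k \<in> {..<m}" "p j = p k"
          then show "j = k" using disj[of j k] disj[of k j] by (cases j k rule: linorder_cases) auto
        qed
        moreover have "Q \<notin> p ` {..<m}" using p(1) SQ by auto
        ultimately have "card (insert Q (p ` {..<m})) = Suc m"
          by (simp add: card_image)
        moreover have "insert Q (p ` {..<m}) \<subseteq> {P \<in> F. x \<in> P}"
          using p x by (auto simp: F_def)
        ultimately have "Suc m \<le> card {P \<in> F. x \<in> P}"
          using card_mono[OF elim(1), of "insert Q (p ` {..<m})"] by linarith
        then show False by (simp add: m_def)
      qed
    qed
  qed
  with FD sp show thesis by (rule that)
qed

text \<open>Sparse domination is applied to exp (|f| / \<alpha>); taking logarithms turns the power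
  of A into a multiple of the count.\<close>

lemma sparse_bound_imp_expL_bound:
  fixes X :: "(real^'n) set \<Rightarrow> (real^'n) fun_space"
  assumes \<eta>: "0 < \<eta>" "\<eta> < 1"
  shows "\<exists>K>0. \<forall>X :: (real^'n) set \<Rightarrow> (real^'n) fun_space. \<forall>C>0.
    (\<forall>Q\<in>cubes. quasi_banach_function_space Q (X Q)) \<longrightarrow> sparse_bound \<eta> X C \<longrightarrow> expL_bound X (K * C)"
proof -
  define A :: real where "A = 2 ^ CARD('n) / (1 - \<eta>)"
  have "(1::real) \<le> 2 ^ CARD('n)"
    using one_le_power[of "2::real" "CARD('n)"] by simp
  then have A: "1 \<le> A"
    unfolding A_def using \<eta> by (subst le_divide_eq_1_pos) linarith+
  define K where "K = 1 + ln A"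
  have K: "K > 0" using A by (simp add: K_def add_pos_nonneg)
  have "expL_bound X (K * C)"
    if X: "\<forall>Q\<in>cubes. quasi_banach_function_space Q (X Q)" and sb: "sparse_bound \<eta> X C" and C: "C > 0"
    for X :: "(real^'n) set \<Rightarrow> (real^'n) fun_space" and C
    unfolding expL_bound_def
  proof (intro ballI expL_norm_greatest)
    show "0 < K * C" using K C by simp
    fix Q :: "(real^'n) set" and f \<alpha>
    assume Q: "Q \<in> cubes" and "f \<in> expL Q" and \<alpha>: "\<alpha> > 0"
      and le: "(\<integral>\<^sup>+x. ennreal (exp (\<bar>f x\<bar> / \<alpha>) - 1) \<partial>lebesgue_on Q) / emeasure lebesgue Q \<le> 1"
    then have f [measurable]: "f \<in> borel_measurable (lebesgue_on Q)"
      by (auto simp: expL_def)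
    have Qs: "Q \<in> sets lebesgue" by (rule cubes_sets[OF Q])
    \<comment> \<open>\<open>f\<close> is measurable on \<open>Q\<close> only; the cut-off gives a
      measurable function on the whole space.\<close>
    define v where "v x = ennreal (exp (\<bar>f x\<bar> / \<alpha>)) * indicator Q x" for x
    have "(\<lambda>x. ennreal (exp (\<bar>f x\<bar> / \<alpha>))) \<in> borel_measurable (lebesgue_on Q)"
      by measurable
    then have v: "v \<in> borel_measurable lebesgue"
      unfolding v_def using Qs by (subst (asm) borel_measurable_restrict_space_iff_ennreal) auto
    have "(\<integral>\<^sup>+x\<in>Q. v x \<partial>lebesgue) = (\<integral>\<^sup>+x. ennreal (exp (\<bar>f x\<bar> / \<alpha>)) \<partial>lebesgue_on Q)"
      using Qs by (subst nn_integral_restrict_space) (auto simp: v_def mult.assoc simp flip: indicator_inter_arith intro!: nn_integral_cong)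
    also have "\<dots> \<le> ennreal (2 * measure lebesgue Q)"
      by (rule exp_integral_le[OF Q f le \<alpha>])
    also have "\<dots> = ennreal 2 * emeasure lebesgue Q"
      by (simp add: cubes_emeasure[OF Q] ennreal_mult)
    finally obtain F where F: "F \<subseteq> dyadic_cubes Q" "sparse \<eta> F"
      and AE: "AE x in lebesgue. x \<in> Q \<longrightarrow>
         0 < card {P \<in> F. x \<in> P} \<and> v x \<le> ennreal (2 * A ^ card {P \<in> F. x \<in> P})"
      using sparse_family_log_dominates[OF Q \<eta> v] unfolding A_def by blast
    let ?h = "\<lambda>x. \<Sum>\<^sub>\<infinity>P\<in>F. indicator P x :: real"
    have h: "?h x = real (card {P \<in> F. x \<in> P})" for x
      using infsum_indicator_eq_card[of "\<lambda>P. P" x F] by simp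
    have "AE x in lebesgue. x \<in> Q \<longrightarrow> \<bar>f x\<bar> \<le> K * \<alpha> * \<bar>?h x\<bar>"
      using AE
    proof eventually_elim
      case (elim x)
      show ?case
      proof
        assume x: "x \<in> Q"
        define m where "m = card {P \<in> F. x \<in> P}"
        have m: "0 < m" "exp (\<bar>f x\<bar> / \<alpha>) \<le> 2 * A ^ m"
          using elim x A by (auto simp: m_def v_def ennreal_le_iff)
        have "\<bar>f x\<bar> / \<alpha> \<le> ln (2 * A ^ m)"
          using m A by (subst ln_ge_iff) auto
        also have "\<dots> = ln 2 + m * ln A"
          using A by (simp add: ln_mult ln_realpow)
        \<comment> \<open>Since ln 2 < 1 and the count is positive, the additive constant is
          absorbed into m. This is the origin of K = 1 + ln A.\<close>
        also have "\<dots> \<le> m * 1 + m * ln A"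
          using m(1) ln_2_less_1 by (intro add_right_mono) (simp add: order.strict_implies_order less_le_trans[of _ 1])
        also have "\<dots> = K * m" by (simp add: K_def algebra_simps)
        finally show "\<bar>f x\<bar> \<le> K * \<alpha> * \<bar>?h x\<bar>"
          unfolding h using \<alpha> by (simp add: m_def field_simps)
      qed
    qed
    then have "ext_norm (X Q) f \<le> ennreal (K * \<alpha>) * ext_norm (X Q) ?h"
      using X Q f \<alpha> K by (intro ext_norm_mono AE_lebesgue_on) auto
    also have "\<dots> \<le> ennreal (K * \<alpha>) * ennreal C"
      using sb Q F unfolding sparse_bound_def by (intro mult_left_mono) auto
    also have "\<dots> = ennreal (K * C * \<alpha>)"
      using \<alpha> C K by (subst ennreal_mult[symmetric]) (auto simp: mult_ac)
    finally show "ext_norm (X Q) f \<le> ennreal (K * C * \<alpha>)" .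
  qed
  with K show ?thesis by blast
qed

section \<open>The John--Nirenberg inequality\<close>

lemma cubes_bounded: "Q \<in> cubes \<Longrightarrow> bounded Q"
  using cube_between_boxes(2) bounded_cbox bounded_subset unfolding cubes_def by blast

lemma locally_integrable_cube:
  assumes f: "locally_integrable f" and Q: "Q \<in> cubes"
  shows "integrable (lebesgue_on Q) f"
proof -
  have "set_integrable lebesgue (closure Q) f"
    using f cubes_bounded[OF Q] unfolding locally_integrable_def by (simp add: compact_closure)
  then have "set_integrable lebesgue Q f"
    by (rule set_integrable_subset) (use cubes_sets[OF Q] closure_subset in auto)
  then show ?thesis
    using cubes_sets[OF Q] by (simp add: integrable_restrict_space set_integrable_def)
qed

lemma finite_measure_lebesgue_on_cube: "Q \<in> cubes \<Longrightarrow> finite_measure (lebesgue_on Q)"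
  using cubes_sets[of Q] cubes_emeasure[of Q]
  by (intro finite_measureI) (simp add: emeasure_restrict_space space_restrict_space)

lemma integrable_cube_const:
  fixes c :: real
  shows "Q \<in> cubes \<Longrightarrow> integrable (lebesgue_on Q) (\<lambda>x. c)"
  by (rule finite_measure.integrable_const[OF finite_measure_lebesgue_on_cube])

lemma integral_cube_const:
  fixes c :: real
  assumes "Q \<in> cubes"
  shows "(LINT x|lebesgue_on Q. c) = c * measure lebesgue Q"
  using cubes_sets[OF assms] by (simp add: measure_restrict_space space_restrict_space)

lemma avg_diff_const:
  fixes f :: "real^'n \<Rightarrow> real"
  assumes Q: "Q \<in> cubes" and f: "integrable (lebesgue_on Q) f"
  shows "avg Q f - d = avg Q (\<lambda>x. f x - d)"
  using cubes_pos[OF Q] Bochner_Integration.integral_diff[OF f integrable_cube_const[OF Q, of d]]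
  unfolding avg_def integral_cube_const[OF Q] by (simp add: diff_divide_distrib)

lemma nn_integral_abs_eq_avg:
  fixes f :: "real^'n \<Rightarrow> real"
  assumes Q: "Q \<in> cubes" and f: "integrable (lebesgue_on Q) f"
  shows "(\<integral>\<^sup>+x. ennreal \<bar>f x - d\<bar> \<partial>lebesgue_on Q) = ennreal (avg Q (\<lambda>x. \<bar>f x - d\<bar>) * measure lebesgue Q)"
proof -
  have "(\<integral>\<^sup>+x. ennreal \<bar>f x - d\<bar> \<partial>lebesgue_on Q) = ennreal (LINT x|lebesgue_on Q. \<bar>f x - d\<bar>)"
    using f Q by (intro nn_integral_eq_integral integrable_abs Bochner_Integration.integrable_diff integrable_cube_const) auto
  then show ?thesis
    using cubes_pos[OF Q] by (simp add: avg_def)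
qed

lemma abs_avg_diff_le:
  fixes f :: "real^'n \<Rightarrow> real"
  assumes Q: "Q \<in> cubes" and f: "integrable (lebesgue_on Q) f"
  shows "\<bar>avg Q f - d\<bar> \<le> avg Q (\<lambda>x. \<bar>f x - d\<bar>)"
  unfolding avg_diff_const[OF Q f] unfolding avg_def
  using cubes_pos[OF Q] by (auto simp: divide_right_mono integral_abs_bound)

text \<open>The John--Nirenberg inequality by induction on \<open>k\<close>, for all cubes at once: one
  Calderon--Zygmund decomposition of \<open>Q\<close> at height \<open>2 B\<close> moves the average by at most
  \<open>2\<^bsup>n+1\<^esup> B\<close> and loses half of the measure.\<close>

lemma john_nirenberg:
  fixes f :: "real^'n \<Rightarrow> real"
  assumes f: "\<And>Q. Q \<in> cubes \<Longrightarrow> integrable (lebesgue_on Q) f"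
    and osc: "\<And>Q. Q \<in> cubes \<Longrightarrow> avg Q (\<lambda>x. \<bar>f x - avg Q f\<bar>) \<le> B" and B: "B > 0"
  defines "c \<equiv> 2 ^ CARD('n) * (2 * B)"
  assumes Q: "Q \<in> cubes"
  shows "{x \<in> Q. real k * c < \<bar>f x - avg Q f\<bar>} \<in> sets lebesgue \<and>
    emeasure lebesgue {x \<in> Q. real k * c < \<bar>f x - avg Q f\<bar>} \<le> ennreal ((1/2) ^ k * measure lebesgue Q)"
  using Q
proof (induction k arbitrary: Q)
  have S: "{x \<in> Q. t < \<bar>f x - avg Q f\<bar>} \<in> sets lebesgue" if Q: "Q \<in> cubes" for t Q
  proof -
    have [measurable]: "f \<in> borel_measurable (lebesgue_on Q)"
      using f[OF Q] by auto
    have "{x \<in> space (lebesgue_on Q). t < \<bar>f x - avg Q f\<bar>} \<in> sets (lebesgue_on Q)"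
      by measurable
    then show ?thesis
      using cubes_sets[OF Q] by (simp add: space_restrict_space sets_restrict_space_iff)
  qed
  {
    case 0
    have "emeasure lebesgue {x \<in> Q. real 0 * c < \<bar>f x - avg Q f\<bar>} \<le> emeasure lebesgue Q"
      using cubes_sets[OF 0] by (intro emeasure_mono) auto
    then show ?case
      using S[OF 0] by (simp only: cubes_emeasure[OF 0] power_0 mult_1)
  next
    case (Suc k)
    note Q = Suc.prems
    have Qs: "Q \<in> sets lebesgue" by (rule cubes_sets[OF Q])
    have c: "c > 0" "2 * B \<le> c"
      using B one_le_power[of "2::real" "CARD('n)"] by (auto simp: c_def)
    define d where "d = avg Q f"
    define v where "v x = ennreal \<bar>f x - d\<bar> * indicator Q x" for x
    have "(\<lambda>x. ennreal \<bar>f x - d\<bar>) \<in> borel_measurable (lebesgue_on Q)"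
      using f[OF Q] by measurable
    then have v: "v \<in> borel_measurable lebesgue"
      unfolding v_def using Qs by (subst (asm) borel_measurable_restrict_space_iff_ennreal) auto
    have v_int: "(\<integral>\<^sup>+x\<in>P. v x \<partial>lebesgue) = ennreal (avg P (\<lambda>x. \<bar>f x - d\<bar>) * measure lebesgue P)"
      if P: "P \<in> cubes" "P \<subseteq> Q" for P
    proof -
      have "(\<integral>\<^sup>+x\<in>P. v x \<partial>lebesgue) = (\<integral>\<^sup>+x. ennreal \<bar>f x - d\<bar> \<partial>lebesgue_on P)"
        using cubes_sets[OF P(1)] P(2)
        by (subst nn_integral_restrict_space) (auto simp: v_def indicator_def intro!: nn_integral_cong)
      then show ?thesis
        using nn_integral_abs_eq_avg[OF P(1) f[OF P(1)]] by simp
    qed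
    have int: "(\<integral>\<^sup>+x\<in>Q. v x \<partial>lebesgue) \<le> ennreal (B * measure lebesgue Q)"
      unfolding v_int[OF Q order.refl] using osc[OF Q] cubes_pos[OF Q]
      by (intro ennreal_leI mult_right_mono) (auto simp: d_def)
    define G where "G = {P\<in>dyadic_cubes Q. \<not> (\<integral>\<^sup>+x\<in>P. v x \<partial>lebesgue) \<le> ennreal (2 * B) * emeasure lebesgue P}"
    define G' where "G' = {P \<in> G. \<forall>R\<in>G. \<not> P \<subset> R}"
    have GD: "G \<subseteq> dyadic_cubes Q" by (auto simp: G_def)
    have G': "disjoint G'" "\<Union>G' = \<Union>G"
      unfolding G'_def by (rule maximal_cubes[OF Q GD])+
    have GC: "P \<in> cubes" "P \<subseteq> Q" if "P \<in> G" for P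
      using dyadic_cubes_cubes[OF Q] dyadic_cubes_subset[OF Q] GD that by auto
    have cG: "countable G" "countable G'"
      using countable_subset[OF GD countable_dyadic_cubes[OF Q]] by (auto simp: G'_def)
    have UG: "\<Union>G \<in> sets lebesgue" "\<Union>G \<subseteq> Q"
      using GC cubes_sets cG by (blast intro: sets.countable_Union)+
    have UGm: "\<Union>G \<in> lmeasurable"
      by (rule fmeasurableI2[OF cubes_lmeasurable[OF Q] UG(2,1)])
    \<comment> \<open>Weak-type estimate: selected cubes have averages above 2 B, and the whole
      integral over \<open>Q\<close> is at most B |Q|.\<close>
    have half: "measure lebesgue (\<Union>G) \<le> measure lebesgue Q / 2"
    proof -
      have "ennreal (2 * B * measure lebesgue (\<Union>G)) = (\<integral>\<^sup>+x\<in>\<Union>G. ennreal (2 * B) \<partial>lebesgue)"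
        using B by (simp only: nn_integral_cmult_indicator[OF UG(1)] emeasure_eq_measure2[OF UGm])
           (simp add: ennreal_mult)
      also have "\<dots> \<le> (\<integral>\<^sup>+x\<in>\<Union>G. v x \<partial>lebesgue)"
      proof (rule dyadic_set_nn_integral_Union_mono[OF _ v Q GD])
        fix P assume P: "P \<in> G"
        have "(\<integral>\<^sup>+x\<in>P. ennreal (2 * B) \<partial>lebesgue) = ennreal (2 * B) * emeasure lebesgue P"
          using GC[OF P] cubes_sets by (intro nn_integral_cmult_indicator) blast
        also have "\<dots> \<le> (\<integral>\<^sup>+x\<in>P. v x \<partial>lebesgue)"
          using P unfolding G_def by auto
        finally show "(\<integral>\<^sup>+x\<in>P. ennreal (2 * B) \<partial>lebesgue) \<le> (\<integral>\<^sup>+x\<in>P. v x \<partial>lebesgue)" .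
      qed auto
      also have "\<dots> \<le> (\<integral>\<^sup>+x\<in>Q. v x \<partial>lebesgue)"
        using UG by (intro nn_integral_mono) (auto simp: indicator_def)
      also note int
      finally have "2 * B * measure lebesgue (\<Union>G) \<le> B * measure lebesgue Q"
        using B by (subst (asm) ennreal_le_iff) auto
      then show ?thesis using B by simp
    qed
    \<comment> \<open>\<open>Q\<close> is not selected, so a maximal selected cube overshoots the
      height 2 B by at most 2^n; this dictates c.\<close>
    have shift: "\<bar>avg P f - d\<bar> \<le> c" if P: "P \<in> G'" for P
    proof -
      have PG: "P \<in> G" using P by (simp add: G'_def)
      have "ennreal (B * measure lebesgue Q) \<le> ennreal (2 * B) * emeasure lebesgue Q"
        using B by (simp add: cubes_emeasure[OF Q] flip: ennreal_mult)
      then have "Q \<notin> G"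
        using int by (auto simp: G_def intro: order.trans)
      then have "P \<noteq> Q" using PG by auto
      then have "(\<integral>\<^sup>+x\<in>P. v x \<partial>lebesgue) \<le> ennreal c * emeasure lebesgue P"
        using P GD B unfolding c_def
        by (intro stopping_cube_average_le[OF Q]) (auto simp: G'_def G_def)
      also have "\<dots> = ennreal (c * measure lebesgue P)"
        using c by (simp add: cubes_emeasure[OF GC(1)[OF PG]] ennreal_mult)
      finally have "avg P (\<lambda>x. \<bar>f x - d\<bar>) * measure lebesgue P \<le> c * measure lebesgue P"
        unfolding v_int[OF GC[OF PG]] using c by (subst (asm) ennreal_le_iff) auto
      then have "avg P (\<lambda>x. \<bar>f x - d\<bar>) \<le> c"
        using cubes_pos[OF GC(1)[OF PG]] by simp
      then show ?thesis
        using abs_avg_diff_le[OF GC(1)[OF PG] f[OF GC(1)[OF PG]], of d] by linarith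
    qed
    let ?E = "{x \<in> Q. real (Suc k) * c < \<bar>f x - d\<bar>}"
    have E: "?E \<in> sets lebesgue" unfolding d_def by (rule S[OF Q])
    have "2 * B \<ge> 0" using B by simp
    \<comment> \<open>Off the selected cubes |f - d| is almost everywhere at most 2 B, hence at most
      c, so the level set lies in their union up to a null set.\<close>
    from AE_le_of_dyadic_averages_le[OF v Q this]
    have "AE x in lebesgue. x \<in> ?E \<longrightarrow> x \<in> \<Union>G"
    proof eventually_elim
      case (elim x)
      show ?case
      proof
        assume x: "x \<in> ?E"
        show "x \<in> \<Union>G"
        proof (rule ccontr)
          assume "x \<notin> \<Union>G"
          then have "v x \<le> ennreal (2 * B)"
            using elim B x by (auto simp: G_def)
          then have "\<bar>f x - d\<bar> \<le> c"
            using x B c by (simp add: v_def ennreal_le_iff)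
          moreover have "c \<le> real (Suc k) * c" using c by (simp add: mult_le_cancel_right1)
          ultimately show False using x by simp
        qed
      qed
    qed
    then have "(\<integral>\<^sup>+x. indicator ?E x \<partial>lebesgue) \<le> (\<integral>\<^sup>+x\<in>\<Union>G'. indicator ?E x \<partial>lebesgue)"
      by (intro nn_integral_mono_AE) (auto simp: indicator_def G'(2))
    also have "\<dots> \<le> (\<integral>\<^sup>+x\<in>\<Union>G'. ennreal ((1/2) ^ k) \<partial>lebesgue)"
    proof (rule set_nn_integral_Union_mono[OF _ _ cG(2) G'(1)])
      show "G' \<subseteq> sets lebesgue"
        using GC cubes_sets by (auto simp: G'_def)
      fix P assume P: "P \<in> G'"
      then have PC: "P \<in> cubes" using GC by (auto simp: G'_def)
      let ?W = "{x \<in> P. real k * c < \<bar>f x - avg P f\<bar>}"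
      \<comment> \<open>The change of average costs one c, which turns level \<open>Suc k\<close> on
        \<open>Q\<close> into level \<open>k\<close> on \<open>P\<close>, where the induction
        hypothesis applies.\<close>
      have "?E \<inter> P \<subseteq> ?W"
        using shift[OF P] by (auto simp: algebra_simps)
      then have "(\<integral>\<^sup>+x\<in>P. indicator ?E x \<partial>lebesgue) \<le> (\<integral>\<^sup>+x. indicator ?W x \<partial>lebesgue)"
        by (intro nn_integral_mono) (auto simp: indicator_def)
      also have "\<dots> = emeasure lebesgue ?W"
        using Suc.IH[OF PC] by (intro nn_integral_indicator) auto
      also have "\<dots> \<le> ennreal ((1/2) ^ k * measure lebesgue P)"
        using Suc.IH[OF PC] by blast
      also have "\<dots> = (\<integral>\<^sup>+x\<in>P. ennreal ((1/2) ^ k) \<partial>lebesgue)"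
        by (simp only: nn_integral_cmult_indicator[OF cubes_sets[OF PC]] cubes_emeasure[OF PC])
          (simp add: ennreal_mult)
      finally show "(\<integral>\<^sup>+x\<in>P. indicator ?E x \<partial>lebesgue) \<le> (\<integral>\<^sup>+x\<in>P. ennreal ((1/2) ^ k) \<partial>lebesgue)" .
    qed (use E in auto)
    also have "\<dots> = ennreal ((1/2) ^ k * measure lebesgue (\<Union>G))"
      unfolding G'(2)
      by (simp only: nn_integral_cmult_indicator[OF UG(1)] emeasure_eq_measure2[OF UGm])
        (simp add: ennreal_mult)
    also have "\<dots> \<le> ennreal ((1/2) ^ Suc k * measure lebesgue Q)"
      using half by (intro ennreal_leI) (auto simp: field_simps)
    finally have "emeasure lebesgue ?E \<le> ennreal ((1/2) ^ Suc k * measure lebesgue Q)"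
      by (simp only: nn_integral_indicator[OF E])
    then show ?case
      using S[OF Q] by (auto simp only: d_def)
  }
qed

text \<open>The level sets at multiples of c have measure at most 2^-k |Q|, so
  \<open>expL_norm_nested\<close> applies with q = 1/2; its 2 / (1 + q) is the 4 / 3 in the
  logarithm.\<close>

lemma expL_norm_BMO:
  fixes f :: "real^'n \<Rightarrow> real"
  assumes f: "\<And>Q. Q \<in> cubes \<Longrightarrow> integrable (lebesgue_on Q) f"
    and osc: "\<And>Q. Q \<in> cubes \<Longrightarrow> avg Q (\<lambda>x. \<bar>f x - avg Q f\<bar>) \<le> B" and B: "B > 0"
    and Q: "Q \<in> cubes"
  shows "(\<lambda>x. f x - avg Q f) \<in> expL Q"
    "expL_norm Q (\<lambda>x. f x - avg Q f) \<le> ennreal (2 ^ CARD('n) * (2 * B) / ln (4 / 3))"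
proof -
  define c where "c = 2 ^ CARD('n) * (2 * B)"
  have c: "c > 0" using B by (simp add: c_def)
  let ?g = "\<lambda>x. f x - avg Q f"
  define W where "W k = {x \<in> Q. real k * c < \<bar>?g x\<bar>}" for k
  have JN: "W k \<in> sets lebesgue" "emeasure lebesgue (W k) \<le> ennreal ((1/2) ^ k * measure lebesgue Q)" for k
    using john_nirenberg[OF f osc B Q, of k] unfolding W_def c_def by blast+
  have WQ: "W k \<subseteq> Q" for k by (auto simp: W_def)
  have W_le: "measure lebesgue (W k) \<le> (1/2) ^ k * measure lebesgue Q" for k
    using JN(2)[of k] unfolding emeasure_subset_cube[OF Q WQ JN(1)] by (subst (asm) ennreal_le_iff) auto
  have W_Suc: "W (Suc k) \<subseteq> W k" for k
  proof
    fix x assume x: "x \<in> W (Suc k)"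
    have "real k * c \<le> real (Suc k) * c"
      using c by (intro mult_right_mono) auto
    then show "x \<in> W k" using x by (auto simp: W_def)
  qed
  have "AE x in lebesgue. finite {k. x \<in> W k}"
    by (rule nested_AE_finite[OF Q JN(1) WQ W_le]) auto
  then have "AE x in lebesgue. x \<in> Q \<longrightarrow> \<bar>?g x\<bar> \<le> c * real (card {k. x \<in> W k})"
  proof (rule AE_mp, intro AE_I2 impI)
    fix x assume x: "finite {k. x \<in> W k}" "x \<in> Q"
    define N where "N = card {k. x \<in> W k}"
    have "{k. x \<in> W k} = {..<N}"
      unfolding N_def by (rule nested_indices_eq_lessThan[OF decseq_SucI[of W, OF W_Suc] x(1)])
    then have "x \<notin> W N" by auto
    then show "\<bar>?g x\<bar> \<le> c * real (card {k. x \<in> W k})"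
      using x(2) unfolding N_def[symmetric] by (simp add: W_def mult.commute)
  qed
  then have AE: "AE x in lebesgue_on Q. \<bar>?g x\<bar> \<le> c * real (card {k. x \<in> W k})"
    by (rule AE_lebesgue_on[OF Q])
  have m: "?g \<in> borel_measurable (lebesgue_on Q)"
    using f[OF Q] by auto
  show "?g \<in> expL Q" "expL_norm Q ?g \<le> ennreal (2 ^ CARD('n) * (2 * B) / ln (4 / 3))"
    using expL_norm_nested[OF Q JN(1) WQ W_Suc W_le _ _ c m AE] by (simp_all add: c_def)
qed

lemma avg_le_bmo_norm:
  assumes "Q \<in> cubes"
  shows "ennreal (avg Q (\<lambda>x. \<bar>f x - avg Q f\<bar>)) \<le> bmo_norm f"
  unfolding bmo_norm_def using assms by (rule SUP_upper)

lemma expL_bound_imp_bmo_embedding: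
  fixes X :: "(real^'n) set \<Rightarrow> (real^'n) fun_space"
  assumes X: "expL_bound X C" and C: "C > 0"
  shows "bmo_embedding X (2 * 2 ^ CARD('n) / ln (4 / 3) * C)"
  unfolding bmo_embedding_def
proof
  define K :: real where "K = 2 * 2 ^ CARD('n) / ln (4 / 3)"
  have K: "K > 0" by (simp add: K_def)
  fix f :: "real^'n \<Rightarrow> real" assume f: "f \<in> BMO"
  then have int: "\<And>Q. Q \<in> cubes \<Longrightarrow> integrable (lebesgue_on Q) f"
    using locally_integrable_cube by (auto simp: BMO_def)
  obtain b where b: "bmo_norm f = ennreal b" "b \<ge> 0"
    using f by (cases "bmo_norm f") (auto simp: BMO_def)
  have "bmo_X_norm X f \<le> ennreal (K * C * b)"
  proof (rule ennreal_le_epsilon)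
    fix e :: real assume e: "e > 0"
    \<comment> \<open>John--Nirenberg asks for a positive bound, but the norm b may be 0; the small
      excess is removed by letting e tend to 0.\<close>
    define B where "B = b + e / (K * C)"
    have B: "B > 0" "b \<le> B" using b e K C by (auto simp: B_def add_nonneg_pos)
    have osc: "avg Q (\<lambda>x. \<bar>f x - avg Q f\<bar>) \<le> B" if "Q \<in> cubes" for Q
      using avg_le_bmo_norm[OF that, of f] B b by (simp add: ennreal_le_iff)
    have "bmo_X_norm X f \<le> ennreal (K * C * B)"
      unfolding bmo_X_norm_def
    proof (rule SUP_least)
      fix Q :: "(real^'n) set" assume Q: "Q \<in> cubes"
      note e = expL_norm_BMO[OF int osc B(1) Q]
      have "ext_norm (X Q) (\<lambda>x. f x - avg Q f) \<le> ennreal C * expL_norm Q (\<lambda>x. f x - avg Q f)"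
        using X Q e(1) unfolding expL_bound_def by blast
      also have "\<dots> \<le> ennreal C * ennreal (2 ^ CARD('n) * (2 * B) / ln (4 / 3))"
        by (intro mult_left_mono e(2) zero_le)
      also have "\<dots> = ennreal (K * C * B)"
        using C B by (subst ennreal_mult[symmetric]) (auto simp: K_def mult_ac)
      finally show "ext_norm (X Q) (\<lambda>x. f x - avg Q f) \<le> ennreal (K * C * B)" .
    qed
    also have "K * C * B = K * C * b + e"
      using K C by (simp add: B_def distrib_left)
    also have "ennreal \<dots> = ennreal (K * C * b) + ennreal e"
      using K C b e by (intro ennreal_plus) auto
    finally show "bmo_X_norm X f \<le> ennreal (K * C * b) + ennreal e" .
  qed
  also have "\<dots> = ennreal (K * C) * bmo_norm f"
    unfolding b(1) using K C b by (simp add: ennreal_mult)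
  finally show "bmo_X_norm X f \<le> ennreal (2 * 2 ^ CARD('n) / ln (4 / 3) * C) * bmo_norm f"
    by (simp add: K_def)
qed

section \<open>Sums of bumps over sparse families\<close>

text \<open>Families consist of bare sets, so the scale of a cube has to be recovered from the set;
  \<open>cube_inject\<close> makes the description unique.\<close>

definition side :: "(real^'n) set \<Rightarrow> real" where
  "side P = (THE l. l > 0 \<and> (\<exists>a. P = cube a l))"

lemma cube_in_cubes: "l > 0 \<Longrightarrow> cube a l \<in> cubes"
  unfolding cubes_def by blast

lemma side_cube: "l > 0 \<Longrightarrow> side (cube a l) = l"
  unfolding side_def using cube_inject(2) by (intro the_equality) blast+

lemma cubesE:
  assumes "P \<in> cubes"
  obtains b where "P = cube b (side P)" "side P > 0"
proof -
  obtain b l where "P = cube b l" "l > 0"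
    using assms by (auto simp: cubes_def)
  then show thesis
    using side_cube[of l b] that[of b] by simp
qed

lemma cubes_side: "P \<in> cubes \<Longrightarrow> measure lebesgue P = side P ^ CARD('n)" for P :: "(real^'n) set"
  by (metis cubesE measure_cube)

lemma dyadic_same_side_disjoint:
  assumes Q: "Q \<in> cubes" and PR: "P \<in> dyadic_cubes Q" "R \<in> dyadic_cubes Q"
    and "side P = side R" "P \<noteq> R"
  shows "P \<inter> R = {}"
proof (rule ccontr)
  obtain a l where Qa: "Q = cube a l" "l > 0" using Q by (auto simp: cubes_def)
  assume "P \<inter> R \<noteq> {}"
  then obtain z where z: "z \<in> P" "z \<in> R" by auto
  obtain j x k y where xy: "P = dcube a l j x" "R = dcube a l k y"
    using PR unfolding Qa dyadic_cubes_eq[OF Qa(2)] by auto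
  then have PRz: "P = dcube a l j z" "R = dcube a l k z"
    using z dcube_eq[of z a l] by auto
  have "side (dcube a l i z) = l / 2 ^ i" for i
    using Qa(2) by (simp add: dcube_eq_cube side_cube)
  then have "l / 2 ^ j = l / 2 ^ k"
    using assms(4) PRz by simp
  then have "j = k"
    using Qa(2) by (simp add: frac_eq_eq)
  then show False using PRz assms(5) by simp
qed

text \<open>With fewer cubes removed, the uncovered part of each cube only grows. This permits
  splitting a family by scale and exhausting it by finite subfamilies.\<close>

lemma sparse_subset:
  assumes Q: "Q \<in> cubes" and F: "F \<subseteq> dyadic_cubes Q" "sparse \<eta> F" and G: "G \<subseteq> F"
  shows "sparse \<eta> G"
  unfolding sparse_def
proof
  fix P assume P: "P \<in> G"
  have sC: "P \<in> cubes" if "P \<in> F" for P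
    using dyadic_cubes_cubes[OF Q] F that by blast
  have m: "P - \<Union>{P' \<in> H. P' \<subset> P} \<in> lmeasurable" if "H \<subseteq> F" for H
  proof (rule fmeasurableI2[OF cubes_lmeasurable])
    show "P \<in> cubes" using P G sC by blast
    have "countable H"
      using that F countable_subset[OF _ countable_dyadic_cubes[OF Q]] by blast
    then have "\<Union>{P' \<in> H. P' \<subset> P} \<in> sets lebesgue"
      using that sC cubes_sets by (intro sets.countable_Union countable_Collect) blast+
    then show "P - \<Union>{P' \<in> H. P' \<subset> P} \<in> sets lebesgue"
      using cubes_sets[OF \<open>P \<in> cubes\<close>] by (rule sets.Diff[rotated])
  qed blast
  have "\<eta> * measure lebesgue P \<le> measure lebesgue (P - \<Union>{P' \<in> F. P' \<subset> P})"
    using F(2) P G unfolding sparse_def by blast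
  also have "\<dots> \<le> measure lebesgue (P - \<Union>{P' \<in> G. P' \<subset> P})"
    using G by (intro measure_mono_fmeasurable fmeasurableD m) blast+
  finally show "\<eta> * measure lebesgue P \<le> measure lebesgue (P - \<Union>{P' \<in> G. P' \<subset> P})" .
qed

text \<open>\<open>S\<close> is an arbitrary cube, because it will be an enlargement of a test cube
  for \<open>BMO\<close> that is unrelated to the dyadic grid.\<close>

lemma sparse_packing_finite:
  assumes Q: "Q \<in> cubes" and F: "finite F" "F \<subseteq> dyadic_cubes Q" "sparse \<eta> F" and \<eta>: "\<eta> > 0"
    and S: "S \<in> cubes"
  shows "(\<Sum>P | P \<in> F \<and> P \<subseteq> S. measure lebesgue P) \<le> measure lebesgue S / \<eta>"
proof -
  have sC: "P \<in> cubes" if "P \<in> F" for P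
    using dyadic_cubes_cubes[OF Q] F that by blast
  have "ennreal (\<Sum>P | P \<in> F \<and> P \<subseteq> S. measure lebesgue P) = (\<Sum>P | P \<in> F \<and> P \<subseteq> S. emeasure lebesgue P)"
    unfolding sum_ennreal[OF measure_nonneg, symmetric]
    using sC by (intro sum.cong cubes_emeasure[symmetric]) auto
  also have "\<dots> = (\<integral>\<^sup>+P. emeasure lebesgue P \<partial>count_space {P\<in>F. P \<subseteq> S})"
    using F(1) by (intro nn_integral_count_space_finite[symmetric]) auto
  also have "\<dots> \<le> ennreal (1 / \<eta>) * emeasure lebesgue S"
    by (rule sparse_packing[OF Q F(2,3) \<eta> cubes_sets[OF S]])
  also have "\<dots> = ennreal (measure lebesgue S / \<eta>)"
    using \<eta> by (simp add: cubes_emeasure[OF S] flip: ennreal_mult)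
  finally show ?thesis
    using \<eta> by (subst (asm) ennreal_le_iff) auto
qed

text \<open>Scaling by the side gives Lipschitz constant 1 / \<open>side P\<close>: bumps of large
  cubes vary so slowly that their changes over a small cube can be summed.\<close>

definition bump :: "(real^'n) set \<Rightarrow> real^'n \<Rightarrow> real" where
  "bump P x = max 0 (1 - infdist x P / side P)"

lemma bump_nonneg: "0 \<le> bump P x"
  by (simp add: bump_def)

lemma bump_le_1: "P \<in> cubes \<Longrightarrow> bump P x \<le> 1"
  by (erule cubesE) (auto simp: bump_def infdist_nonneg)

lemma bump_eq_1: "x \<in> P \<Longrightarrow> bump P x = 1"
  by (simp add: bump_def)

lemma bump_lipschitz:
  assumes "P \<in> cubes"
  shows "\<bar>bump P x - bump P y\<bar> \<le> dist x y / side P"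
proof -
  have s: "side P > 0" using assms by (rule cubesE)
  have "\<bar>bump P x - bump P y\<bar> \<le> \<bar>infdist x P / side P - infdist y P / side P\<bar>"
    unfolding bump_def by linarith
  also have "\<dots> = \<bar>infdist x P - infdist y P\<bar> / side P"
    using s by (simp add: diff_divide_distrib[symmetric])
  also have "\<dots> \<le> dist x y / side P"
    using s infdist_triangle_abs by (intro divide_right_mono) auto
  finally show ?thesis .
qed

lemma continuous_on_bump: "continuous_on S (bump P)"
  unfolding bump_def by (cases "side P = 0") (auto intro!: continuous_intros)

lemma bump_pos_near:
  assumes P: "P \<in> cubes" and pos: "bump P x \<noteq> 0"
  obtains z where "z \<in> P" "dist x z < side P"
proof -
  have s: "side P > 0" using P by (rule cubesE)
  have ne: "P \<noteq> {}" using P cube_ne unfolding cubes_def by blast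
  have "infdist x P < side P"
    using pos s by (auto simp: bump_def max_def field_simps split: if_splits)
  then have "(INF z\<in>P. dist x z) < side P"
    using ne by (simp add: infdist_def)
  then show thesis
    using cInf_lessD[of "dist x ` P" "side P"] ne that by auto
qed

text \<open>The bump is at most 1 and vanishes off the concentric cube of three times the
  side.\<close>

lemma bump_integral_le:
  fixes P R :: "(real^'n) set"
  assumes P: "P \<in> cubes" and R: "R \<in> cubes"
  shows "(LINT x|lebesgue_on R. bump P x) \<le> 3 ^ CARD('n) * measure lebesgue P"
proof -
  obtain b where b: "P = cube b (side P)" "side P > 0" using P by (rule cubesE)
  define m where "m = side P"
  let ?P = "cube (\<chi> i. b $ i - m) (3 * m)"
  have m: "m > 0" using b by (simp add: m_def)
  have Pm: "?P \<in> lmeasurable"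
    using m by (intro cubes_lmeasurable cube_in_cubes) simp
  have sub: "x \<in> ?P" if x: "bump P x \<noteq> 0" for x
  proof -
    obtain z where z: "z \<in> P" "dist x z < m"
      using bump_pos_near[OF P x] by (auto simp: m_def)
    have zb: "z \<in> cube b m" using z b by (simp add: m_def)
    show ?thesis
      unfolding cube_def mem_Collect_eq
    proof
      fix i
      have "b $ i \<le> z $ i \<and> z $ i < b $ i + m"
        using zb unfolding cube_def by blast
      moreover have "\<bar>x $ i - z $ i\<bar> < m"
        using z(2) component_le_norm_cart[of "x - z" i] by (simp add: dist_norm)
      ultimately show "(\<chi> i. b $ i - m) $ i \<le> x $ i \<and> x $ i < (\<chi> i. b $ i - m) $ i + 3 * m"
        by (simp only: vec_lambda_beta) linarith
    qed
  qed
  have "(LINT x|lebesgue_on R. bump P x) = (LINT x|lebesgue. indicator R x * bump P x)"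
    using cubes_sets[OF R] by (subst integral_restrict_space) auto
  also have "\<dots> \<le> (LINT x|lebesgue. indicator ?P x)"
  proof (rule integral_mono_AE')
    show "integrable lebesgue (indicator ?P :: _ \<Rightarrow> real)"
      using Pm by (simp add: integrable_indicator_iff fmeasurable_def)
    show "AE x in lebesgue. indicator R x * bump P x \<le> indicator ?P x"
    proof (intro AE_I2)
      fix x
      show "indicator R x * bump P x \<le> indicator ?P x"
        using sub[of x] bump_le_1[OF P, of x] by (cases "bump P x = 0") (auto simp: indicator_def)
    qed
    show "AE x in lebesgue. 0 \<le> (indicator ?P x :: real)"
      by simp
  qed
  also have "\<dots> = measure lebesgue ?P" by simp
  also have "\<dots> = (3 * m) ^ CARD('n)"
    using m by (intro measure_cube) simp
  also have "\<dots> = 3 ^ CARD('n) * measure lebesgue P"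
    by (simp add: cubes_side[OF P] m_def power_mult_distrib)
  finally show ?thesis .
qed

section \<open>Continuous functions, dyadic scales and nearby cubes\<close>

lemma locally_integrable_continuous:
  fixes g :: "real^'n \<Rightarrow> real"
  assumes g: "continuous_on UNIV g"
  shows "locally_integrable g"
  unfolding locally_integrable_def
proof (intro allI impI)
  fix K :: "(real^'n) set" assume K: "compact K"
  have "integrable lborel (\<lambda>x. indicator K x *\<^sub>R g x)"
    by (rule borel_integrable_compact[OF K continuous_on_subset[OF g]]) simp
  then show "g absolutely_integrable_on K"
    unfolding set_integrable_def using K borel_measurable_continuous_onI[OF g]
    by (intro integrable_completion[THEN iffD2, rotated] borel_measurable_scaleR
        borel_measurable_indicator)
      (auto simp: compact_imp_closed)
qed

lemma integrable_continuous_cube: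
  fixes g :: "real^'n \<Rightarrow> real"
  assumes "continuous_on UNIV g" "R \<in> cubes"
  shows "integrable (lebesgue_on R) g"
  by (intro locally_integrable_cube locally_integrable_continuous assms)

text \<open>The quotients s / m are terms of a geometric progression of ratio 2, so their sum is at
  most twice the largest one, which is below 1 because s < m.\<close>

lemma sum_geometric_scales_le:
  fixes l s :: real
  assumes M: "finite M" "M \<subseteq> range (\<lambda>k::nat. l / 2 ^ k)" "\<And>m. m \<in> M \<Longrightarrow> s < m" and ls: "l > 0" "s > 0"
  shows "(\<Sum>m\<in>M. s / m) \<le> 2"
proof (cases "M = {}")
  case False
  have inj: "inj (\<lambda>k::nat. l / 2 ^ k)"
    using ls by (intro injI) (simp add: frac_eq_eq)
  obtain K where K: "M = (\<lambda>k. l / 2 ^ k) ` K"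
    using M(2) by (meson subset_imageE)
  have finK: "finite K"
    using M(1) K inj finite_imageD inj_on_subset by blast
  have neK: "K \<noteq> {}" using False K by auto
  define N where "N = Max K"
  have N: "N \<in> K" "K \<subseteq> {..<Suc N}"
    using Max_in[OF finK neK] Max_ge[OF finK] by (auto simp: N_def less_Suc_eq_le)
  have "s < l / 2 ^ N" using N K M(3) by blast
  then have sN: "s * 2 ^ N < l" by (simp add: field_simps)
  have "(\<Sum>m\<in>M. s / m) = (\<Sum>k\<in>K. s / l * 2 ^ k)"
    unfolding K using inj by (subst sum.reindex) (auto intro: inj_on_subset simp: field_simps)
  also have "\<dots> \<le> (\<Sum>k<Suc N. s / l * 2 ^ k)"
    using N ls by (intro sum_mono2) auto
  also have "\<dots> = s / l * (\<Sum>k<Suc N. 2 ^ k)"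
    by (simp only: sum_distrib_left)
  also have "(\<Sum>k<Suc N. (2::real) ^ k) = 2 ^ Suc N - 1"
    by (subst geometric_sum) auto
  also have "s / l * (2 ^ Suc N - 1) \<le> s / l * (2 * 2 ^ N)"
    using ls by (intro mult_left_mono) auto
  also have "\<dots> \<le> 2"
    using sN ls by (simp add: field_simps)
  finally show ?thesis .
qed simp

lemma dyadic_cubes_side:
  assumes "Q \<in> cubes"
  obtains l where "l > 0" "\<And>P. P \<in> dyadic_cubes Q \<Longrightarrow> side P \<in> range (\<lambda>k::nat. l / 2 ^ k)"
proof -
  obtain a l where Qa: "Q = cube a l" "l > 0" using assms by (auto simp: cubes_def)
  have "side P \<in> range (\<lambda>k::nat. l / 2 ^ k)" if "P \<in> dyadic_cubes Q" for P
    using that Qa(2) unfolding Qa(1) dyadic_cubes_eq[OF Qa(2)] by (auto simp: dcube_eq_cube side_cube)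
  with Qa(2) show thesis by (rule that)
qed

text \<open>In each coordinate, points of \<open>P\<close> differ from z by less than the side, and
  z from x by less than the side; this gives the margin 2 m.\<close>

lemma cube_near_subset:
  fixes P :: "(real^'n) set"
  assumes P: "P \<in> cubes" "z \<in> P" and side: "side P \<le> m"
    and x: "\<And>i. r $ i - u \<le> x $ i \<and> x $ i < r $ i + w" "dist x z < side P"
  shows "P \<subseteq> cube (\<chi> i. r $ i - u - 2 * m) (u + w + 4 * m)"
proof
  fix y assume y: "y \<in> P"
  obtain b where b: "P = cube b (side P)" using P(1) by (rule cubesE)
  have zy: "z \<in> cube b (side P)" "y \<in> cube b (side P)"
    using b P y by auto
  have *: "\<bar>y $ i - x $ i\<bar> < 2 * m" for i
  proof -
    have "b $ i \<le> z $ i \<and> z $ i < b $ i + side P" "b $ i \<le> y $ i \<and> y $ i < b $ i + side P"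
      using zy unfolding cube_def by blast+
    moreover have "\<bar>x $ i - z $ i\<bar> < side P"
      using x(2) component_le_norm_cart[of "x - z" i] by (simp add: dist_norm)
    ultimately show ?thesis
      using side by linarith
  qed
  show "y \<in> cube (\<chi> i. r $ i - u - 2 * m) (u + w + 4 * m)"
    unfolding cube_def mem_Collect_eq
  proof
    fix i
    show "(\<chi> i. r $ i - u - 2 * m) $ i \<le> y $ i \<and> y $ i < (\<chi> i. r $ i - u - 2 * m) $ i + (u + w + 4 * m)"
      using *[of i] x(1)[of i] by (simp only: vec_lambda_beta) linarith
  qed
qed

text \<open>Cubes smaller than \<open>R\<close> contribute by packing, larger ones by their Lipschitz constants,
  which are summable over the scales.\<close>

lemma sum_bump_oscillation:
  fixes Q :: "(real^'n) set"
  assumes Q: "Q \<in> cubes" and F: "finite F" "F \<subseteq> dyadic_cubes Q" "sparse \<eta> F" and \<eta>: "\<eta> > 0"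
    and R: "R \<in> cubes"
  shows "\<exists>d. avg R (\<lambda>x. \<bar>(\<Sum>P\<in>F. bump P x) - d\<bar>) \<le> 15 ^ CARD('n) / \<eta> + 2 * real CARD('n) * 6 ^ CARD('n)"
proof -
  obtain r s where rs: "R = cube r s" "s > 0" using R by (auto simp: cubes_def)
  have sC: "P \<in> cubes" if "P \<in> F" for P
    using dyadic_cubes_cubes[OF Q] F that by blast
  have spos: "side P > 0" if "P \<in> F" for P
    using sC[OF that] by (rule cubesE)
  define Fs where "Fs = {P \<in> F. side P \<le> s}"
  define Fl where "Fl = {P \<in> F. s < side P}"
  have fin: "finite Fs" "finite Fl" using F(1) by (auto simp: Fs_def Fl_def)
  have FF: "F = Fs \<union> Fl" "Fs \<inter> Fl = {}" by (auto simp: Fs_def Fl_def)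
  \<comment> \<open>Only the large bumps need a constant subtracted, their value at the corner of
    \<open>R\<close>; the small ones have bounded mean.\<close>
  define d where "d = (\<Sum>P\<in>Fl. bump P r)"
  obtain l where l: "l > 0" "\<And>P. P \<in> dyadic_cubes Q \<Longrightarrow> side P \<in> range (\<lambda>k::nat. l / 2 ^ k)"
    using dyadic_cubes_side[OF Q] by metis
  have large: "(\<Sum>P\<in>Fl. \<bar>bump P x - bump P r\<bar>) \<le> 2 * real CARD('n) * 6 ^ CARD('n)" if x: "x \<in> R" for x
  proof -
    have rR: "r \<in> R" using rs cube_ne by blast
    have dxr: "dist x r \<le> CARD('n) * s"
      using x rR unfolding rs(1) by (rule cube_dist_le)
    \<comment> \<open>Cubes of one scale m are disjoint, so by volume at most 5^n of them are within
      reach of \<open>R\<close>, and each bump varies by at most n s / m. The bound 6^n leaves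
      slack.\<close>
    have scale: "(\<Sum>P | P \<in> Fl \<and> side P = m. \<bar>bump P x - bump P r\<bar>) \<le> real CARD('n) * 6 ^ CARD('n) * (s / m)"
      if m: "m \<in> side ` Fl" for m
    proof -
      have sm: "s < m" "m > 0" using m rs(2) by (auto simp: Fl_def)
      let ?H = "{P \<in> Fl. side P = m}"
      let ?S = "cube (\<chi> i. r $ i - 0 - 2 * m) (0 + m + 4 * m)"
      let ?S' = "cube (\<chi> i. r $ i - 2 * m) (5 * m)"
      have HF: "?H \<subseteq> F" "?H \<subseteq> dyadic_cubes Q" "finite ?H" using F fin by (auto simp: Fl_def)
      have near: "P \<subseteq> ?S'" if P: "P \<in> ?H" "bump P x \<noteq> bump P r" for P
      proof -
        have "bump P x \<noteq> 0 \<or> bump P r \<noteq> 0" using P by auto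
        then obtain y where y: "y \<in> R" "bump P y \<noteq> 0" using x rR by blast
        obtain z where z: "z \<in> P" "dist y z < side P"
          using bump_pos_near[OF sC y(2)] P HF(1) by blast
        have "y \<in> cube r s" using y rs by simp
        then have "r $ i - 0 \<le> y $ i \<and> y $ i < r $ i + m" for i
        proof -
          have "r $ i \<le> y $ i \<and> y $ i < r $ i + s"
            using \<open>y \<in> cube r s\<close> unfolding cube_def by blast
          then show ?thesis using sm by linarith
        qed
        then have "P \<subseteq> ?S"
          using P HF(1) z by (intro cube_near_subset[OF sC z(1)]) auto
        then show ?thesis by (simp add: add.commute)
      qed
      \<comment> \<open>Disjoint cubes are 1-sparse, so packing with \<eta> = 1 counts them.\<close>
      have sp: "sparse 1 ?H"
        unfolding sparse_def
      proof
        fix P assume P: "P \<in> ?H"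
        have "P - \<Union>{P' \<in> ?H. P' \<subset> P} = P"
          using dyadic_same_side_disjoint[OF Q, of _ P] P HF(2) by fastforce
        then show "1 * measure lebesgue P \<le> measure lebesgue (P - \<Union>{P' \<in> ?H. P' \<subset> P})" by simp
      qed
      have S': "?S' \<in> cubes" using sm by (intro cube_in_cubes) simp
      have "real (card {P \<in> ?H. P \<subseteq> ?S'}) * m ^ CARD('n) = (\<Sum>P | P \<in> ?H \<and> P \<subseteq> ?S'. measure lebesgue P)"
        using HF(1) sC by (subst sum.cong[OF refl, of _ _ "\<lambda>_. m ^ CARD('n)"]) (auto simp: cubes_side)
      also have "\<dots> \<le> measure lebesgue ?S' / 1"
        by (rule sparse_packing_finite[OF Q HF(3,2) sp _ S']) simp
      also have "\<dots> = 5 ^ CARD('n) * m ^ CARD('n)"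
        using sm measure_cube[of "5 * m" "\<chi> i. r $ i - 2 * m"] by (simp add: power_mult_distrib)
      finally have "real (card {P \<in> ?H. P \<subseteq> ?S'}) \<le> 5 ^ CARD('n)"
        using sm by simp
      also have "\<dots> \<le> 6 ^ CARD('n)"
        by (rule power_mono) auto
      finally have card: "real (card {P \<in> ?H. P \<subseteq> ?S'}) \<le> 6 ^ CARD('n)" .
      have "(\<Sum>P\<in>?H. \<bar>bump P x - bump P r\<bar>) = (\<Sum>P | P \<in> ?H \<and> P \<subseteq> ?S'. \<bar>bump P x - bump P r\<bar>)"
        using HF(3) near by (intro sum.mono_neutral_right) auto
      also have "\<dots> \<le> (\<Sum>P | P \<in> ?H \<and> P \<subseteq> ?S'. CARD('n) * s / m)"
      proof (rule sum_mono)
        fix P assume P: "P \<in> {P. P \<in> ?H \<and> P \<subseteq> ?S'}"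
        then have "\<bar>bump P x - bump P r\<bar> \<le> dist x r / m"
          using bump_lipschitz[OF sC, of P x r] HF(1) by auto
        also have "\<dots> \<le> CARD('n) * s / m"
          using dxr sm by (intro divide_right_mono) auto
        finally show "\<bar>bump P x - bump P r\<bar> \<le> CARD('n) * s / m" .
      qed
      also have "\<dots> = real (card {P \<in> ?H. P \<subseteq> ?S'}) * (CARD('n) * s / m)"
        by simp
      also have "\<dots> \<le> 6 ^ CARD('n) * (CARD('n) * s / m)"
        using card sm rs by (intro mult_right_mono) auto
      finally show ?thesis by (simp add: mult_ac)
    qed
    have "(\<Sum>P\<in>Fl. \<bar>bump P x - bump P r\<bar>) = (\<Sum>m\<in>side ` Fl. \<Sum>P | P \<in> Fl \<and> side P = m. \<bar>bump P x - bump P r\<bar>)"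
      using fin by (intro sum.group[symmetric]) auto
    also have "\<dots> \<le> (\<Sum>m\<in>side ` Fl. real CARD('n) * 6 ^ CARD('n) * (s / m))"
      by (intro sum_mono scale)
    also have "\<dots> = real CARD('n) * 6 ^ CARD('n) * (\<Sum>m\<in>side ` Fl. s / m)"
      by (simp only: sum_distrib_left)
    also have "\<dots> \<le> real CARD('n) * 6 ^ CARD('n) * 2"
    proof (intro mult_left_mono sum_geometric_scales_le)
      show "side ` Fl \<subseteq> range (\<lambda>k::nat. l / 2 ^ k)"
        using l(2) F(2) by (auto simp: Fl_def)
    qed (use fin l rs in \<open>auto simp: Fl_def\<close>)
    finally show ?thesis by (simp add: mult_ac)
  qed
  \<comment> \<open>Each bump costs 3^n times the volume of its cube, and the cubes that matter pack
    into the fivefold enlargement of \<open>R\<close>; together 15^n.\<close>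
  have small: "(LINT x|lebesgue_on R. (\<Sum>P\<in>Fs. bump P x)) \<le> 15 ^ CARD('n) / \<eta> * measure lebesgue R"
  proof -
    let ?S = "cube (\<chi> i. r $ i - 0 - 2 * s) (0 + s + 4 * s)"
    let ?S' = "cube (\<chi> i. r $ i - 2 * s) (5 * s)"
    have S': "?S' \<in> cubes" using rs by (intro cube_in_cubes) simp
    have zero: "(LINT x|lebesgue_on R. bump P x) = 0" if P: "P \<in> Fs" "\<not> P \<subseteq> ?S'" for P
    proof -
      have "bump P x = 0" if x: "x \<in> R" for x
      proof (rule ccontr)
        assume "bump P x \<noteq> 0"
        then obtain z where z: "z \<in> P" "dist x z < side P"
          using bump_pos_near[OF sC] P by (auto simp: Fs_def)
        have "x \<in> cube r s" using x rs by simp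
        then have "r $ i - 0 \<le> x $ i \<and> x $ i < r $ i + s" for i
          unfolding cube_def by simp
        then have "P \<subseteq> ?S"
          using P z by (intro cube_near_subset[OF sC z(1)]) (auto simp: Fs_def)
        then show False using P by (simp add: add.commute)
      qed
      then show ?thesis
        using cubes_sets[OF R] by (subst Bochner_Integration.integral_cong[OF refl, of _ _ "\<lambda>_. 0"])
          (auto simp: space_restrict_space)
    qed
    have "(LINT x|lebesgue_on R. (\<Sum>P\<in>Fs. bump P x)) = (\<Sum>P\<in>Fs. LINT x|lebesgue_on R. bump P x)"
      by (intro Bochner_Integration.integral_sum integrable_continuous_cube R continuous_on_bump)
    also have "\<dots> = (\<Sum>P | P \<in> Fs \<and> P \<subseteq> ?S'. LINT x|lebesgue_on R. bump P x)"
      using fin zero by (intro sum.mono_neutral_right) auto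
    also have "\<dots> \<le> (\<Sum>P | P \<in> Fs \<and> P \<subseteq> ?S'. 3 ^ CARD('n) * measure lebesgue P)"
      using bump_integral_le[OF sC R] by (intro sum_mono) (auto simp: Fs_def)
    also have "\<dots> = 3 ^ CARD('n) * (\<Sum>P | P \<in> Fs \<and> P \<subseteq> ?S'. measure lebesgue P)"
      by (simp only: sum_distrib_left)
    also have "\<dots> \<le> 3 ^ CARD('n) * (measure lebesgue ?S' / \<eta>)"
    proof (intro mult_left_mono sparse_packing_finite[OF Q fin(1) _ _ \<eta> S'])
      show "Fs \<subseteq> dyadic_cubes Q" using F by (auto simp: Fs_def)
      show "sparse \<eta> Fs" by (rule sparse_subset[OF Q F(2,3)]) (auto simp: Fs_def)
    qed simp
    also have "measure lebesgue ?S' = 5 ^ CARD('n) * measure lebesgue R"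
      using rs(2) measure_cube[of "5 * s" "\<chi> i. r $ i - 2 * s"] measure_cube[of s r]
      unfolding rs(1) by (simp add: power_mult_distrib)
    also have "3 ^ CARD('n) * (5 ^ CARD('n) * measure lebesgue R / \<eta>) = 15 ^ CARD('n) / \<eta> * measure lebesgue R"
      using power_mult_distrib[of 3 "5::real" "CARD('n)"] by simp
    finally show ?thesis .
  qed
  define L where "L = 2 * real CARD('n) * 6 ^ CARD('n)"
  have "avg R (\<lambda>x. \<bar>(\<Sum>P\<in>F. bump P x) - d\<bar>) * measure lebesgue R = (LINT x|lebesgue_on R. \<bar>(\<Sum>P\<in>F. bump P x) - d\<bar>)"
    using cubes_pos[OF R] by (simp add: avg_def)
  also have "\<dots> \<le> (LINT x|lebesgue_on R. (\<Sum>P\<in>Fs. bump P x) + L)"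
  proof (rule integral_mono)
    show "integrable (lebesgue_on R) (\<lambda>x. \<bar>(\<Sum>P\<in>F. bump P x) - d\<bar>)"
      "integrable (lebesgue_on R) (\<lambda>x. (\<Sum>P\<in>Fs. bump P x) + L)"
      by (intro integrable_continuous_cube[OF _ R] continuous_intros continuous_on_bump)+
    fix x assume "x \<in> space (lebesgue_on R)"
    then have x: "x \<in> R" using cubes_sets[OF R] by (simp add: space_restrict_space)
    have "(\<Sum>P\<in>F. bump P x) - d = (\<Sum>P\<in>Fs. bump P x) + (\<Sum>P\<in>Fl. bump P x - bump P r)"
      unfolding FF(1) d_def using fin FF(2) by (simp add: sum.union_disjoint sum_subtractf)
    moreover have "\<bar>\<Sum>P\<in>Fl. bump P x - bump P r\<bar> \<le> L"
      using order.trans[OF sum_abs large[OF x]] by (simp add: L_def)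
    moreover have "0 \<le> (\<Sum>P\<in>Fs. bump P x)"
      by (intro sum_nonneg bump_nonneg)
    ultimately show "\<bar>(\<Sum>P\<in>F. bump P x) - d\<bar> \<le> (\<Sum>P\<in>Fs. bump P x) + L"
      by linarith
  qed
  also have "\<dots> = (LINT x|lebesgue_on R. (\<Sum>P\<in>Fs. bump P x)) + L * measure lebesgue R"
    unfolding integral_cube_const[OF R, symmetric]
    by (intro Bochner_Integration.integral_add integrable_continuous_cube[OF _ R] continuous_intros continuous_on_bump)
  also have "\<dots> \<le> (15 ^ CARD('n) / \<eta> + L) * measure lebesgue R"
    using small by (simp add: distrib_right)
  finally have "avg R (\<lambda>x. \<bar>(\<Sum>P\<in>F. bump P x) - d\<bar>) \<le> 15 ^ CARD('n) / \<eta> + L"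
    using cubes_pos[OF R] by (subst (asm) mult_le_cancel_right_pos) auto
  then show ?thesis by (auto simp: L_def)
qed

section \<open>The equivalence\<close>

text \<open>Moving from d to the mean costs the distance between them, itself at most the
  oscillation around d. Hence \<open>BMO\<close> may be tested with any convenient constant.\<close>

lemma avg_oscillation_le:
  fixes f :: "real^'n \<Rightarrow> real"
  assumes Q: "Q \<in> cubes" and f: "integrable (lebesgue_on Q) f"
  shows "avg Q (\<lambda>x. \<bar>f x - avg Q f\<bar>) \<le> 2 * avg Q (\<lambda>x. \<bar>f x - d\<bar>)"
proof -
  define e where "e = avg Q f"
  have int: "integrable (lebesgue_on Q) (\<lambda>x. \<bar>f x - c\<bar>)" for c
    using f integrable_cube_const[OF Q] by auto
  have "(LINT x|lebesgue_on Q. \<bar>f x - e\<bar>) \<le> (LINT x|lebesgue_on Q. \<bar>f x - d\<bar> + \<bar>e - d\<bar>)"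
    by (intro integral_mono int Bochner_Integration.integrable_add integrable_cube_const[OF Q]) linarith
  also have "\<dots> = (LINT x|lebesgue_on Q. \<bar>f x - d\<bar>) + \<bar>e - d\<bar> * measure lebesgue Q"
    unfolding integral_cube_const[OF Q, symmetric]
    by (intro Bochner_Integration.integral_add int integrable_cube_const[OF Q])
  finally have "avg Q (\<lambda>x. \<bar>f x - e\<bar>) \<le> avg Q (\<lambda>x. \<bar>f x - d\<bar>) + \<bar>e - d\<bar>"
    using cubes_pos[OF Q] by (simp add: avg_def field_simps)
  then show ?thesis
    using abs_avg_diff_le[OF Q f, of d] by (simp add: e_def)
qed

text \<open>Since the constant of the quasi-triangle inequality may depend on \<open>Q\<close>, the average has to
  be absorbed pointwise: adding a multiple of the indicator of a suitable set keeps the function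
  in BMO and makes its deviation from the mean dominate the sum of the bumps on all of \<open>Q\<close>.\<close>

lemma bmo_embedding_imp_finite_sparse_bound:
  fixes X :: "(real^'n) set \<Rightarrow> (real^'n) fun_space"
  assumes \<eta>: "\<eta> > 0"
  shows "\<exists>K>0. \<forall>X :: (real^'n) set \<Rightarrow> (real^'n) fun_space. \<forall>C>0. \<forall>Q F.
    (\<forall>Q\<in>cubes. quasi_banach_function_space Q (X Q)) \<longrightarrow> bmo_embedding X C \<longrightarrow>
    Q \<in> cubes \<longrightarrow> finite F \<longrightarrow> F \<subseteq> dyadic_cubes Q \<longrightarrow> sparse \<eta> F \<longrightarrow>
    ext_norm (X Q) (\<lambda>x. real (card {P \<in> F. x \<in> P})) \<le> ennreal (K * C)"
proof -
  \<comment> \<open>Four times the bound 3^n / \<eta> for the average of the bump sum, so that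
    Chebyshev leaves at most a quarter of \<open>Q\<close> above \<open>T\<close>.\<close>
  define T where "T = 4 * 3 ^ CARD('n) / \<eta>"
  \<comment> \<open>If w, between 2^-n and 3/4, is the fraction of \<open>Q\<close> on which
    \<open>B\<close> is added, then B w is at least 2 T and B (1 - w) at least T.\<close>
  define B where "B = 2 * 2 ^ CARD('n) * T"
  define C0 where "C0 = 15 ^ CARD('n) / \<eta> + 2 * real CARD('n) * 6 ^ CARD('n)"
  define K where "K = 2 * (C0 + B)"
  have two_pow: "(2::real) \<le> 2 ^ CARD('n)"
    using power_increasing[of 1 "CARD('n)" "2::real"] by simp
  have T: "T > 0" using \<eta> by (simp add: T_def)
  have "4 * T \<le> B"
    unfolding B_def using two_pow T by (intro mult_right_mono) auto
  then have B: "B > 0" "4 * T \<le> B" using T by auto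
  have C0: "C0 > 0" using \<eta> by (simp add: C0_def add_pos_pos)
  have "ext_norm (X Q) (\<lambda>x. real (card {P \<in> F. x \<in> P})) \<le> ennreal (K * C)"
    if X: "\<forall>Q\<in>cubes. quasi_banach_function_space Q (X Q)" and emb: "bmo_embedding X C" and C: "C > 0"
      and Q: "Q \<in> cubes" and F: "finite F" "F \<subseteq> dyadic_cubes Q" "sparse \<eta> F"
    for X :: "(real^'n) set \<Rightarrow> (real^'n) fun_space" and C Q F
  proof -
    obtain a l where Qa: "Q = cube a l" "l > 0" using Q by (auto simp: cubes_def)
    define \<phi> where "\<phi> x = (\<Sum>P\<in>F. bump P x)" for x
    have sC: "P \<in> cubes" if "P \<in> F" for P
      using dyadic_cubes_cubes[OF Q] F that by blast
    have Qs: "Q \<in> sets lebesgue" by (rule cubes_sets[OF Q])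
    have q: "measure lebesgue Q > 0" by (rule cubes_pos[OF Q])
    have \<phi>_cont: "continuous_on UNIV \<phi>"
      unfolding \<phi>_def by (intro continuous_intros continuous_on_bump)
    have \<phi>_int: "integrable (lebesgue_on R) \<phi>" if "R \<in> cubes" for R
      by (rule integrable_continuous_cube[OF \<phi>_cont that])
    have \<phi>_nonneg: "0 \<le> \<phi> x" for x
      unfolding \<phi>_def by (intro sum_nonneg bump_nonneg)
    have card_le: "real (card {P \<in> F. x \<in> P}) \<le> \<phi> x" for x
    proof -
      have "real (card {P \<in> F. x \<in> P}) = (\<Sum>P | P \<in> F \<and> x \<in> P. bump P x)"
        by (simp add: bump_eq_1)
      also have "\<dots> \<le> \<phi> x"
        unfolding \<phi>_def using F(1) by (intro sum_mono2) (auto simp: bump_nonneg)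
      finally show ?thesis .
    qed
    have int_\<phi>: "(LINT x|lebesgue_on Q. \<phi> x) \<le> T / 4 * measure lebesgue Q"
    proof -
      have FQ: "{P. P \<in> F \<and> P \<subseteq> Q} = F"
        using F(2) dyadic_cubes_subset[OF Q] by blast
      have "(LINT x|lebesgue_on Q. \<phi> x) = (\<Sum>P\<in>F. LINT x|lebesgue_on Q. bump P x)"
        unfolding \<phi>_def by (intro Bochner_Integration.integral_sum integrable_continuous_cube Q continuous_on_bump)
      also have "\<dots> \<le> (\<Sum>P\<in>F. 3 ^ CARD('n) * measure lebesgue P)"
        by (intro sum_mono bump_integral_le sC Q)
      also have "\<dots> = 3 ^ CARD('n) * (\<Sum>P\<in>F. measure lebesgue P)"
        by (simp only: sum_distrib_left)
      also have "\<dots> \<le> 3 ^ CARD('n) * (measure lebesgue Q / \<eta>)"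
        using sparse_packing_finite[OF Q F \<eta> Q] unfolding FQ by (intro mult_left_mono) auto
      finally show ?thesis by (simp add: T_def)
    qed
    have avg_\<phi>: "0 \<le> avg Q \<phi>" "avg Q \<phi> \<le> T"
    proof -
      show "0 \<le> avg Q \<phi>"
        unfolding avg_def using \<phi>_nonneg by simp
      have "avg Q \<phi> \<le> T / 4"
        unfolding avg_def using int_\<phi> q by (simp add: field_simps)
      then show "avg Q \<phi> \<le> T" using T by simp
    qed
    define S where "S = {x \<in> Q. T < \<phi> x}"
    have "{x \<in> space (lebesgue_on Q). T < \<phi> x} \<in> sets (lebesgue_on Q)"
      using \<phi>_int[OF Q] by measurable
    then have SQ: "S \<in> sets (lebesgue_on Q)"
      using Qs by (simp add: S_def space_restrict_space)
    then have Ss: "S \<in> sets lebesgue"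
      using Qs by (simp add: sets_restrict_space_iff)
    have meas_Q: "(LINT x|lebesgue_on Q. indicator A x) = measure lebesgue A"
      and int_Q: "integrable (lebesgue_on Q) (indicator A :: _ \<Rightarrow> real)"
      if "A \<in> sets lebesgue" "A \<subseteq> Q" for A
    proof -
      have AQ: "A \<in> sets (lebesgue_on Q)"
        using that Qs by (simp add: sets_restrict_space_iff)
      then show "integrable (lebesgue_on Q) (indicator A :: _ \<Rightarrow> real)"
        by (intro finite_measure.integrable_const_bound[OF finite_measure_lebesgue_on_cube[OF Q], of _ 1]) auto
      have "A \<inter> Q = A" using that by auto
      then show "(LINT x|lebesgue_on Q. indicator A x) = measure lebesgue A"
        using AQ Qs that by (simp add: space_restrict_space measure_restrict_space)
    qed
    have S_le: "measure lebesgue S \<le> measure lebesgue Q / 4"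
    proof -
      have "T * measure lebesgue S = (LINT x|lebesgue_on Q. T * indicator S x)"
        using meas_Q[OF Ss] by (simp add: S_def)
      also have "\<dots> \<le> (LINT x|lebesgue_on Q. \<phi> x)"
      proof (rule integral_mono)
        show "integrable (lebesgue_on Q) (\<lambda>x. T * indicator S x)"
          by (intro integrable_mult_right int_Q Ss) (auto simp: S_def)
        show "T * indicator S x \<le> \<phi> x" for x
          using \<phi>_nonneg[of x] by (auto simp: S_def indicator_def)
      qed (rule \<phi>_int[OF Q])
      also note int_\<phi>
      finally show ?thesis using T by simp
    qed
    \<comment> \<open>\<open>S\<close> may be null, and raising the function there alone would not
      move the average. A corner subcube guarantees the fraction 2^-n, while the total stays at most
      3/4.\<close>
    define Q' where "Q' = cube a (l / 2)"
    have Q': "Q' \<in> sets lebesgue" "Q' \<subseteq> Q"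
    proof -
      show "Q' \<in> sets lebesgue" by (simp only: Q'_def cube_sets)
      have "l / 2 \<le> l" using Qa(2) by simp
      then show "Q' \<subseteq> Q"
        unfolding Q'_def Qa(1) cube_def by (fastforce intro: order.strict_trans2)
    qed
    have Q'_meas: "measure lebesgue Q' = measure lebesgue Q / 2 ^ CARD('n)"
      using Qa(2) measure_cube[of "l/2" a] measure_cube[of l a]
      unfolding Q'_def Qa(1) by (simp add: power_divide)
    define W where "W = Q' \<union> S"
    have W: "W \<in> sets lebesgue" "W \<subseteq> Q"
      using Q' Ss by (auto simp: W_def S_def)
    have Wm: "W \<in> lmeasurable"
      by (rule fmeasurableI2[OF cubes_lmeasurable[OF Q] W(2,1)])
    define w where "w = measure lebesgue W / measure lebesgue Q"
    have w: "1 / 2 ^ CARD('n) \<le> w" "w \<le> 3 / 4"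
    proof -
      have "measure lebesgue Q' \<le> measure lebesgue W"
        by (rule measure_mono_fmeasurable[OF _ Q'(1) Wm]) (auto simp: W_def)
      then show "1 / 2 ^ CARD('n) \<le> w"
        unfolding Q'_meas w_def using q by (simp add: field_simps)
      have "measure lebesgue W \<le> measure lebesgue Q' + measure lebesgue S"
        unfolding W_def by (rule measure_Un_le[OF Q'(1) Ss])
      also have "\<dots> \<le> measure lebesgue Q / 2 + measure lebesgue Q / 4"
        unfolding Q'_meas using S_le two_pow q by (intro add_mono divide_left_mono) auto
      finally show "w \<le> 3 / 4"
        unfolding w_def using q by (simp add: field_simps)
    qed
    define h where "h x = \<phi> x + B * indicator W x" for x
    have h_loc: "locally_integrable h"
      unfolding locally_integrable_def
    proof (intro allI impI)
      fix A :: "(real^'n) set" assume A: "compact A"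
      have 1: "set_integrable lebesgue A \<phi>"
        using locally_integrable_continuous[OF \<phi>_cont] A by (simp add: locally_integrable_def)
      have "A \<in> sets lebesgue"
        using A by (simp add: compact_imp_closed sets_completionI_sets borel_closed)
      moreover have "integrable lebesgue (\<lambda>x. B * indicator W x)"
        by (intro integrable_mult_right integrable_real_indicator W(1))
          (simp only: emeasure_eq_measure2[OF Wm] ennreal_less_top infinity_ennreal_def)
      ultimately have 2: "set_integrable lebesgue A (\<lambda>x. B * indicator W x)"
        unfolding set_integrable_def by (rule integrable_mult_indicator)
      show "h absolutely_integrable_on A"
        unfolding h_def by (rule set_integral_add(1)[OF 1 2])
    qed
    have h_osc: "avg R (\<lambda>x. \<bar>h x - avg R h\<bar>) \<le> K" if R: "R \<in> cubes" for R
    proof -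
      have h_int: "integrable (lebesgue_on R) h" by (rule locally_integrable_cube[OF h_loc R])
      obtain d where d: "avg R (\<lambda>x. \<bar>\<phi> x - d\<bar>) \<le> C0"
        using sum_bump_oscillation[OF Q F \<eta> R] unfolding \<phi>_def C0_def by blast
      have "(LINT x|lebesgue_on R. \<bar>h x - d\<bar>) \<le> (LINT x|lebesgue_on R. \<bar>\<phi> x - d\<bar> + B)"
      proof (rule integral_mono)
        show "integrable (lebesgue_on R) (\<lambda>x. \<bar>h x - d\<bar>)"
          by (intro integrable_abs Bochner_Integration.integrable_diff h_int integrable_cube_const[OF R])
        show "integrable (lebesgue_on R) (\<lambda>x. \<bar>\<phi> x - d\<bar> + B)"
          by (intro Bochner_Integration.integrable_add integrable_abs Bochner_Integration.integrable_diff
              \<phi>_int[OF R] integrable_cube_const[OF R])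
        show "\<bar>h x - d\<bar> \<le> \<bar>\<phi> x - d\<bar> + B" for x
          using B by (auto simp: h_def indicator_def)
      qed
      also have "\<dots> = (LINT x|lebesgue_on R. \<bar>\<phi> x - d\<bar>) + B * measure lebesgue R"
        unfolding integral_cube_const[OF R, symmetric]
        by (intro Bochner_Integration.integral_add integrable_abs Bochner_Integration.integrable_diff
            \<phi>_int[OF R] integrable_cube_const[OF R])
      finally have "avg R (\<lambda>x. \<bar>h x - d\<bar>) \<le> avg R (\<lambda>x. \<bar>\<phi> x - d\<bar>) + B"
        using cubes_pos[OF R] by (simp add: avg_def field_simps)
      then have "avg R (\<lambda>x. \<bar>h x - d\<bar>) \<le> C0 + B"
        by (rule order.trans[OF _ add_right_mono[OF d]])
      then show ?thesis
        unfolding K_def by (rule order.trans[OF avg_oscillation_le[OF R h_int, of d] mult_left_mono]) simp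
    qed
    have h_norm: "bmo_norm h \<le> ennreal K"
      unfolding bmo_norm_def using h_osc by (intro SUP_least ennreal_leI)
    have hB: "h \<in> BMO"
      using h_loc h_norm by (auto simp: BMO_def order.strict_trans1)
    have avg_h: "avg Q h = avg Q \<phi> + B * w"
    proof -
      have "(LINT x|lebesgue_on Q. h x) = (LINT x|lebesgue_on Q. \<phi> x) + B * measure lebesgue W"
        unfolding h_def using \<phi>_int[OF Q] int_Q[OF W] meas_Q[OF W]
        by (subst Bochner_Integration.integral_add) auto
      then show ?thesis
        by (simp add: avg_def w_def add_divide_distrib)
    qed
    \<comment> \<open>On \<open>W\<close> the added \<open>B\<close> outweighs the whole average,
      leaving at least the bump sum. Off \<open>W\<close> the bump sum is at most \<open>T\<close>,
      while the average is at least 2 T.\<close>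
    have dom: "\<phi> x \<le> \<bar>h x - avg Q h\<bar>" if x: "x \<in> Q" for x
    proof (cases "x \<in> W")
      case True
      have "B * w \<le> B * (3 / 4)"
        using w B by (intro mult_left_mono) auto
      moreover have "h x = \<phi> x + B" using True by (simp add: h_def)
      ultimately show ?thesis
        unfolding avg_h using avg_\<phi> B by linarith
    next
      case False
      then have "\<phi> x \<le> T" using x by (auto simp: W_def S_def)
      moreover have "2 * T \<le> B * w"
      proof -
        have "2 * T = B * (1 / 2 ^ CARD('n))" by (simp add: B_def)
        also have "\<dots> \<le> B * w" using w B by (intro mult_left_mono) auto
        finally show ?thesis .
      qed
      moreover have "h x = \<phi> x" using False by (simp add: h_def)
      ultimately show ?thesis
        unfolding avg_h using avg_\<phi>(1) by linarith
    qed
    have "(\<lambda>x. real (card {P \<in> F. x \<in> P})) \<in> borel_measurable lebesgue"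
      using F(1) sC cubes_sets by (intro borel_measurable_card_sets countable_finite) auto
    then have meas: "(\<lambda>x. real (card {P \<in> F. x \<in> P})) \<in> borel_measurable (lebesgue_on Q)"
      by (rule measurable_restrict_space1)
    have "ext_norm (X Q) (\<lambda>x. real (card {P \<in> F. x \<in> P})) \<le> ennreal 1 * ext_norm (X Q) (\<lambda>x. h x - avg Q h)"
      using X Q order.trans[OF card_le dom]
      by (intro ext_norm_mono[OF _ meas] AE_lebesgue_on[OF Q]) auto
    also have "\<dots> \<le> bmo_X_norm X h"
      unfolding bmo_X_norm_def ennreal_1 mult_1 using Q by (rule SUP_upper)
    also have "\<dots> \<le> ennreal C * bmo_norm h"
      using emb hB unfolding bmo_embedding_def by blast
    also have "\<dots> \<le> ennreal C * ennreal K"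
      by (intro mult_left_mono h_norm zero_le)
    also have "\<dots> = ennreal (K * C)"
      using C C0 B by (subst ennreal_mult[symmetric]) (auto simp: K_def mult.commute)
    finally show ?thesis .
  qed
  moreover have "K > 0" using C0 B by (simp add: K_def)
  ultimately show ?thesis by blast
qed

text \<open>Infinite sparse families are exhausted by finite ones, using the Fatou property.\<close>

lemma bmo_embedding_imp_sparse_bound:
  assumes \<eta>: "\<eta> > 0"
  shows "\<exists>K>0. \<forall>X :: (real^'n) set \<Rightarrow> (real^'n) fun_space. \<forall>C>0.
    (\<forall>Q\<in>cubes. quasi_banach_function_space Q (X Q)) \<longrightarrow> bmo_embedding X C \<longrightarrow> sparse_bound \<eta> X (K * C)"
proof -
  obtain K where K: "K > 0" and bound: "\<forall>X :: (real^'n) set \<Rightarrow> (real^'n) fun_space. \<forall>C>0. \<forall>Q F.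
    (\<forall>Q\<in>cubes. quasi_banach_function_space Q (X Q)) \<longrightarrow> bmo_embedding X C \<longrightarrow>
    Q \<in> cubes \<longrightarrow> finite F \<longrightarrow> F \<subseteq> dyadic_cubes Q \<longrightarrow> sparse \<eta> F \<longrightarrow>
    ext_norm (X Q) (\<lambda>x. real (card {P \<in> F. x \<in> P})) \<le> ennreal (K * C)"
    using bmo_embedding_imp_finite_sparse_bound[OF \<eta>, where 'n = 'n] by (elim exE conjE)
  have "sparse_bound \<eta> X (K * C)"
    if X: "\<forall>Q\<in>cubes. quasi_banach_function_space Q (X Q)" and emb: "bmo_embedding X C" and C: "C > 0"
    for X :: "(real^'n) set \<Rightarrow> (real^'n) fun_space" and C
    unfolding sparse_bound_def
  proof (intro ballI allI impI)
    fix Q :: "(real^'n) set" and F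
    assume Q: "Q \<in> cubes" and "F \<subseteq> dyadic_cubes Q \<and> sparse \<eta> F"
    then have F: "F \<subseteq> dyadic_cubes Q" "sparse \<eta> F" by auto
    have sC: "P \<in> cubes" if "P \<in> F" for P
      using dyadic_cubes_cubes[OF Q] F that by blast
    have KC: "0 \<le> K * C" using K C by simp
    \<comment> \<open>The members of \<open>F\<close> among the first N + 1 cubes of an enumeration
      of all dyadic cubes.\<close>
    define D where "D N = F \<inter> from_nat_into (dyadic_cubes Q) ` {..N}" for N :: nat
    have D: "finite (D N)" "D N \<subseteq> F" for N by (auto simp: D_def)
    have D_mono: "D M \<subseteq> D N" if "M \<le> N" for M N using that by (auto simp: D_def)
    have range: "range (from_nat_into (dyadic_cubes Q)) = dyadic_cubes Q"
      using dyadic_cubes.self by (intro range_from_nat_into countable_dyadic_cubes[OF Q]) blast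
    have D_UN: "\<exists>N. P \<in> D N" if P: "P \<in> F" for P
    proof -
      obtain N where "P = from_nat_into (dyadic_cubes Q) N"
        using range P F(1) by blast
      then show ?thesis using P by (auto simp: D_def)
    qed
    define g where "g N x = real (card {P \<in> D N. x \<in> P})" for N x
    define f where "f x = real (card {P \<in> F. x \<in> P})" for x
    have g_ext: "ext_norm (X Q) (g N) \<le> ennreal (K * C)" for N
      unfolding g_def
      by (rule bound[THEN spec, THEN spec, THEN mp, OF C, THEN spec, THEN spec, THEN mp, OF X, THEN mp, OF emb,
            THEN mp, OF Q, THEN mp, OF D(1), THEN mp, OF order.trans[OF D(2) F(1)], THEN mp,
            OF sparse_subset[OF Q F D(2)]])
    have g_mem: "g N \<in> members (X Q)" for N
      using g_ext[of N] by (auto simp: ext_norm_def top_unique split: if_splits)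
    have g_norm: "qnorm (X Q) (g N) \<le> K * C" for N
      using g_ext[of N] g_mem[of N] KC by (simp add: ext_norm_def ennreal_le_iff)
    have "f \<in> borel_measurable lebesgue"
      unfolding f_def using F sC cubes_sets countable_subset[OF F(1) countable_dyadic_cubes[OF Q]]
      by (intro borel_measurable_card_sets) auto
    then have f: "f \<in> borel_measurable (lebesgue_on Q)"
      by (rule measurable_restrict_space1)
    \<comment> \<open>Convergence holds where finitely many cubes contain \<open>x\<close>;
      elsewhere the finite counts are unbounded while \<open>f\<close> has the default value
      0.\<close>
    have AE: "AE x in lebesgue_on Q. (\<forall>N. 0 \<le> g N x) \<and> incseq (\<lambda>N. g N x) \<and> (\<lambda>N. g N x) \<longlonglongrightarrow> f x"
    proof (intro AE_lebesgue_on[OF Q])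
      show "AE x in lebesgue. x \<in> Q \<longrightarrow> (\<forall>N. 0 \<le> g N x) \<and> incseq (\<lambda>N. g N x) \<and> (\<lambda>N. g N x) \<longlonglongrightarrow> f x"
        using sparse_AE_finite[OF Q F \<eta>]
      proof eventually_elim
        case (elim x)
        have "incseq (\<lambda>N. g N x)"
        proof (rule incseq_SucI)
          fix N
          have "{P \<in> D N. x \<in> P} \<subseteq> {P \<in> D (Suc N). x \<in> P}"
            using D_mono[of N "Suc N"] by auto
          then show "g N x \<le> g (Suc N) x"
            unfolding g_def using D(1) by (simp add: card_mono)
        qed
        moreover have "(\<lambda>N. g N x) \<longlonglongrightarrow> f x"
        proof -
          obtain n where n: "\<And>P. P \<in> F \<Longrightarrow> P \<in> D (n P)" using D_UN by metis
          define N where "N = Max (insert 0 (n ` {P \<in> F. x \<in> P}))"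
          have "g M x = f x" if "M \<ge> N" for M
          proof -
            have "P \<in> D M" if P: "P \<in> F" "x \<in> P" for P
            proof -
              have "n P \<le> N" unfolding N_def using elim P by (intro Max_ge) auto
              then show ?thesis using n[OF P(1)] D_mono[of "n P" M] \<open>M \<ge> N\<close> by auto
            qed
            then have "{P \<in> D M. x \<in> P} = {P \<in> F. x \<in> P}" using D(2) by blast
            then show ?thesis by (simp add: g_def f_def)
          qed
          then show ?thesis
            by (intro tendsto_eventually) (auto simp: eventually_sequentially)
        qed
        ultimately show ?case by (simp add: g_def)
      qed
    qed
    have bdd: "bdd_above (range (\<lambda>N. qnorm (X Q) (g N)))"
      using g_norm by (intro bdd_aboveI2)
    have XQ: "quasi_banach_function_space Q (X Q)" using X Q by blast
    note fatou = XQ[unfolded quasi_banach_function_space_def, THEN conjunct2, THEN conjunct2,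
        THEN conjunct2, THEN conjunct2, rule_format, of g f]
    have "f \<in> members (X Q) \<and> qnorm (X Q) f = (SUP N. qnorm (X Q) (g N))"
      by (rule fatou) (use g_mem f AE bdd in blast)
    moreover have "(SUP N. qnorm (X Q) (g N)) \<le> K * C"
      using g_norm by (intro cSUP_least) auto
    ultimately have "ext_norm (X Q) f \<le> ennreal (K * C)"
      by (auto simp: ext_norm_def intro!: ennreal_leI)
    moreover have "f = (\<lambda>x. \<Sum>\<^sub>\<infinity>P\<in>F. indicator P x)"
      using infsum_indicator_eq_card[of "\<lambda>P. P" _ F] by (auto simp: f_def)
    ultimately show "ext_norm (X Q) (\<lambda>x. \<Sum>\<^sub>\<infinity>P\<in>F. indicator P x) \<le> ennreal (K * C)"
      by simp
  qed
  with K show ?thesis by blast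
qed

text \<open>Dividing by \<open>K\<close> reduces the claim to each admissible constant. If
  \<open>P\<close> admits none, its best constant is infinite and the bound is trivial.\<close>

lemma best_const_le:
  assumes "K > 0" "\<And>C. C > 0 \<Longrightarrow> P C \<Longrightarrow> R (K * C)"
  shows "best_const R \<le> ennreal K * best_const P"
proof -
  have "best_const R / ennreal K \<le> best_const P"
    unfolding best_const_def[of P]
  proof (rule Inf_greatest)
    fix z assume "z \<in> {ennreal C | C. C > 0 \<and> P C}"
    then obtain C where C: "z = ennreal C" "C > 0" "R (K * C)"
      using assms(2) by auto
    then have "best_const R \<le> ennreal (K * C)"
      unfolding best_const_def using assms(1) by (intro Inf_lower) auto
    then show "best_const R / ennreal K \<le> z"
      using C assms(1) by (intro divide_le_posI_ennreal) (auto simp: ennreal_mult)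
  qed
  then have "best_const R / ennreal K * ennreal K \<le> best_const P * ennreal K"
    by (rule mult_right_mono) simp
  moreover have "best_const R / ennreal K * ennreal K = best_const R"
    using assms(1) by (intro ennreal_divide_mult_cancel) auto
  ultimately show ?thesis by (simp add: mult.commute)
qed

theorem theorem3p3:
  fixes \<eta> \<gamma> :: real
  assumes "0 < \<eta>" "\<eta> < 1" "0 < \<gamma>" "\<gamma> < 1"
  shows "(\<forall>X :: (real^'n) set \<Rightarrow> (real^'n) fun_space. normalized_family X \<longrightarrow>
            ((\<exists>C1>0. bmo_embedding X C1) \<longleftrightarrow> (\<exists>C2>0. sparse_bound \<eta> X C2)) \<and>
            ((\<exists>C2>0. sparse_bound \<eta> X C2) \<longleftrightarrow> (\<exists>C3>0. nested_bound \<gamma> X C3)) \<and>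
            ((\<exists>C3>0. nested_bound \<gamma> X C3) \<longleftrightarrow> (\<exists>C4>0. expL_bound X C4))) \<and>
         (\<forall>c0>0. \<forall>c1>0. \<exists>K>0. \<forall>X :: (real^'n) set \<Rightarrow> (real^'n) fun_space.
            normalized_with c0 c1 X \<longrightarrow>
            (let Cs = {best_const (bmo_embedding X), best_const (sparse_bound \<eta> X),
                       best_const (nested_bound \<gamma> X), best_const (expL_bound X)}
             in \<forall>A\<in>Cs. \<forall>B\<in>Cs. A \<le> ennreal K * B))"
proof -
  define qb :: "((real^'n) set \<Rightarrow> (real^'n) fun_space) \<Rightarrow> bool"
    where "qb X \<longleftrightarrow> (\<forall>Q\<in>cubes. quasi_banach_function_space Q (X Q))" for X
  obtain K1 where K1: "K1 > 0" "\<And>X C. qb X \<Longrightarrow> C > 0 \<Longrightarrow> bmo_embedding X C \<Longrightarrow> sparse_bound \<eta> X (K1 * C)"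
    using bmo_embedding_imp_sparse_bound[OF assms(1), where 'n = 'n] unfolding qb_def by blast
  obtain K2 where K2: "K2 > 0" "\<And>X C. qb X \<Longrightarrow> C > 0 \<Longrightarrow> sparse_bound \<eta> X C \<Longrightarrow> expL_bound X (K2 * C)"
    using sparse_bound_imp_expL_bound[OF assms(1,2), where 'n = 'n] unfolding qb_def by blast
  define K3 :: real where "K3 = 2 * 2 ^ CARD('n) / ln (4 / 3)"
  have K3: "K3 > 0" by (simp add: K3_def)
  have K3': "bmo_embedding X (K3 * C)" if "C > 0" "expL_bound X C"
    for X :: "(real^'n) set \<Rightarrow> (real^'n) fun_space" and C
    unfolding K3_def by (rule expL_bound_imp_bmo_embedding[OF that(2,1)])
  obtain K4 where K4: "K4 > 0" "\<And>X C. qb X \<Longrightarrow> C > 0 \<Longrightarrow> nested_bound \<gamma> X C \<Longrightarrow> expL_bound X (K4 * C)"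
    using nested_bound_imp_expL_bound[OF assms(3,4), where 'n = 'n] unfolding qb_def by blast
  define K5 where "K5 = 1 / ln (2 / (1 + \<gamma>))"
  have K5: "K5 > 0" using assms by (simp add: K5_def)
  have K5': "nested_bound \<gamma> X (K5 * C)" if "C > 0" "expL_bound X C"
    for X :: "(real^'n) set \<Rightarrow> (real^'n) fun_space" and C
    unfolding K5_def by (rule expL_bound_imp_nested_bound[OF assms(3,4) that(2,1)])
  have equiv: "((\<exists>C1>0. bmo_embedding X C1) \<longleftrightarrow> (\<exists>C2>0. sparse_bound \<eta> X C2)) \<and>
      ((\<exists>C2>0. sparse_bound \<eta> X C2) \<longleftrightarrow> (\<exists>C3>0. nested_bound \<gamma> X C3)) \<and>
      ((\<exists>C3>0. nested_bound \<gamma> X C3) \<longleftrightarrow> (\<exists>C4>0. expL_bound X C4))" if X: "qb X" for X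
  proof -
    have 1: "(\<exists>C>0. bmo_embedding X C) \<Longrightarrow> (\<exists>C>0. sparse_bound \<eta> X C)"
      using K1 X mult_pos_pos by metis
    have 2: "(\<exists>C>0. sparse_bound \<eta> X C) \<Longrightarrow> (\<exists>C>0. expL_bound X C)"
      using K2 X mult_pos_pos by metis
    have 3: "(\<exists>C>0. expL_bound X C) \<Longrightarrow> (\<exists>C>0. bmo_embedding X C)"
      using K3 K3' mult_pos_pos by metis
    have 4: "(\<exists>C>0. nested_bound \<gamma> X C) \<Longrightarrow> (\<exists>C>0. expL_bound X C)"
      using K4 X mult_pos_pos by metis
    have 5: "(\<exists>C>0. expL_bound X C) \<Longrightarrow> (\<exists>C>0. nested_bound \<gamma> X C)"
      using K5 K5' mult_pos_pos by metis
    show ?thesis using 1 2 3 4 5 by blast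
  qed
  \<comment> \<open>A common bound for all five factors; the summand 1 makes its powers
    increasing.\<close>
  define L where "L = 1 + K1 + K2 + K3 + K4 + K5"
  have L: "1 \<le> L" "K1 \<le> L" "K2 \<le> L" "K3 \<le> L" "K4 \<le> L" "K5 \<le> L"
    using K1(1) K2(1) K3 K4(1) K5 by (simp_all add: L_def)
  have const: "A \<le> ennreal (L ^ 4) * B"
    if X: "qb X" and AB: "A \<in> {best_const (bmo_embedding X), best_const (sparse_bound \<eta> X),
        best_const (nested_bound \<gamma> X), best_const (expL_bound X)}"
      "B \<in> {best_const (bmo_embedding X), best_const (sparse_bound \<eta> X),
        best_const (nested_bound \<gamma> X), best_const (expL_bound X)}" for X A B
  proof -
    let ?b1 = "best_const (bmo_embedding X)" and ?b2 = "best_const (sparse_bound \<eta> X)"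
      and ?b3 = "best_const (nested_bound \<gamma> X)" and ?b4 = "best_const (expL_bound X)"
    have up: "x \<le> ennreal L * y" if "x \<le> ennreal k * y" "k \<le> L" for x y k
      using that by (meson ennreal_leI mult_right_mono order_trans zero_le)
    have tr: "x \<le> ennreal (L ^ (i + j)) * z" if "x \<le> ennreal (L ^ i) * y" "y \<le> ennreal (L ^ j) * z" for x y z i j
    proof -
      have "x \<le> ennreal (L ^ i) * (ennreal (L ^ j) * z)"
        using that by (meson mult_left_mono order_trans zero_le)
      then show ?thesis using L(1) by (simp add: power_add ennreal_mult mult.assoc)
    qed
    have 21: "?b2 \<le> ennreal (L ^ 1) * ?b1"
      using up[OF best_const_le[OF K1(1), of "bmo_embedding X" "sparse_bound \<eta> X"]] K1(2)[OF X] L by simp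
    have 42: "?b4 \<le> ennreal (L ^ 1) * ?b2"
      using up[OF best_const_le[OF K2(1), of "sparse_bound \<eta> X" "expL_bound X"]] K2(2)[OF X] L by simp
    have 14: "?b1 \<le> ennreal (L ^ 1) * ?b4"
      using up[OF best_const_le[OF K3, of "expL_bound X" "bmo_embedding X"]] K3' L by simp
    have 43: "?b4 \<le> ennreal (L ^ 1) * ?b3"
      using up[OF best_const_le[OF K4(1), of "nested_bound \<gamma> X" "expL_bound X"]] K4(2)[OF X] L by simp
    have 34: "?b3 \<le> ennreal (L ^ 1) * ?b4"
      using up[OF best_const_le[OF K5, of "expL_bound X" "nested_bound \<gamma> X"]] K5' L by simp
    have more: "x \<le> ennreal (L ^ j) * y" if "x \<le> ennreal (L ^ i) * y" "i \<le> j" for x y i j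
    proof -
      have "ennreal (L ^ i) \<le> ennreal (L ^ j)"
        using that(2) L(1) by (intro ennreal_leI power_increasing)
      then show ?thesis using that(1) by (meson mult_right_mono order_trans zero_le)
    qed
    have 44: "?b4 \<le> ennreal (L ^ 0) * ?b4" by simp
    \<comment> \<open>The best constant of (iv) is the hub: every other one is reached from it, and
      leads back to it, in at most two implications, whence L^2 twice.\<close>
    have A4: "A \<le> ennreal (L ^ 2) * ?b4"
      using AB(1) more[OF 14, of 2] tr[OF 21 14, unfolded one_add_one] more[OF 34, of 2] more[OF 44, of 2]
      by (elim insertE emptyE) (simp_all only: one_le_numeral zero_le)
    have B4: "?b4 \<le> ennreal (L ^ 2) * B"
      using AB(2) tr[OF 42 21, unfolded one_add_one] more[OF 42, of 2] more[OF 43, of 2] more[OF 44, of 2]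
      by (elim insertE emptyE) (simp_all only: one_le_numeral zero_le)
    show ?thesis using tr[OF A4 B4] by simp
  qed
  have "0 < L ^ 4" using L(1) by simp
  then have "\<exists>K>0. \<forall>X :: (real^'n) set \<Rightarrow> (real^'n) fun_space.
            normalized_with c0 c1 X \<longrightarrow>
            (let Cs = {best_const (bmo_embedding X), best_const (sparse_bound \<eta> X),
                       best_const (nested_bound \<gamma> X), best_const (expL_bound X)}
             in \<forall>A\<in>Cs. \<forall>B\<in>Cs. A \<le> ennreal K * B)" for c0 c1
    unfolding Let_def normalized_with_def
    by (intro exI[of _ "L ^ 4"] conjI allI impI ballI const) (auto simp only: qb_def)
  moreover have "qb X" if "normalized_family X" for X
    using that unfolding normalized_family_def normalized_with_def qb_def by blast
  ultimately show ?thesis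
    by (intro conjI allI impI) (use equiv in blast)+
qed

end
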